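(* Let $p\geq 3$ and $n\geq 2$ be integers, and let $a,b\in\mathbb{R}$ satisfy $$-2\leq a\leq \xi(p,n):=-2+\frac{(p-2)(n+2)}{2(2p+n-2)}\quad\text{and}\quad b\geq 0.$$ Let $X\sim N_p(\theta,\eta^{-1}I_p)$ and $S\sim \eta^{-1}\chi^2_n$ be independent, with $\theta\in\mathbb{R}^p$ and $\eta>0$ both unknown, and consider estimation of $\theta$ under the loss $\eta\|\delta-\theta\|^2$. Then the generalized Bayes estimator $\delta_*$ of $\theta$ with respect to the improper prior $$\pi_*(\theta,\eta)=\frac{1}{\eta}\int_0^\infty\frac{\eta^{p/2}}{(2\pi)^{p/2}g^{p/2}}\exp\left(-\frac{\eta}{2g}\|\theta\|^2\right)\pi(g)\,dg,\qquad \pi(g)=\frac{1}{(g+1)^{a+2}}\left(\frac{g}{g+1}\right)^b,$$ is minimax, and it is admissible among the class of all estimators.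
   Context: The observation is $(X,S)$, where $X$ and $S$ are independent with densities $f(x\mid\theta,\eta)=\frac{\eta^{p/2}}{(2\pi)^{p/2}}\exp(-\eta\|x-\theta\|^2/2)$ on $\mathbb{R}^p$ and $f(s\mid\eta)=\frac{\eta^{n/2}s^{n/2-1}}{\Gamma(n/2)2^{n/2}}\exp(-\eta s/2)$ on $(0,\infty)$. An estimator is a measurable function $\delta(x,s)\in\mathbb{R}^p$; its risk is $R(\delta;\theta,\eta)=E_{\theta,\eta}[\eta\|\delta(X,S)-\theta\|^2]\in[0,\infty]$. An estimator $\delta$ is admissible (among all estimators) if there is no estimator $\delta'$ with $R(\delta';\theta,\eta)\le R(\delta;\theta,\eta)$ for all $(\theta,\eta)\in\mathbb{R}^p\times(0,\infty)$ and strict inequality for some $(\theta,\eta)$. An estimator $\delta$ is minimax if $\sup_{\theta,\eta}R(\delta;\theta,\eta)=\inf_{\delta'}\sup_{\theta,\eta}R(\delta';\theta,\eta)$, the infimum being over all estimators; the estimator $X$, which has constant risk $p$, is minimax. The generalized Bayes estimator is $$\delta_*(x,s)=\frac{\iint \eta\,\theta\,\pi_*(\theta,\eta)f(x\mid\theta,\eta)f(s\mid\eta)\,d\theta\,d\eta}{\iint \eta\,\pi_*(\theta,\eta)f(x\mid\theta,\eta)f(s\mid\eta)\,d\theta\,d\eta},$$ which is given explicitly by $$\delta_*(x,s)=\left(1-\frac{\int_0^\infty (g+1)^{-p/2-1}\bigl(1+\|x\|^2/\{s(g+1)\}\bigr)^{-p/2-n/2-1}\pi(g)\,dg}{\int_0^\infty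 (g+1)^{-p/2}\bigl(1+\|x\|^2/\{s(g+1)\}\bigr)^{-p/2-n/2-1}\pi(g)\,dg}\right)x.$$ *)

theory Defs
  imports "HOL-Analysis.Analysis"
begin

definition pos_lborel :: "real measure" where
  "pos_lborel = restrict_space lborel {0<..}"

text \<open>The dimension \<open>p\<close> is the cardinality of the index type \<open>'p\<close>.\<close>

definition normal_dens :: "real ^ 'p \<Rightarrow> real \<Rightarrow> real ^ 'p \<Rightarrow> real" where
  "normal_dens \<theta> \<eta> x =
     \<eta> powr (real CARD('p) / 2) / (2 * pi) powr (real CARD('p) / 2)
       * exp (- \<eta> * (norm (x - \<theta>))\<^sup>2 / 2)"

definition chisq_dens :: "nat \<Rightarrow> real \<Rightarrow> real \<Rightarrow> real" where
  "chisq_dens n \<eta> s =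
     \<eta> powr (real n / 2) * s powr (real n / 2 - 1)
       / (Gamma (real n / 2) * 2 powr (real n / 2)) * exp (- \<eta> * s / 2)"

text \<open>The joint law of the independent pair \<open>(X, S)\<close>; its underlying space is
  \<open>UNIV \<times> {0<..}\<close>, so the values of an estimator at \<open>s \<le> 0\<close> are irrelevant throughout.\<close>

definition sampling_law :: "nat \<Rightarrow> real ^ 'p \<Rightarrow> real \<Rightarrow> ((real ^ 'p) \<times> real) measure" where
  "sampling_law n \<theta> \<eta> =
     density lborel (\<lambda>x. ennreal (normal_dens \<theta> \<eta> x))
       \<Otimes>\<^sub>M density pos_lborel (\<lambda>s. ennreal (chisq_dens n \<eta> s))"

definition estimator :: "((real ^ 'p) \<times> real \<Rightarrow> real ^ 'p) \<Rightarrow> bool" where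
  "estimator \<delta> \<longleftrightarrow> \<delta> \<in> borel_measurable (lborel \<Otimes>\<^sub>M pos_lborel)"

definition risk :: "nat \<Rightarrow> ((real ^ 'p) \<times> real \<Rightarrow> real ^ 'p) \<Rightarrow> real ^ 'p \<Rightarrow> real \<Rightarrow> ennreal" where
  "risk n \<delta> \<theta> \<eta> = (\<integral>\<^sup>+ z. ennreal (\<eta> * (norm (\<delta> z - \<theta>))\<^sup>2) \<partial>sampling_law n \<theta> \<eta>)"

definition admissible :: "nat \<Rightarrow> ((real ^ 'p) \<times> real \<Rightarrow> real ^ 'p) \<Rightarrow> bool" where
  "admissible n \<delta> \<longleftrightarrow> estimator \<delta> \<and>
     \<not> (\<exists>\<delta>'. estimator \<delta>' \<and>
            (\<forall>\<theta>. \<forall>\<eta>>0. risk n \<delta>' \<theta> \<eta> \<le> risk n \<delta> \<theta> \<eta>) \<and>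
            (\<exists>\<theta>. \<exists>\<eta>>0. risk n \<delta>' \<theta> \<eta> < risk n \<delta> \<theta> \<eta>))"

definition sup_risk :: "nat \<Rightarrow> ((real ^ 'p) \<times> real \<Rightarrow> real ^ 'p) \<Rightarrow> ennreal" where
  "sup_risk n \<delta> = (SUP (\<theta>, \<eta>) \<in> UNIV \<times> {0<..}. risk n \<delta> \<theta> \<eta>)"

definition minimax :: "nat \<Rightarrow> ((real ^ 'p) \<times> real \<Rightarrow> real ^ 'p) \<Rightarrow> bool" where
  "minimax n \<delta> \<longleftrightarrow> estimator \<delta> \<and>
     sup_risk n \<delta> = (INF \<delta>' \<in> {\<delta>' :: (real ^ 'p) \<times> real \<Rightarrow> real ^ 'p. estimator \<delta>'}. sup_risk n \<delta>')"

text \<open>The (possibly improper) prior enters as a measure on \<open>(\<theta>, \<eta>)\<close>. The extra factor \<open>\<eta>\<close> in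
  both integrals comes from the loss \<open>\<eta> * (norm (\<delta> - \<theta>))\<^sup>2\<close>.\<close>

definition gen_bayes ::
    "nat \<Rightarrow> ((real ^ 'p) \<times> real) measure \<Rightarrow> (real ^ 'p) \<times> real \<Rightarrow> real ^ 'p" where
  "gen_bayes n \<nu> = (\<lambda>(x, s).
     (\<integral>(\<theta>, \<eta>). (\<eta> * normal_dens \<theta> \<eta> x * chisq_dens n \<eta> s) *\<^sub>R \<theta> \<partial>\<nu>) /\<^sub>R
     (\<integral>(\<theta>, \<eta>). \<eta> * normal_dens \<theta> \<eta> x * chisq_dens n \<eta> s \<partial>\<nu>))"

definition mixing_dens :: "real \<Rightarrow> real \<Rightarrow> real \<Rightarrow> real" where
  "mixing_dens a b g = 1 / (g + 1) powr (a + 2) * (g / (g + 1)) powr b"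

text \<open>The density is \<open>ennreal\<close>-valued because the integral over \<open>g\<close> can diverge at \<open>\<theta> = 0\<close>
  (a null set).\<close>

definition prior_dens :: "real \<Rightarrow> real \<Rightarrow> real ^ 'p \<Rightarrow> real \<Rightarrow> ennreal" where
  "prior_dens a b \<theta> \<eta> = ennreal (1 / \<eta>) *
     (\<integral>\<^sup>+ g. ennreal (\<eta> powr (real CARD('p) / 2)
                   / ((2 * pi) powr (real CARD('p) / 2) * g powr (real CARD('p) / 2))
                 * exp (- \<eta> / (2 * g) * (norm \<theta>)\<^sup>2) * mixing_dens a b g) \<partial>pos_lborel)"

definition prior_measure :: "real \<Rightarrow> real \<Rightarrow> ((real ^ 'p) \<times> real) measure" where
  "prior_measure a b = density (lborel \<Otimes>\<^sub>M pos_lborel) (\<lambda>(\<theta>, \<eta>). prior_dens a b \<theta> \<eta>)"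

definition \<xi> :: "nat \<Rightarrow> nat \<Rightarrow> real" where
  "\<xi> p n = -2 + (real p - 2) * (real n + 2) / (2 * (2 * real p + real n - 2))"

end

theory Submission
  imports Defs "HOL-Probability.Probability"
begin

text \<open>Given the latent \<open>g\<close>, the parameter \<open>\<theta>\<close> integrates out of the prior, so the generalized Bayes
  estimator is \<open>(1 - Q w) x\<close>, where \<open>w = (norm x)\<^sup>2 / s\<close> and \<open>Q w\<close> is the posterior mean of \<open>1 / (g + 1)\<close>.

  Minimaxity: \<open>w * Q w\<close> is nondecreasing, because the posterior of \<open>w / (g + 1)\<close> has monotone likelihood
  ratio in \<open>w\<close>, and it is at most \<open>2 * (p - 2) / (n + 2)\<close>. Baranchik's argument then gives risk at most
  \<open>p\<close>; the Stein and chi-square identities in it are replaced by inequalities obtained from scaling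
  \<open>x\<close> and \<open>s\<close>. That no estimator has smaller maximal risk follows from the priors \<open>\<theta> \<sim> N(0, \<tau> I)\<close>,
  \<open>\<eta> = 1\<close>, as \<open>\<tau> \<rightarrow> \<infinity>\<close>.

  Admissibility: Blyth's method with the prior multiplied by \<open>H\<^sup>2\<close>, where \<open>H\<close> is a cutoff in
  \<open>\<bar>ln \<eta>\<bar> + ln (g + 1)\<close>. The excess Bayes risk is at most a constant times the Dirichlet energy
  of \<open>H\<close> in the variables \<open>(ln \<eta>, ln (g + 1))\<close>. At the boundary \<open>a = -2\<close> this is the energy of
  planar Brownian motion, which is recurrent, so the energy can be made arbitrarily small.\<close>

section \<open>Gaussian integrals\<close>

text \<open>The two halves are linked: the risk bound \<open>p\<close> proved for minimaxity makes
  the integrated risks under the truncated priors finite, so that they can be subtracted. The value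
  \<xi> solves \<open>(p / 2 + a + 1) / (n / 2 - a - 1) = 2 * (p - 2) / (n + 2)\<close> for
  \<open>a\<close>: the left side is the limit of \<open>w * Q w\<close> at infinity, the right side
  Baranchik's constant. The same bound forces \<open>a + 2 < n / 2\<close>, the moment condition of
  the admissibility half. The Bayes rule of a truncated prior is never computed. A competitor is
  written as the generalized Bayes rule plus \<open>d\<close>; half of the quadratic gain in
  \<open>d\<close> survives against an error free of \<open>d\<close>. At \<open>a = -2\<close> this
  error has no decay of its own in the logarithmic plane, so smallness must come from the cutoff:
  the squared gradient of \<open>(1 + r) powr (- \<epsilon>)\<close> is about
  \<open>\<epsilon>\<^sup>2 * (1 + r) powr (- 2 - 2 * \<epsilon>)\<close>, with planar integral of
  order \<epsilon>. The cutoff is compared with its value at the typical posterior point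
  \<open>\<eta> = 1 / s\<close>, \<open>g = w\<close>, because \<open>\<eta> * s\<close> and
  \<open>(1 + w) / (g + 1)\<close> have posterior moments of small order bounded uniformly in the
  data.\<close>

lemma space_pos_lborel [simp]: "space pos_lborel = {0<..}"
  by (simp add: pos_lborel_def space_restrict_space)

lemma measurable_pos_lborelD [measurable (raw)]:
  "f \<in> M \<rightarrow>\<^sub>M pos_lborel \<Longrightarrow> f \<in> borel_measurable M"
  unfolding pos_lborel_def by (auto simp: measurable_restrict_space2_iff)

lemma borel_measurable_pos_lborelI:
  "f \<in> borel_measurable borel \<Longrightarrow> f \<in> borel_measurable pos_lborel"
  unfolding pos_lborel_def by (simp add: measurable_restrict_space1)

interpretation pos_lborel: sigma_finite_measure pos_lborel
  unfolding pos_lborel_def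
  by (rule sigma_finite_measure_restrict_space) (auto intro: lborel.sigma_finite_measure_axioms)

abbreviation pos_plane :: "(real \<times> real) measure" where
  "pos_plane \<equiv> pos_lborel \<Otimes>\<^sub>M pos_lborel"

interpretation pos2: pair_sigma_finite pos_lborel pos_lborel ..

interpretation sample: pair_sigma_finite "lborel :: (real ^ 'p) measure" pos_lborel ..

lemma nn_integral_pos_lborel:
  "(\<integral>\<^sup>+x. f x \<partial>pos_lborel) = (\<integral>\<^sup>+x. f x * indicator {0<..} x \<partial>lborel)"
  unfolding pos_lborel_def by (subst nn_integral_restrict_space) auto

lemma normal_dens_measurable [measurable]:
  assumes [measurable]: "f \<in> borel_measurable M" "g \<in> borel_measurable M" "h \<in> borel_measurable M"
  shows "(\<lambda>x. normal_dens (f x) (g x) (h x)) \<in> borel_measurable M"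
  unfolding normal_dens_def by measurable

lemma chisq_dens_measurable [measurable]:
  assumes [measurable]: "f \<in> borel_measurable M" "g \<in> borel_measurable M"
  shows "(\<lambda>x. chisq_dens n (f x) (g x)) \<in> borel_measurable M"
  unfolding chisq_dens_def by measurable

lemma mixing_dens_measurable [measurable]:
  assumes [measurable]: "f \<in> borel_measurable M"
  shows "(\<lambda>x. mixing_dens a b (f x)) \<in> borel_measurable M"
  unfolding mixing_dens_def by measurable

lemma normal_dens_nonneg [simp]: "normal_dens \<theta> \<eta> x \<ge> 0"
  by (simp add: normal_dens_def)

lemma normal_dens_pos: "\<eta> > 0 \<Longrightarrow> normal_dens \<theta> \<eta> x > 0"
  by (simp add: normal_dens_def)

lemma chisq_dens_nonneg [simp]: "chisq_dens n \<eta> s \<ge> 0"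
  by (cases "n = 0") (auto simp add: chisq_dens_def intro!: divide_nonneg_nonneg mult_nonneg_nonneg Gamma_real_nonneg)

lemma chisq_dens_pos: "n > 0 \<Longrightarrow> \<eta> > 0 \<Longrightarrow> s > 0 \<Longrightarrow> chisq_dens n \<eta> s > 0"
  by (simp add: chisq_dens_def Gamma_real_pos)

lemma mixing_dens_nonneg [simp]: "mixing_dens a b g \<ge> 0"
  by (simp add: mixing_dens_def)

lemma mixing_dens_pos: "g > 0 \<Longrightarrow> mixing_dens a b g > 0"
  by (simp add: mixing_dens_def)

lemma mixing_dens_le: "g > 0 \<Longrightarrow> b \<ge> 0 \<Longrightarrow> mixing_dens a b g \<le> (g + 1) powr (- a - 2)"
proof -
  assume "g > 0" "b \<ge> 0"
  then have "(g / (g + 1)) powr b \<le> 1" by (intro powr_le1) auto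
  then have "mixing_dens a b g \<le> 1 / (g + 1) powr (a + 2) * 1"
    unfolding mixing_dens_def using \<open>g > 0\<close> by (intro mult_left_mono) auto
  also have "\<dots> = (g + 1) powr (- a - 2)"
    using powr_minus_divide[of "g + 1" "a + 2"] by (simp add: algebra_simps)
  finally show ?thesis .
qed

section \<open>Multivariate normal densities: mass, moments and conjugacy\<close>

lemma power2_norm_eq_sum_Basis:
  fixes x :: "'a :: euclidean_space"
  shows "(norm x)\<^sup>2 = (\<Sum>b\<in>Basis. (x \<bullet> b)\<^sup>2)"
  unfolding power2_norm_eq_inner by (subst euclidean_inner) (simp add: power2_eq_square)

text \<open>Independence of the coordinates reduces the moments below to one-dimensional ones. Since
  \<eta> is a precision, each coordinate has standard deviation
  \<open>1 / sqrt \<eta>\<close>.\<close>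

lemma normal_dens_eq_prod:
  fixes \<theta> x :: "real ^ 'p"
  assumes "\<eta> > 0"
  shows "normal_dens \<theta> \<eta> x = (\<Prod>b\<in>Basis. normal_density (\<theta> \<bullet> b) (1 / sqrt \<eta>) (x \<bullet> b))"
proof -
  have "(\<Prod>b\<in>Basis. normal_density (\<theta> \<bullet> b) (1 / sqrt \<eta>) (x \<bullet> b))
     = (\<Prod>b\<in>(Basis :: (real ^ 'p) set). (\<eta> / (2 * pi)) powr (1/2) * exp (- \<eta> / 2 * ((x - \<theta>) \<bullet> b)\<^sup>2))"
    using assms
    by (intro prod.cong refl) (simp add: normal_density_def powr_half_sqrt real_sqrt_divide
         inner_diff_left field_simps real_sqrt_mult)
  also have "\<dots> = ((\<eta> / (2 * pi)) powr (1/2)) ^ CARD('p) * exp (\<Sum>b\<in>(Basis :: (real ^ 'p) set). - \<eta> / 2 * ((x - \<theta>) \<bullet> b)\<^sup>2)"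
    by (simp add: prod.distrib exp_sum)
  also have "((\<eta> / (2 * pi)) powr (1/2)) ^ CARD('p) = \<eta> powr (real CARD('p) / 2) / (2 * pi) powr (real CARD('p) / 2)"
    using assms by (simp add: powr_realpow[symmetric] powr_powr powr_divide)
  also have "(\<Sum>b\<in>(Basis :: (real ^ 'p) set). - \<eta> / 2 * ((x - \<theta>) \<bullet> b)\<^sup>2) = - \<eta> / 2 * (norm (x - \<theta>))\<^sup>2"
    unfolding sum_distrib_left[symmetric] power2_norm_eq_sum_Basis ..
  finally show ?thesis
    by (simp add: normal_dens_def algebra_simps)
qed

lemma nn_integral_normal_dens:
  fixes \<theta> :: "real ^ 'p"
  assumes "\<eta> > 0"
  shows "(\<integral>\<^sup>+x. ennreal (normal_dens \<theta> \<eta> x) \<partial>lborel) = 1"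
proof -
  have s: "0 < 1 / sqrt \<eta>" using assms by simp
  have "(\<integral>\<^sup>+x. ennreal (normal_dens \<theta> \<eta> x) \<partial>lborel)
     = (\<integral>\<^sup>+x. (\<Prod>b\<in>Basis. ennreal (normal_density (\<theta> \<bullet> b) (1 / sqrt \<eta>) (x \<bullet> b))) \<partial>(lborel :: (real^'p) measure))"
    using assms by (simp add: normal_dens_eq_prod prod_ennreal)
  also have "\<dots> = (\<Prod>b\<in>(Basis :: (real^'p) set). \<integral>\<^sup>+x. ennreal (normal_density (\<theta> \<bullet> b) (1 / sqrt \<eta>) x) \<partial>lborel)"
    by (rule nn_integral_lborel_prod) auto
  also have "\<dots> = 1"
    using s by (intro prod.neutral) (auto simp: nn_integral_eq_integral integrable_normal_density integral_normal_density)
  finally show ?thesis .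
qed

lemma integrable_normal_dens:
  "\<eta> > 0 \<Longrightarrow> integrable lborel (normal_dens \<theta> \<eta>)"
  by (rule integrableI_nonneg) (auto simp: nn_integral_normal_dens)

lemma integral_normal_dens:
  "\<eta> > 0 \<Longrightarrow> (\<integral>x. normal_dens \<theta> \<eta> x \<partial>lborel) = 1"
  by (subst integral_eq_nn_integral) (auto simp: nn_integral_normal_dens)

lemma nn_integral_normal_dens_coord:
  fixes \<theta> :: "real ^ 'p"
  assumes "\<eta> > 0" and i: "i \<in> Basis"
  shows "(\<integral>\<^sup>+x. ennreal (normal_dens \<theta> \<eta> x * ((x - \<theta>) \<bullet> i)\<^sup>2) \<partial>lborel) = ennreal (1 / \<eta>)"
proof -
  let ?n = "\<lambda>b. normal_density (\<theta> \<bullet> b) (1 / sqrt \<eta>)"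
  have s: "0 < 1 / sqrt \<eta>" using assms by simp
  \<comment> \<open>The square is put into the factor of coordinate \<open>i\<close> alone, so that
    the integral still factorizes.\<close>
  have eq: "normal_dens \<theta> \<eta> x * ((x - \<theta>) \<bullet> i)\<^sup>2
      = (\<Prod>b\<in>Basis. ?n b (x \<bullet> b) * (if b = i then (x \<bullet> b - \<theta> \<bullet> b)\<^sup>2 else 1))" for x
    using assms by (subst normal_dens_eq_prod) (auto simp: prod.distrib inner_diff_left prod.delta)
  have "(\<integral>\<^sup>+x. ennreal (normal_dens \<theta> \<eta> x * ((x - \<theta>) \<bullet> i)\<^sup>2) \<partial>lborel)
     = (\<integral>\<^sup>+x. (\<Prod>b\<in>Basis. ennreal (?n b (x \<bullet> b) * (if b = i then (x \<bullet> b - \<theta> \<bullet> b)\<^sup>2 else 1))) \<partial>(lborel :: (real^'p) measure))"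
    unfolding eq by (subst prod_ennreal) auto
  also have "\<dots> = (\<Prod>b\<in>(Basis :: (real^'p) set). \<integral>\<^sup>+x. ennreal (?n b x * (if b = i then (x - \<theta> \<bullet> b)\<^sup>2 else 1)) \<partial>lborel)"
    by (rule nn_integral_lborel_prod) auto
  also have "\<dots> = (\<Prod>b\<in>(Basis :: (real^'p) set). if b = i then ennreal (1 / \<eta>) else 1)"
  proof (intro prod.cong refl)
    fix b :: "real ^ 'p"
    show "(\<integral>\<^sup>+x. ennreal (?n b x * (if b = i then (x - \<theta> \<bullet> b)\<^sup>2 else 1)) \<partial>lborel) = (if b = i then ennreal (1 / \<eta>) else 1)"
    proof (cases "b = i")
      case True
      have "(\<integral>\<^sup>+x. ennreal (?n b x * (x - \<theta> \<bullet> b)\<^sup>2) \<partial>lborel) = ennreal (\<integral>x. ?n b x * (x - \<theta> \<bullet> b)\<^sup>2 \<partial>lborel)"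
        using s by (intro nn_integral_eq_integral integrable_normal_moment) auto
      also have "(\<integral>x. ?n b x * (x - \<theta> \<bullet> b)\<^sup>2 \<partial>lborel) = 1 / \<eta>"
        using integral_normal_moment_even[OF s, of "\<theta> \<bullet> b" 1] assms
        by (simp add: fact_numeral power_divide)
      finally show ?thesis using True by simp
    next
      case False
      then show ?thesis using s
        by (auto simp: nn_integral_eq_integral integrable_normal_density integral_normal_density)
    qed
  qed
  also have "\<dots> = ennreal (1 / \<eta>)" using i by (simp add: prod.delta)
  finally show ?thesis .
qed

lemma nn_integral_normal_dens_norm:
  fixes \<theta> :: "real ^ 'p"
  assumes "\<eta> > 0"
  shows "(\<integral>\<^sup>+x. ennreal (normal_dens \<theta> \<eta> x * (norm (x - \<theta>))\<^sup>2) \<partial>lborel) = ennreal (real CARD('p) / \<eta>)"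
proof -
  have "normal_dens \<theta> \<eta> x * (norm (x - \<theta>))\<^sup>2 = (\<Sum>i\<in>Basis. normal_dens \<theta> \<eta> x * ((x - \<theta>) \<bullet> i)\<^sup>2)" for x
    by (simp add: power2_norm_eq_sum_Basis sum_distrib_left)
  then have "(\<integral>\<^sup>+x. ennreal (normal_dens \<theta> \<eta> x * (norm (x - \<theta>))\<^sup>2) \<partial>lborel)
    = (\<integral>\<^sup>+x. (\<Sum>i\<in>Basis. ennreal (normal_dens \<theta> \<eta> x * ((x - \<theta>) \<bullet> i)\<^sup>2)) \<partial>lborel)"
    by (subst sum_ennreal) auto
  also have "\<dots> = (\<Sum>i\<in>(Basis :: (real^'p) set). ennreal (1 / \<eta>))"
    by (subst nn_integral_sum) (auto simp: nn_integral_normal_dens_coord assms)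
  also have "\<dots> = ennreal (real CARD('p) / \<eta>)"
    using assms by (subst sum_ennreal) auto
  finally show ?thesis .
qed

lemma integrable_normal_dens_norm:
  fixes \<theta> :: "real ^ 'p"
  assumes "\<eta> > 0"
  shows "integrable lborel (\<lambda>x. normal_dens \<theta> \<eta> x * (norm (x - \<theta>))\<^sup>2)"
  using assms by (intro integrableI_nonneg) (auto simp: nn_integral_normal_dens_norm)

lemma integrable_normal_dens_scaleR:
  fixes f :: "real ^ 'p \<Rightarrow> 'b :: {banach, second_countable_topology}"
  assumes \<eta>: "\<eta> > 0" and [measurable]: "f \<in> borel_measurable borel"
    and b: "\<And>x. norm (f x) \<le> A + B * (norm (x - \<theta>))\<^sup>2"
  shows "integrable lborel (\<lambda>x. normal_dens \<theta> \<eta> x *\<^sub>R f x)"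
proof (rule Bochner_Integration.integrable_bound)
  show "integrable lborel (\<lambda>x. A * normal_dens \<theta> \<eta> x + B * (normal_dens \<theta> \<eta> x * (norm (x - \<theta>))\<^sup>2))"
    using \<eta> by (intro Bochner_Integration.integrable_add integrable_mult_right integrable_normal_dens integrable_normal_dens_norm)
  show "AE x in lborel. norm (normal_dens \<theta> \<eta> x *\<^sub>R f x)
    \<le> norm (A * normal_dens \<theta> \<eta> x + B * (normal_dens \<theta> \<eta> x * (norm (x - \<theta>))\<^sup>2))"
  proof (rule AE_I2)
    fix x
    have "norm (normal_dens \<theta> \<eta> x *\<^sub>R f x) \<le> normal_dens \<theta> \<eta> x * (A + B * (norm (x - \<theta>))\<^sup>2)"
      using b[of x] by (simp add: mult_left_mono)
    also have "\<dots> \<le> norm (A * normal_dens \<theta> \<eta> x + B * (normal_dens \<theta> \<eta> x * (norm (x - \<theta>))\<^sup>2))"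
      by (simp add: algebra_simps)
    finally show "norm (normal_dens \<theta> \<eta> x *\<^sub>R f x)
    \<le> norm (A * normal_dens \<theta> \<eta> x + B * (normal_dens \<theta> \<eta> x * (norm (x - \<theta>))\<^sup>2))" .
  qed
qed simp

lemma norm_le_one_plus_sq: "norm x \<le> 1 + (norm x)\<^sup>2"
  using zero_le_power2[of "norm x - 1/2"] by (simp add: power2_eq_square algebra_simps)

lemma sq_sum_le: "(x + y)\<^sup>2 \<le> 2 * x\<^sup>2 + 2 * (y :: real)\<^sup>2"
  using zero_le_power2[of "x - y"] by (simp add: power2_eq_square algebra_simps)

lemma norm_sq_le_shift:
  fixes x y :: "'a :: real_normed_vector"
  shows "(norm x)\<^sup>2 \<le> 2 * (norm y)\<^sup>2 + 2 * (norm (x - y))\<^sup>2"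
proof -
  have "norm x \<le> norm y + norm (x - y)" using norm_triangle_ineq[of y "x - y"] by simp
  then have "(norm x)\<^sup>2 \<le> (norm y + norm (x - y))\<^sup>2" by (intro power_mono) auto
  also note sq_sum_le
  finally show ?thesis .
qed

text \<open>Reflection in the point \<theta> preserves Lebesgue measure and the density and reverses
  the sign of the integrand.\<close>

lemma integral_normal_dens_centered:
  fixes \<theta> :: "real ^ 'p"
  assumes "\<eta> > 0"
  shows "(\<integral>x. normal_dens \<theta> \<eta> x *\<^sub>R (x - \<theta>) \<partial>lborel) = 0"
proof -
  have "(\<integral>x. normal_dens \<theta> \<eta> x *\<^sub>R (x - \<theta>) \<partial>lborel)
      = (\<integral>x. normal_dens \<theta> \<eta> x *\<^sub>R (x - \<theta>) \<partial>(density (distr lborel borel (\<lambda>x. 2 *\<^sub>R \<theta> + (-1) *\<^sub>R x)) (\<lambda>_. 1)))"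
    using lborel_affine[of "-1" "2 *\<^sub>R \<theta>"] by simp
  also have "\<dots> = (\<integral>x. normal_dens \<theta> \<eta> (2 *\<^sub>R \<theta> - x) *\<^sub>R (2 *\<^sub>R \<theta> - x - \<theta>) \<partial>lborel)"
    by (simp add: density_1 integral_distr)
  also have "\<dots> = (\<integral>x. - (normal_dens \<theta> \<eta> x *\<^sub>R (x - \<theta>)) \<partial>lborel)"
  proof (intro Bochner_Integration.integral_cong refl)
    fix x :: "real ^ 'p"
    have "2 *\<^sub>R \<theta> - x - \<theta> = \<theta> - x" by (simp add: scaleR_2)
    then show "normal_dens \<theta> \<eta> (2 *\<^sub>R \<theta> - x) *\<^sub>R (2 *\<^sub>R \<theta> - x - \<theta>) = - (normal_dens \<theta> \<eta> x *\<^sub>R (x - \<theta>))"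
      unfolding normal_dens_def by (simp only: norm_minus_commute[of \<theta> x] scaleR_minus_right[symmetric] minus_diff_eq)
  qed
  also have "\<dots> = - (\<integral>x. normal_dens \<theta> \<eta> x *\<^sub>R (x - \<theta>) \<partial>lborel)" by simp
  finally have "2 *\<^sub>R (\<integral>x. normal_dens \<theta> \<eta> x *\<^sub>R (x - \<theta>) \<partial>lborel) = 0"
    unfolding scaleR_2 eq_neg_iff_add_eq_0 .
  then show ?thesis unfolding scaleR_eq_0_iff by auto
qed

lemma integral_normal_dens_scaleR_id:
  fixes \<theta> :: "real ^ 'p"
  assumes \<eta>: "\<eta> > 0"
  shows "(\<integral>x. normal_dens \<theta> \<eta> x *\<^sub>R x \<partial>lborel) = \<theta>"
proof -
  have i1: "integrable lborel (\<lambda>x. normal_dens \<theta> \<eta> x *\<^sub>R (x - \<theta>))"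
    using \<eta> norm_le_one_plus_sq by (intro integrable_normal_dens_scaleR[where A=1 and B=1]) auto
  have i2: "integrable lborel (\<lambda>x. normal_dens \<theta> \<eta> x *\<^sub>R \<theta>)"
    by (intro integrable_scaleR_left integrable_normal_dens[OF \<eta>])
  have e: "normal_dens \<theta> \<eta> x *\<^sub>R x = normal_dens \<theta> \<eta> x *\<^sub>R (x - \<theta>) + normal_dens \<theta> \<eta> x *\<^sub>R \<theta>" for x
    by (simp add: algebra_simps)
  show "(\<integral>x. normal_dens \<theta> \<eta> x *\<^sub>R x \<partial>lborel) = \<theta>"
    unfolding e using i1 i2 \<eta> integrable_normal_dens[OF \<eta>, of \<theta>]
    by (simp add: integral_normal_dens_centered integral_normal_dens)
qed

text \<open>Bias-variance decomposition. In its main applications the roles are exchanged: the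
  integration variable is the parameter, the centre is a posterior mean and \<open>v\<close> is the
  value of an estimator.\<close>

lemma nn_integral_normal_dens_sq_dist:
  fixes \<theta> v :: "real ^ 'p"
  assumes \<eta>: "\<eta> > 0"
  shows "(\<integral>\<^sup>+x. ennreal (normal_dens \<theta> \<eta> x * (norm (x - v))\<^sup>2) \<partial>lborel)
       = ennreal ((norm (\<theta> - v))\<^sup>2 + real CARD('p) / \<eta>)"
proof -
  have e: "normal_dens \<theta> \<eta> x * (norm (x - v))\<^sup>2 = normal_dens \<theta> \<eta> x * (norm (x - \<theta>))\<^sup>2
     + 2 * ((normal_dens \<theta> \<eta> x *\<^sub>R (x - \<theta>)) \<bullet> (\<theta> - v)) + normal_dens \<theta> \<eta> x * (norm (\<theta> - v))\<^sup>2" for x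
  proof -
    have "(norm (x - v))\<^sup>2 = (norm ((x - \<theta>) + (\<theta> - v)))\<^sup>2" by simp
    also have "\<dots> = (norm (x - \<theta>))\<^sup>2 + 2 * ((x - \<theta>) \<bullet> (\<theta> - v)) + (norm (\<theta> - v))\<^sup>2"
      unfolding power2_norm_eq_inner by (simp only: inner_add_left inner_add_right inner_commute)
    finally show ?thesis by (simp only: inner_scaleR_left distrib_left mult.left_commute mult.assoc)
  qed
  have i1: "integrable lborel (\<lambda>x. normal_dens \<theta> \<eta> x *\<^sub>R (x - \<theta>))"
    using \<eta> norm_le_one_plus_sq by (intro integrable_normal_dens_scaleR[where A=1 and B=1]) auto
  note i2 = integrable_normal_dens[OF \<eta>, of \<theta>] and i3 = integrable_normal_dens_norm[OF \<eta>, of \<theta>]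
  have i3': "(\<integral>x. normal_dens \<theta> \<eta> x * (norm (x - \<theta>))\<^sup>2 \<partial>lborel) = real CARD('p) / \<eta>"
    using \<eta> by (subst integral_eq_nn_integral) (auto simp: nn_integral_normal_dens_norm)
  have i: "integrable lborel (\<lambda>x. normal_dens \<theta> \<eta> x * (norm (x - v))\<^sup>2)"
    unfolding e by (intro Bochner_Integration.integrable_add integrable_mult_right integrable_inner_left integrable_mult_left i1 i2 i3)
  have "(\<integral>\<^sup>+x. ennreal (normal_dens \<theta> \<eta> x * (norm (x - v))\<^sup>2) \<partial>lborel)
     = ennreal (\<integral>x. normal_dens \<theta> \<eta> x * (norm (x - v))\<^sup>2 \<partial>lborel)"
    using i by (intro nn_integral_eq_integral) auto
  also have "(\<integral>x. normal_dens \<theta> \<eta> x * (norm (x - v))\<^sup>2 \<partial>lborel) = (norm (\<theta> - v))\<^sup>2 + real CARD('p) / \<eta>"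
  proof -
    have "(\<integral>x. normal_dens \<theta> \<eta> x * (norm (x - v))\<^sup>2 \<partial>lborel)
      = (\<integral>x. normal_dens \<theta> \<eta> x * (norm (x - \<theta>))\<^sup>2 \<partial>lborel)
      + 2 * (\<integral>x. (normal_dens \<theta> \<eta> x *\<^sub>R (x - \<theta>)) \<bullet> (\<theta> - v) \<partial>lborel)
      + (\<integral>x. normal_dens \<theta> \<eta> x \<partial>lborel) * (norm (\<theta> - v))\<^sup>2"
      unfolding e
      by (subst Bochner_Integration.integral_add;
          (subst Bochner_Integration.integral_add)?;
          (intro Bochner_Integration.integrable_add integrable_mult_right integrable_inner_left integrable_mult_left i1 i2 i3)?)
         (simp only: Bochner_Integration.integral_mult_right_zero Bochner_Integration.integral_mult_left_zero)
    also have "(\<integral>x. (normal_dens \<theta> \<eta> x *\<^sub>R (x - \<theta>)) \<bullet> (\<theta> - v) \<partial>lborel) = 0"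
      by (subst integral_inner_left[OF i1]) (simp add: integral_normal_dens_centered[OF \<eta>])
    finally show ?thesis by (simp add: i3' integral_normal_dens[OF \<eta>])
  qed
  finally show ?thesis .
qed

text \<open>Completing the square in \<theta>. Given \<open>g\<close>, the parameter has prior
  precision \<open>\<eta> / g\<close>; the right side is the marginal density of \<open>x\<close>
  times the posterior density of \<theta>. Each later integration over \<theta> against the prior
  goes through this identity.\<close>

lemma normal_dens_mult:
  fixes \<theta> x :: "real ^ 'p"
  assumes \<eta>: "\<eta> > 0" and g: "g > 0"
  shows "normal_dens \<theta> \<eta> x * normal_dens 0 (\<eta> / g) \<theta>
       = normal_dens 0 (\<eta> / (g + 1)) x * normal_dens ((g / (g + 1)) *\<^sub>R x) (\<eta> * (g + 1) / g) \<theta>"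
proof -
  let ?p = "real CARD('p) / 2"
  have 1: "- \<eta> * (norm (x - \<theta>))\<^sup>2 / 2 + - (\<eta> / g) * (norm \<theta>)\<^sup>2 / 2
    = - (\<eta> / (g + 1)) * (norm x)\<^sup>2 / 2 + - (\<eta> * (g + 1) / g) * (norm (\<theta> - (g / (g + 1)) *\<^sub>R x))\<^sup>2 / 2"
  proof -
    define X where "X = x \<bullet> x" define T where "T = \<theta> \<bullet> \<theta>" define C where "C = \<theta> \<bullet> x"
    have a: "(norm (x - \<theta>))\<^sup>2 = X - 2 * C + T"
      unfolding power2_norm_eq_inner X_def T_def C_def by (simp add: algebra_simps inner_commute)
    have c: "(norm x)\<^sup>2 = X" "(norm \<theta>)\<^sup>2 = T"
      unfolding power2_norm_eq_inner X_def T_def by auto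
    \<comment> \<open>The weight that the posterior mean puts on \<open>x\<close>. In terms of
      \<open>r\<close> the precisions are \<open>\<eta> * (1 - r)\<close>, \<open>\<eta> / r\<close>
      and \<open>\<eta> / r - \<eta>\<close>, which leaves a polynomial identity.\<close>
    define r where "r = g / (g + 1)"
    have r: "\<eta> / (g + 1) = \<eta> * (1 - r)" "\<eta> * (g + 1) / g = \<eta> / r" "\<eta> / g = \<eta> / r - \<eta>" "r > 0"
      using g by (auto simp: r_def field_simps)
    have "\<eta> / r * (T - 2 * r * C + r\<^sup>2 * X) = \<eta> / r * T - 2 * \<eta> * C + \<eta> * r * X"
      using r(4) by (simp add: field_simps power2_eq_square)
    moreover have b: "(norm (\<theta> - r *\<^sub>R x))\<^sup>2 = T - 2 * r * C + r\<^sup>2 * X"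
      unfolding power2_norm_eq_inner X_def T_def C_def by (simp add: algebra_simps inner_commute power2_eq_square)
    ultimately have B: "- (\<eta> / r) * (norm (\<theta> - r *\<^sub>R x))\<^sup>2 / 2 = - (\<eta> / r * T - 2 * \<eta> * C + \<eta> * r * X) / 2"
      by simp
    show ?thesis unfolding r_def[symmetric] r(1-3) B a c by (simp add: algebra_simps add_divide_distrib diff_divide_distrib)
  qed
  have 2: "\<eta> powr ?p * (\<eta> / g) powr ?p = (\<eta> / (g + 1)) powr ?p * (\<eta> * (g + 1) / g) powr ?p"
    using \<eta> g by (simp add: powr_mult[symmetric])
  define u1 u2 u3 u4 where "u1 = - \<eta> * (norm (x - \<theta>))\<^sup>2 / 2" and "u2 = - (\<eta> / g) * (norm \<theta>)\<^sup>2 / 2"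
    and "u3 = - (\<eta> / (g + 1)) * (norm x)\<^sup>2 / 2"
    and "u4 = - (\<eta> * (g + 1) / g) * (norm (\<theta> - (g / (g + 1)) *\<^sub>R x))\<^sup>2 / 2"
  define w1 w2 w3 w4 where "w1 = \<eta> powr ?p" and "w2 = (\<eta> / g) powr ?p"
    and "w3 = (\<eta> / (g + 1)) powr ?p" and "w4 = (\<eta> * (g + 1) / g) powr ?p"
  have "exp u1 * exp u2 = exp u3 * exp u4"
    using 1 unfolding u1_def u2_def u3_def u4_def exp_add[symmetric] by (rule arg_cong)
  moreover have "w1 * w2 = w3 * w4" using 2 unfolding w1_def w2_def w3_def w4_def .
  ultimately have "(w1 * w2) * (exp u1 * exp u2) = (w3 * w4) * (exp u3 * exp u4)" by simp
  then show ?thesis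
    unfolding normal_dens_def diff_0_right u1_def[symmetric] u2_def[symmetric] u3_def[symmetric] u4_def[symmetric]
      w1_def[symmetric] w2_def[symmetric] w3_def[symmetric] w4_def[symmetric]
    by (simp add: mult_ac)
qed

section \<open>The mixture over precision and latent scale\<close>

lemma nn_integral_powr_tail:
  assumes "\<alpha> > 1" "w \<ge> 0"
  shows "(\<integral>\<^sup>+g. ennreal ((g + 1) powr (- \<alpha>)) * indicator {w..} g \<partial>lborel) = ennreal ((1 + w) powr (1 - \<alpha>) / (\<alpha> - 1))"
proof -
  have "(\<integral>\<^sup>+g. ennreal ((g + 1) powr (- \<alpha>)) * indicator {w..} g \<partial>lborel)
      = ennreal (0 - ((w + 1) powr (1 - \<alpha>) / (1 - \<alpha>)))"
  proof (rule nn_integral_FTC_atLeast)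
    show "((\<lambda>g. (g + 1) powr (1 - \<alpha>) / (1 - \<alpha>)) \<longlongrightarrow> 0) at_top"
      using assms by real_asymp
    fix x assume "w \<le> x"
    then have "((\<lambda>g. (g + 1) powr (1 - \<alpha>)) has_real_derivative (1 - \<alpha>) * (x + 1) powr (- \<alpha>)) (at x)"
      using assms by (auto intro!: derivative_eq_intros)
    from DERIV_cdivide[OF this, of "1 - \<alpha>"]
    show "((\<lambda>g. (g + 1) powr (1 - \<alpha>) / (1 - \<alpha>)) has_real_derivative (x + 1) powr - \<alpha>) (at x)"
      using assms by simp
  qed auto
  also have "0 - ((w + 1) powr (1 - \<alpha>) / (1 - \<alpha>)) = (1 + w) powr (1 - \<alpha>) / (\<alpha> - 1)"
    by (metis add.commute diff_0 minus_diff_eq minus_divide_right)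
  finally show ?thesis .
qed

lemma nn_integral_powr_initial:
  assumes "\<gamma> > 0" "w \<ge> 0"
  shows "(\<integral>\<^sup>+g. ennreal ((g + 1) powr (\<gamma> - 1)) * indicator {0..w} g \<partial>lborel) \<le> ennreal ((1 + w) powr \<gamma> / \<gamma>)"
proof -
  have "(\<integral>\<^sup>+g. ennreal ((g + 1) powr (\<gamma> - 1)) * indicator {0..w} g \<partial>lborel)
      = ennreal ((w + 1) powr \<gamma> / \<gamma> - (0 + 1) powr \<gamma> / \<gamma>)"
  proof (rule nn_integral_FTC_Icc)
    fix x assume "x \<in> {0..w}"
    then show "((\<lambda>g. (g + 1) powr \<gamma> / \<gamma>) has_real_derivative (x + 1) powr (\<gamma> - 1)) (at x)"
      using assms by (auto intro!: derivative_eq_intros simp: field_simps)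
  qed (use assms in auto)
  also have "\<dots> \<le> ennreal ((1 + w) powr \<gamma> / \<gamma>)"
    using assms by (intro ennreal_leI) (simp add: add.commute)
  finally show ?thesis .
qed

text \<open>The integral is split at \<open>g = w\<close>. Above \<open>w\<close> the second factor
  is at most 1 and the tail of the first one gives \<open>(1 + w) powr (1 - \<alpha>)\<close>, which
  uses \<open>\<alpha> > 1\<close>. Below \<open>w\<close> the second factor behaves like a power of
  \<open>(g + 1) / (1 + w)\<close>, and \<open>\<gamma> + 1 > \<alpha>\<close> makes the remaining
  power grow, so that its integral is governed by the endpoint \<open>w\<close>. Both parts are of
  the same order.\<close>

lemma nn_integral_beta_bound:
  assumes "\<alpha> > 1" "\<gamma> + 1 > \<alpha>" "w \<ge> 0"
  shows "(\<integral>\<^sup>+g. ennreal ((g + 1) powr (- \<alpha>) * (1 + w / (g + 1)) powr (- \<gamma>)) \<partial>pos_lborel)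
     \<le> ennreal ((1 / (\<alpha> - 1) + 1 / (\<gamma> - \<alpha> + 1)) * (1 + w) powr (1 - \<alpha>))"
proof -
  define \<delta> where "\<delta> = \<gamma> - \<alpha> + 1"
  have \<delta>: "\<delta> > 0" and \<gamma>: "\<gamma> > 0" using assms by (auto simp: \<delta>_def)
  have pw: "ennreal ((g + 1) powr (- \<alpha>) * (1 + w / (g + 1)) powr (- \<gamma>)) * indicator {0<..} g
     \<le> ennreal ((g + 1) powr (- \<alpha>)) * indicator {w..} g
        + ennreal ((1 + w) powr (- \<gamma>)) * (ennreal ((g + 1) powr (\<delta> - 1)) * indicator {0..w} g)" for g
  proof (cases "g > 0")
    case g: True
    show ?thesis
    proof (cases "g \<ge> w")
      case True
      have "(1 + w / (g + 1)) powr (- \<gamma>) \<le> (1 + w / (g + 1)) powr 0"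
        using g assms \<gamma> by (intro powr_mono) auto
      moreover have "1 + w / (g + 1) \<noteq> 0"
        using g assms by (intro less_imp_neq[symmetric] add_pos_nonneg) auto
      ultimately have "(g + 1) powr (- \<alpha>) * (1 + w / (g + 1)) powr (- \<gamma>) \<le> (g + 1) powr (- \<alpha>) * 1"
        using g assms by (intro mult_left_mono) auto
      then have "ennreal ((g + 1) powr (- \<alpha>) * (1 + w / (g + 1)) powr (- \<gamma>)) \<le> ennreal ((g + 1) powr (- \<alpha>))"
        by (intro ennreal_leI) simp
      then show ?thesis using True g by (auto simp: add_increasing2)
    next
      case False
      \<comment> \<open>\<open>1 + w / (g + 1)\<close> is at least \<open>(1 + w) / (g + 1)\<close>
        because \<open>g\<close> is positive; the negative exponent turns this into an upper
        bound.\<close>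
      have "(1 + w / (g + 1)) powr (- \<gamma>) \<le> ((1 + w) / (g + 1)) powr (- \<gamma>)"
        using g assms \<gamma> by (intro powr_mono2') (auto simp: field_simps)
      also have "\<dots> = (1 + w) powr (- \<gamma>) * (g + 1) powr \<gamma>"
        using g assms by (simp add: powr_divide powr_minus field_simps)
      finally have "(g + 1) powr (- \<alpha>) * (1 + w / (g + 1)) powr (- \<gamma>)
        \<le> (g + 1) powr (- \<alpha>) * ((1 + w) powr (- \<gamma>) * (g + 1) powr \<gamma>)"
        by (intro mult_left_mono) auto
      also have "\<dots> = (1 + w) powr (- \<gamma>) * (g + 1) powr (\<delta> - 1)"
        by (simp add: \<delta>_def powr_add[symmetric] mult_ac)
      finally show ?thesis using False g
        by (auto simp: ennreal_mult[symmetric] intro!: ennreal_leI)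
    qed
  qed auto
  have "(\<integral>\<^sup>+g. ennreal ((g + 1) powr (- \<alpha>) * (1 + w / (g + 1)) powr (- \<gamma>)) \<partial>pos_lborel)
     \<le> (\<integral>\<^sup>+g. ennreal ((g + 1) powr (- \<alpha>)) * indicator {w..} g
        + ennreal ((1 + w) powr (- \<gamma>)) * (ennreal ((g + 1) powr (\<delta> - 1)) * indicator {0..w} g) \<partial>lborel)"
    unfolding nn_integral_pos_lborel by (intro nn_integral_mono pw)
  also have "\<dots> = (\<integral>\<^sup>+g. ennreal ((g + 1) powr (- \<alpha>)) * indicator {w..} g \<partial>lborel)
     + ennreal ((1 + w) powr (- \<gamma>)) * (\<integral>\<^sup>+g. ennreal ((g + 1) powr (\<delta> - 1)) * indicator {0..w} g \<partial>lborel)"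
    by (subst nn_integral_add) (auto simp: nn_integral_cmult)
  also have "\<dots> \<le> ennreal ((1 + w) powr (1 - \<alpha>) / (\<alpha> - 1)) + ennreal ((1 + w) powr (- \<gamma>)) * ennreal ((1 + w) powr \<delta> / \<delta>)"
    using nn_integral_powr_tail[OF assms(1,3)] nn_integral_powr_initial[OF \<delta> assms(3)]
    by (intro add_mono mult_left_mono) auto
  also have "\<dots> = ennreal ((1 + w) powr (1 - \<alpha>) / (\<alpha> - 1) + (1 + w) powr (- \<gamma>) * ((1 + w) powr \<delta> / \<delta>))"
    using assms \<delta> by (subst ennreal_mult[symmetric]) (auto simp: ennreal_plus[symmetric] simp del: ennreal_plus)
  also have "(1 + w) powr (- \<gamma>) * ((1 + w) powr \<delta> / \<delta>) = (1 + w) powr (1 - \<alpha>) / \<delta>"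
    by (simp add: powr_add[symmetric] \<delta>_def)
  finally show ?thesis by (simp add: \<delta>_def algebra_simps)
qed

lemma nn_integral_gamma:
  fixes c r :: real
  assumes "c > 0" "r > 0"
  shows "(\<integral>\<^sup>+t. ennreal (t powr (c - 1) * exp (- (r * t))) \<partial>pos_lborel) = ennreal (Gamma c / r powr c)"
proof -
  have "ennreal (Gamma c) = (\<integral>\<^sup>+t. ennreal (indicator {0..} t * t powr (c - 1) / exp t) \<partial>lborel)"
    using Gamma_conv_nn_integral_real[OF assms(1)] .
  also have "\<dots> = ennreal \<bar>r\<bar> * (\<integral>\<^sup>+t. ennreal (indicator {0..} (0 + r * t) * (0 + r * t) powr (c - 1) / exp (0 + r * t)) \<partial>lborel)"
    using assms by (intro nn_integral_real_affine) auto
  also have "(\<integral>\<^sup>+t. ennreal (indicator {0..} (0 + r * t) * (0 + r * t) powr (c - 1) / exp (0 + r * t)) \<partial>lborel)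
     = (\<integral>\<^sup>+t. ennreal (r powr (c - 1)) * (ennreal (t powr (c - 1) * exp (- (r * t))) * indicator {0<..} t) \<partial>lborel)"
    using assms
    by (intro nn_integral_cong)
       (auto simp: indicator_def powr_mult exp_minus field_simps ennreal_mult[symmetric] zero_le_mult_iff split: if_splits)
  also have "\<dots> = ennreal (r powr (c - 1)) * (\<integral>\<^sup>+t. ennreal (t powr (c - 1) * exp (- (r * t))) \<partial>pos_lborel)"
    unfolding nn_integral_pos_lborel by (subst nn_integral_cmult) auto
  also have "ennreal \<bar>r\<bar> * (ennreal (r powr (c - 1)) * (\<integral>\<^sup>+t. ennreal (t powr (c - 1) * exp (- (r * t))) \<partial>pos_lborel))
     = ennreal (r powr c) * (\<integral>\<^sup>+t. ennreal (t powr (c - 1) * exp (- (r * t))) \<partial>pos_lborel)"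
  proof -
    have "ennreal \<bar>r\<bar> * ennreal (r powr (c - 1)) = ennreal (r powr c)"
      using assms by (subst ennreal_mult[symmetric]) (auto simp: powr_mult_base)
    then show ?thesis by (simp add: mult.assoc[symmetric])
  qed
  finally have *: "ennreal (Gamma c) = ennreal (r powr c) * (\<integral>\<^sup>+t. ennreal (t powr (c - 1) * exp (- (r * t))) \<partial>pos_lborel)" .
  have "ennreal (1 / r powr c) * ennreal (Gamma c) = ennreal (1 / r powr c) * (ennreal (r powr c)
      * (\<integral>\<^sup>+t. ennreal (t powr (c - 1) * exp (- (r * t))) \<partial>pos_lborel))"
    unfolding * ..
  also have "\<dots> = (\<integral>\<^sup>+t. ennreal (t powr (c - 1) * exp (- (r * t))) \<partial>pos_lborel)"
    unfolding mult.assoc[symmetric] using assms by (subst ennreal_mult[symmetric]) auto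
  finally have "(\<integral>\<^sup>+t. ennreal (t powr (c - 1) * exp (- (r * t))) \<partial>pos_lborel) = ennreal (1 / r powr c) * ennreal (Gamma c)" ..
  also have "\<dots> = ennreal (Gamma c / r powr c)"
    using assms by (subst ennreal_mult[symmetric]) (auto simp: Gamma_real_nonneg)
  finally show ?thesis .
qed

section \<open>The posterior kernel and its marginal in the latent scale\<close>

locale scale_mixture =
  fixes ty :: "'p::finite itself" and p :: real and n :: nat and a b :: real
  assumes p_eq: "p = real CARD('p)" and p_ge: "p \<ge> 3" and n_ge: "n \<ge> 2"
    and a_ge: "a \<ge> -2" and a_less: "a + 2 < real n / 2" and b_ge: "b \<ge> 0"
begin

text \<open>The kernel contains \<eta> to the power \<open>(p + n) / 2\<close>, so this is the shape
  parameter of the gamma integral over \<eta>.\<close>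

definition \<kappa> :: real where "\<kappa> = (p + n) / 2 + 1"

text \<open>\<open>kern\<close> is the integrand of the denominator of the Bayes rule after integrating out \<open>\<theta>\<close>; the factor
  \<open>\<eta>\<close> from the loss has cancelled the factor \<open>1 / \<eta>\<close> of the prior. Integrating out \<open>\<eta>\<close> as well leaves
  \<open>mix\<close>, with \<open>w = (norm x)\<^sup>2 / s\<close>, up to a factor depending on \<open>s\<close> only.\<close>

definition mix :: "real \<Rightarrow> real \<Rightarrow> real" where
  "mix w g = (g + 1) powr (- p / 2) * (1 + w / (g + 1)) powr (- \<kappa>) * mixing_dens a b g"

definition kern :: "real ^ 'p \<Rightarrow> real \<Rightarrow> real \<Rightarrow> real \<Rightarrow> real" where
  "kern x s \<eta> g = normal_dens 0 (\<eta> / (g + 1)) x * chisq_dens n \<eta> s * mixing_dens a b g"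

text \<open>Collects what the integral over \<eta> of \<open>(\<eta> * s) powr j\<close> times the
  kernel leaves behind: a gamma function of shape \<open>\<kappa> + j\<close> and the normalizing
  constants of the two sampling densities.\<close>

definition gamma_const :: "real \<Rightarrow> real" where
  "gamma_const j = Gamma (\<kappa> + j) * 2 powr (\<kappa> + j) / ((2 * pi) powr (p / 2) * (Gamma (real n / 2) * 2 powr (real n / 2)))"

lemma kern_measurable [measurable]:
  assumes [measurable]: "f1 \<in> borel_measurable M" "f2 \<in> borel_measurable M" "f3 \<in> borel_measurable M" "f4 \<in> borel_measurable M"
  shows "(\<lambda>z. kern (f1 z) (f2 z) (f3 z) (f4 z)) \<in> borel_measurable M"
  unfolding kern_def by measurable

lemma mix_measurable [measurable]:
  assumes [measurable]: "f1 \<in> borel_measurable M" "f2 \<in> borel_measurable M"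
  shows "(\<lambda>z. mix (f1 z) (f2 z)) \<in> borel_measurable M"
  unfolding mix_def by measurable

lemma kern_nonneg [simp]: "kern x s \<eta> g \<ge> 0"
  by (simp add: kern_def)

lemma kern_pos: "s > 0 \<Longrightarrow> \<eta> > 0 \<Longrightarrow> g > 0 \<Longrightarrow> kern x s \<eta> g > 0"
  using n_ge by (simp add: kern_def normal_dens_pos chisq_dens_pos mixing_dens_pos)

lemma mix_nonneg [simp]: "mix w g \<ge> 0"
  by (simp add: mix_def)

lemma mix_pos: "w \<ge> 0 \<Longrightarrow> g > 0 \<Longrightarrow> mix w g > 0"
  by (simp add: mix_def mixing_dens_pos add_pos_nonneg less_imp_neq[symmetric])

lemma gamma_const_pos: "\<kappa> + j > 0 \<Longrightarrow> gamma_const j > 0"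
  using n_ge unfolding gamma_const_def by (intro divide_pos_pos mult_pos_pos) (auto simp: Gamma_real_pos)

text \<open>As a function of \<eta> the kernel is an unnormalized gamma density with rate
  \<open>s * (1 + w / (g + 1)) / 2\<close>. The moment is one of \<open>\<eta> * s\<close>, which is
  scale free, and therefore the power of \<open>s\<close> in the result does not depend on
  \<open>j\<close>. The case \<open>j = 0\<close> serves the Bayes rule, \<open>j = -1\<close> an
  integrability check, and small \<open>j\<close> of both signs the oscillation of the
  cutoff.\<close>

lemma nn_integral_kern_precision:
  assumes s: "s > 0" and g: "g > 0" and j: "\<kappa> + j > 0"
  shows "(\<integral>\<^sup>+\<eta>. ennreal ((\<eta> * s) powr j * kern x s \<eta> g) \<partial>pos_lborel)
    = ennreal (gamma_const j * s powr (- p / 2 - 2) * (1 + (norm x)\<^sup>2 / s / (g + 1)) powr (- j) * mix ((norm x)\<^sup>2 / s) g)"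
proof -
  define w where "w = (norm x)\<^sup>2 / s"
  define r where "r = s * (1 + w / (g + 1)) / 2"
  define G where "G = Gamma (real n / 2) * 2 powr (real n / 2)"
  have w: "w \<ge> 0" using s by (simp add: w_def)
  have w1: "1 + w / (g + 1) > 0" using w g by (simp add: add_pos_nonneg)
  have r: "r > 0" using s w1 by (simp add: r_def)
  have G: "G > 0" using n_ge by (simp add: G_def Gamma_real_pos)
  define c where "c = (g + 1) powr (- p / 2) * s powr (real n / 2 - 1 + j) * mixing_dens a b g / ((2 * pi) powr (p / 2) * G)"
  have c: "c \<ge> 0" using G by (simp add: c_def)
  have *: "(\<eta> * s) powr j * kern x s \<eta> g = c * (\<eta> powr (\<kappa> + j - 1) * exp (- (r * \<eta>)))" if \<eta>: "\<eta> > 0" for \<eta>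
  proof -
    have 1: "- (\<eta> / (g + 1)) * (norm x)\<^sup>2 / 2 + - \<eta> * s / 2 = - (r * \<eta>)"
    proof -
      have "s * w = (norm x)\<^sup>2" using s by (simp add: w_def)
      moreover have "- (s * (1 + w / h) / 2 * \<eta>) = - (\<eta> / h) * (s * w) / 2 + - \<eta> * s / 2" for h
        by (simp add: algebra_simps)
      from this[of "g + 1"] have "- (r * \<eta>) = - (\<eta> / (g + 1)) * (s * w) / 2 + - \<eta> * s / 2"
        unfolding r_def .
      ultimately show ?thesis by simp
    qed
    have 2: "exp (- (r * \<eta>)) = exp (- (\<eta> / (g + 1)) * (norm x)\<^sup>2 / 2) * exp (- \<eta> * s / 2)"
      by (simp only: 1[symmetric] exp_add)
    have 3: "\<eta> powr (\<kappa> + j - 1) = \<eta> powr j * (\<eta> powr (p / 2) * \<eta> powr (real n / 2))"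
      by (simp add: \<kappa>_def powr_add[symmetric] add_divide_distrib algebra_simps)
    have 4: "(\<eta> / (g + 1)) powr (p / 2) = \<eta> powr (p / 2) * (g + 1) powr (- p / 2)"
      using \<eta> g by (simp add: powr_divide powr_minus_divide)
    have 5: "s powr (real n / 2 - 1 + j) = s powr (real n / 2 - 1) * s powr j"
      by (simp add: powr_add)
    have 6: "(\<eta> * s) powr j = \<eta> powr j * s powr j"
      using \<eta> s by (simp add: powr_mult)
    show ?thesis
      unfolding kern_def normal_dens_def chisq_dens_def diff_0_right p_eq[symmetric] 4 6 c_def 5 2 3 G_def by (simp add: mult_ac)
  qed
  have "(\<integral>\<^sup>+\<eta>. ennreal ((\<eta> * s) powr j * kern x s \<eta> g) \<partial>pos_lborel)
      = (\<integral>\<^sup>+\<eta>. ennreal c * ennreal (\<eta> powr (\<kappa> + j - 1) * exp (- (r * \<eta>))) \<partial>pos_lborel)"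
    using c by (intro nn_integral_cong) (auto simp: * ennreal_mult[symmetric])
  also have "\<dots> = ennreal c * ennreal (Gamma (\<kappa> + j) / r powr (\<kappa> + j))"
    using nn_integral_gamma[OF j r] by (subst nn_integral_cmult) (auto intro: borel_measurable_pos_lborelI)
  also have "\<dots> = ennreal (c * (Gamma (\<kappa> + j) / r powr (\<kappa> + j)))"
    using c j r by (subst ennreal_mult[symmetric]) (auto simp: Gamma_real_nonneg)
  also have "c * (Gamma (\<kappa> + j) / r powr (\<kappa> + j)) = gamma_const j * s powr (- p / 2 - 2) * (1 + w / (g + 1)) powr (- j) * mix w g"
  proof -
    have 1: "1 / r powr (\<kappa> + j) = 2 powr (\<kappa> + j) * s powr (- (\<kappa> + j)) * ((1 + w / (g + 1)) powr (- \<kappa>) * (1 + w / (g + 1)) powr (- j))"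
    proof -
      define t e where "t = 1 + w / (g + 1)" and "e = \<kappa> + j"
      have "(s * t / 2) powr e = s powr e * t powr e / 2 powr e"
        by (simp add: powr_divide powr_mult)
      then have "1 / (s * t / 2) powr e = 2 powr e * s powr (- e) * t powr (- e)"
        by (simp add: powr_minus_divide)
      also have "t powr (- e) = t powr (- \<kappa>) * t powr (- j)"
        by (simp add: e_def powr_add[symmetric])
      finally show ?thesis unfolding r_def t_def e_def .
    qed
    have "- p / 2 - 2 = (real n / 2 - 1 + j) + (- (\<kappa> + j))"
      by (simp add: \<kappa>_def add_divide_distrib)
    then have 2: "s powr (- p / 2 - 2) = s powr (real n / 2 - 1 + j) * s powr (- (\<kappa> + j))"
      by (simp only: powr_add)
    have "c * (Gamma (\<kappa> + j) / r powr (\<kappa> + j)) = c * Gamma (\<kappa> + j) * (1 / r powr (\<kappa> + j))" by simp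
    also have "\<dots> = gamma_const j * s powr (- p / 2 - 2) * (1 + w / (g + 1)) powr (- j) * mix w g"
      unfolding 1 2 gamma_const_def mix_def c_def G_def by (simp add: mult_ac)
    finally show ?thesis .
  qed
  finally show ?thesis unfolding w_def .
qed

lemma nn_integral_kern_eq:
  assumes s: "s > 0" and j: "\<kappa> + j > 0" and [measurable]: "f \<in> borel_measurable borel" and f: "\<And>g. g > 0 \<Longrightarrow> f g \<ge> 0"
  shows "(\<integral>\<^sup>+z. ennreal (f (snd z) * (fst z * s) powr j * kern x s (fst z) (snd z)) \<partial>pos_plane)
    = ennreal (gamma_const j * s powr (- p / 2 - 2)) *
      (\<integral>\<^sup>+g. ennreal (f g * (1 + (norm x)\<^sup>2 / s / (g + 1)) powr (- j) * mix ((norm x)\<^sup>2 / s) g) \<partial>pos_lborel)"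
proof -
  note [measurable] = borel_measurable_pos_lborelI[OF \<open>f \<in> borel_measurable borel\<close>]
  have "(\<integral>\<^sup>+z. ennreal (f (snd z) * (fst z * s) powr j * kern x s (fst z) (snd z)) \<partial>pos_plane)
      = (\<integral>\<^sup>+g. \<integral>\<^sup>+\<eta>. ennreal (f (snd (\<eta>, g)) * (fst (\<eta>, g) * s) powr j * kern x s (fst (\<eta>, g)) (snd (\<eta>, g))) \<partial>pos_lborel \<partial>pos_lborel)"
    by (rule pos2.nn_integral_snd[symmetric]) measurable
  also have "\<dots> = (\<integral>\<^sup>+g. ennreal (gamma_const j * s powr (- p / 2 - 2)) *
      ennreal (f g * (1 + (norm x)\<^sup>2 / s / (g + 1)) powr (- j) * mix ((norm x)\<^sup>2 / s) g) \<partial>pos_lborel)"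
  proof (rule nn_integral_cong)
    fix g assume "g \<in> space pos_lborel"
    then have g: "g > 0" by simp
    have "(\<integral>\<^sup>+\<eta>. ennreal (f (snd (\<eta>, g)) * (fst (\<eta>, g) * s) powr j * kern x s (fst (\<eta>, g)) (snd (\<eta>, g))) \<partial>pos_lborel)
      = (\<integral>\<^sup>+\<eta>. ennreal (f g) * ennreal ((\<eta> * s) powr j * kern x s \<eta> g) \<partial>pos_lborel)"
      using f[OF g] by (intro nn_integral_cong) (auto simp: ennreal_mult[symmetric] mult_ac)
    also have "\<dots> = ennreal (f g) * ennreal (gamma_const j * s powr (- p / 2 - 2) * (1 + (norm x)\<^sup>2 / s / (g + 1)) powr (- j) * mix ((norm x)\<^sup>2 / s) g)"
      using nn_integral_kern_precision[OF s g j] by (subst nn_integral_cmult) auto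
    also have "\<dots> = ennreal (gamma_const j * s powr (- p / 2 - 2)) *
      ennreal (f g * (1 + (norm x)\<^sup>2 / s / (g + 1)) powr (- j) * mix ((norm x)\<^sup>2 / s) g)"
      using f[OF g] gamma_const_pos[OF j] by (simp add: ennreal_mult[symmetric] mult_ac)
    finally show "(\<integral>\<^sup>+\<eta>. ennreal (f (snd (\<eta>, g)) * (fst (\<eta>, g) * s) powr j * kern x s (fst (\<eta>, g)) (snd (\<eta>, g))) \<partial>pos_lborel) = \<dots>" .
  qed
  also have "\<dots> = ennreal (gamma_const j * s powr (- p / 2 - 2)) *
      (\<integral>\<^sup>+g. ennreal (f g * (1 + (norm x)\<^sup>2 / s / (g + 1)) powr (- j) * mix ((norm x)\<^sup>2 / s) g) \<partial>pos_lborel)"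
    by (rule nn_integral_cmult) measurable
  finally show ?thesis .
qed

text \<open>Bounding the mixing density by \<open>(g + 1) powr (- a - 2)\<close> leaves the
  beta-type integral above with exponents \<open>p / 2 + a + 2 + l\<close> and
  \<open>\<kappa> + j\<close>; the two hypotheses are its convergence conditions.\<close>

lemma nn_integral_mix_le:
  assumes "p / 2 + a + 2 + l > 1" "\<kappa> + j + 1 > p / 2 + a + 2 + l" "w \<ge> 0"
  shows "(\<integral>\<^sup>+g. ennreal ((g + 1) powr (- l) * (1 + w / (g + 1)) powr (- j) * mix w g) \<partial>pos_lborel)
    \<le> ennreal ((1 / (p / 2 + a + 1 + l) + 1 / (\<kappa> + j - (p / 2 + a + 1 + l))) * (1 + w) powr (- (p / 2 + a + 1 + l)))"
proof -
  define \<alpha> where "\<alpha> = p / 2 + a + 2 + l"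
  have "(\<integral>\<^sup>+g. ennreal ((g + 1) powr (- l) * (1 + w / (g + 1)) powr (- j) * mix w g) \<partial>pos_lborel)
     \<le> (\<integral>\<^sup>+g. ennreal ((g + 1) powr (- \<alpha>) * (1 + w / (g + 1)) powr (- (\<kappa> + j))) \<partial>pos_lborel)"
  proof (intro nn_integral_mono ennreal_leI)
    fix g assume "g \<in> space pos_lborel"
    then have g: "g > 0" by simp
    have "(g + 1) powr (- l) * (1 + w / (g + 1)) powr (- j) * mix w g
      \<le> (g + 1) powr (- l) * (1 + w / (g + 1)) powr (- j) * ((g + 1) powr (- p / 2) * (1 + w / (g + 1)) powr (- \<kappa>) * (g + 1) powr (- a - 2))"
      unfolding mix_def using mixing_dens_le[OF g b_ge] by (intro mult_left_mono) auto
    also have "\<dots> = ((g + 1) powr (- l) * (g + 1) powr (- p / 2) * (g + 1) powr (- a - 2)) * ((1 + w / (g + 1)) powr (- \<kappa>) * (1 + w / (g + 1)) powr (- j))"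
      by (simp add: mult_ac)
    also have "\<dots> = (g + 1) powr (- \<alpha>) * (1 + w / (g + 1)) powr (- (\<kappa> + j))"
      unfolding powr_add[symmetric] by (simp add: \<alpha>_def algebra_simps)
    finally show "(g + 1) powr (- l) * (1 + w / (g + 1)) powr (- j) * mix w g \<le> \<dots>" .
  qed
  also have "\<dots> \<le> ennreal ((1 / (\<alpha> - 1) + 1 / (\<kappa> + j - \<alpha> + 1)) * (1 + w) powr (1 - \<alpha>))"
    using assms by (intro nn_integral_beta_bound) (auto simp: \<alpha>_def)
  finally show ?thesis by (simp add: \<alpha>_def algebra_simps)
qed

text \<open>The mass sits at \<open>g\<close> of order \<open>1 + w\<close>. On the interval from
  \<open>2 * w + 1\<close> to \<open>4 * w + 3\<close> the value \<open>g + 1\<close> lies between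
  \<open>2 * (1 + w)\<close> and \<open>4 * (1 + w)\<close>, so
  \<open>1 + w / (g + 1) \<le> 2\<close> and \<open>g / (g + 1) \<ge> 1 / 2\<close>, and the length
  contributes one power of \<open>1 + w\<close>. The order agrees with the upper bound, which makes
  normalized moments uniformly bounded.\<close>

lemma nn_integral_mix_ge:
  "\<exists>c>0. \<forall>w\<ge>0. ennreal (c * (1 + w) powr (- (p / 2 + a + 1))) \<le> (\<integral>\<^sup>+g. ennreal (mix w g) \<partial>pos_lborel)"
proof (intro exI conjI allI impI)
  define \<beta> where "\<beta> = p / 2 + a + 2"
  have \<beta>: "\<beta> > 0" using p_ge a_ge by (simp add: \<beta>_def)
  have \<kappa>: "\<kappa> > 0" unfolding \<kappa>_def using p_ge by (intro add_nonneg_pos) auto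
  define c where "c = 4 powr (- \<beta>) * 2 powr (- \<kappa>) * (1/2) powr b"
  show "0 < 2 * c" by (simp add: c_def)
  fix w :: real assume w: "w \<ge> 0"
  have "mix w g \<ge> c * (1 + w) powr (- \<beta>)" if g: "g \<in> {2 * w + 1..4 * w + 3}" for g
  proof -
    have "(4 * (1 + w)) powr (- \<beta>) \<le> (g + 1) powr (- \<beta>)"
      using g w \<beta> by (intro powr_mono2') auto
    moreover have "(4 * (1 + w)) powr (- \<beta>) = 4 powr (- \<beta>) * (1 + w) powr (- \<beta>)"
      by (intro powr_mult)
    ultimately have 1: "4 powr (- \<beta>) * (1 + w) powr (- \<beta>) \<le> (g + 1) powr (- \<beta>)" by simp
    have 2: "2 powr (- \<kappa>) \<le> (1 + w / (g + 1)) powr (- \<kappa>)"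
      using g w \<kappa> by (intro powr_mono2') (auto simp: field_simps add_pos_nonneg)
    have 3: "(1/2) powr b \<le> (g / (g + 1)) powr b"
      using g w b_ge by (intro powr_mono2) (auto simp: field_simps)
    have "c * (1 + w) powr (- \<beta>) = (4 powr (- \<beta>) * (1 + w) powr (- \<beta>)) * 2 powr (- \<kappa>) * (1/2) powr b"
      by (simp add: c_def)
    also have "\<dots> \<le> (g + 1) powr (- \<beta>) * (1 + w / (g + 1)) powr (- \<kappa>) * (g / (g + 1)) powr b"
      using 1 2 3 by (intro mult_mono) auto
    also have "\<dots> = mix w g"
    proof -
      have "(g + 1) powr (- \<beta>) = (g + 1) powr (- p / 2) * (1 / (g + 1) powr (a + 2))"
        unfolding powr_minus_divide[symmetric] powr_add[symmetric] by (simp add: \<beta>_def algebra_simps)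
      then show ?thesis by (simp add: mix_def mixing_dens_def)
    qed
    finally show ?thesis .
  qed
  then have "(\<integral>\<^sup>+g. ennreal (c * (1 + w) powr (- \<beta>)) * indicator {2 * w + 1..4 * w + 3} g \<partial>lborel)
     \<le> (\<integral>\<^sup>+g. ennreal (mix w g) * indicator {0<..} g \<partial>lborel)"
    using w by (intro nn_integral_mono) (auto split: split_indicator intro!: ennreal_leI)
  moreover have "(\<integral>\<^sup>+g. ennreal (c * (1 + w) powr (- \<beta>)) * indicator {2 * w + 1..4 * w + 3} g \<partial>lborel)
    = ennreal (c * (1 + w) powr (- \<beta>)) * ennreal (2 * (1 + w))"
    using w by (subst nn_integral_cmult_indicator) (auto intro!: arg_cong2[where f="(*)"] arg_cong[where f=ennreal])
  moreover have "\<dots> = ennreal (2 * c * ((1 + w) powr (- \<beta>) * (1 + w)))"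
    using w by (subst ennreal_mult[symmetric]) (auto simp: c_def mult_ac)
  moreover have "(1 + w) powr (- \<beta>) * (1 + w) = (1 + w) powr (- (p / 2 + a + 1))"
    using w powr_add[of "1 + w" "- \<beta>" 1] by (simp add: \<beta>_def)
  ultimately show "ennreal (2 * c * (1 + w) powr (- (p / 2 + a + 1))) \<le> (\<integral>\<^sup>+g. ennreal (mix w g) \<partial>pos_lborel)"
    unfolding nn_integral_pos_lborel by simp
qed

end

interpretation param: pair_sigma_finite "lborel :: (real ^ 'p) measure" pos_plane ..

lemma space_pos2: "space pos_plane = {0<..} \<times> {0<..}"
  by (simp add: space_pair_measure)

section \<open>The generalized Bayes estimator\<close>

text \<open>Keeping \<open>g\<close> as a third coordinate replaces the extended-real density,
  itself an integral over \<open>g\<close>, by an explicit real one. This is what allows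
  vector-valued integrals against the prior to be rewritten as integrals with a density.\<close>

lemma prior_measure_eq_distr:
  "(prior_measure a b :: ((real ^ 'p) \<times> real) measure) =
    distr (density (lborel \<Otimes>\<^sub>M pos_plane)
        (\<lambda>(\<theta>, \<eta>, g). ennreal (1 / \<eta> * normal_dens 0 (\<eta> / g) \<theta> * mixing_dens a b g)))
      (lborel \<Otimes>\<^sub>M pos_lborel) (\<lambda>(\<theta>, \<eta>, g). (\<theta>, \<eta>))" (is "_ = distr (density ?T ?d) ?L ?pr")
proof (rule measure_eqI)
  show "sets (prior_measure a b :: ((real ^ 'p) \<times> real) measure) = sets (distr (density ?T ?d) ?L ?pr)"
    by (simp add: prior_measure_def)
  fix A assume "A \<in> sets (prior_measure a b :: ((real ^ 'p) \<times> real) measure)"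
  then have A [measurable]: "A \<in> sets ?L" by (simp add: prior_measure_def)
  have pd: "prior_dens a b \<theta> \<eta> = (\<integral>\<^sup>+g. ?d (\<theta>, \<eta>, g) \<partial>pos_lborel)" if "\<eta> > 0" for \<theta> :: "real ^ 'p" and \<eta>
    unfolding prior_dens_def
  proof (subst nn_integral_cmult[symmetric])
    show "(\<integral>\<^sup>+g. ennreal (1 / \<eta>) * ennreal (\<eta> powr (real CARD('p) / 2)
                   / ((2 * pi) powr (real CARD('p) / 2) * g powr (real CARD('p) / 2))
                 * exp (- \<eta> / (2 * g) * (norm \<theta>)\<^sup>2) * mixing_dens a b g) \<partial>pos_lborel)
       = (\<integral>\<^sup>+g. ?d (\<theta>, \<eta>, g) \<partial>pos_lborel)"
    proof (intro nn_integral_cong)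
      fix g assume "g \<in> space pos_lborel"
      then have g: "g > 0" by simp
      show "ennreal (1 / \<eta>) * ennreal (\<eta> powr (real CARD('p) / 2)
                   / ((2 * pi) powr (real CARD('p) / 2) * g powr (real CARD('p) / 2))
                 * exp (- \<eta> / (2 * g) * (norm \<theta>)\<^sup>2) * mixing_dens a b g) = ?d (\<theta>, \<eta>, g)"
        using that g by (simp add: ennreal_mult[symmetric] normal_dens_def powr_divide mult_ac)
    qed
  qed measurable
  have d: "?d \<in> borel_measurable ?T" by measurable
  have pr: "?pr \<in> ?T \<rightarrow>\<^sub>M ?L" by measurable
  have f: "(\<lambda>(\<theta>, \<eta>). prior_dens a b \<theta> \<eta>) \<in> borel_measurable (?L :: ((real ^ 'p) \<times> real) measure)"
  proof (subst measurable_cong)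
    show "(case w of (\<theta>, \<eta>) \<Rightarrow> prior_dens a b \<theta> \<eta>) = (\<integral>\<^sup>+g. ?d (fst w, snd w, g) \<partial>pos_lborel)"
      if "w \<in> space ?L" for w :: "(real ^ 'p) \<times> real"
      using that pd[of "snd w" "fst w"] by (auto simp: space_pair_measure)
    show "(\<lambda>w. \<integral>\<^sup>+g. ?d (fst w, snd w, g) \<partial>pos_lborel) \<in> borel_measurable (?L :: ((real ^ 'p) \<times> real) measure)"
      by measurable
  qed
  have "emeasure (prior_measure a b) A = (\<integral>\<^sup>+z. (case z of (\<theta>, \<eta>) \<Rightarrow> prior_dens a b \<theta> \<eta>) * indicator A z \<partial>?L)"
    unfolding prior_measure_def by (rule emeasure_density[OF f A])
  also have "\<dots> = (\<integral>\<^sup>+\<theta>. \<integral>\<^sup>+\<eta>. prior_dens a b \<theta> \<eta> * indicator A (\<theta>, \<eta>) \<partial>pos_lborel \<partial>lborel)"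
    using f by (subst pos_lborel.nn_integral_fst[symmetric]) auto
  also have "\<dots> = (\<integral>\<^sup>+\<theta>. \<integral>\<^sup>+\<eta>. \<integral>\<^sup>+g. ?d (\<theta>, \<eta>, g) * indicator A (\<theta>, \<eta>) \<partial>pos_lborel \<partial>pos_lborel \<partial>lborel)"
    by (intro nn_integral_cong) (simp add: pd nn_integral_multc)
  also have "\<dots> = (\<integral>\<^sup>+\<theta>. \<integral>\<^sup>+z. ?d (\<theta>, z) * indicator A (?pr (\<theta>, z)) \<partial>pos_plane \<partial>lborel)"
    by (intro nn_integral_cong, subst pos_lborel.nn_integral_fst[symmetric]) auto
  also have "\<dots> = (\<integral>\<^sup>+z. ?d z * indicator A (?pr z) \<partial>?T)"
    by (subst pos2.P.nn_integral_fst[symmetric]) auto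
  moreover have prA: "?pr -` A \<inter> space ?T \<in> sets ?T"
    by (rule measurable_sets[OF pr A])
  ultimately have "emeasure (prior_measure a b) A = (\<integral>\<^sup>+z. ?d z * indicator A (?pr z) \<partial>?T)" by simp
  also have "\<dots> = (\<integral>\<^sup>+z. ?d z * indicator (?pr -` A \<inter> space ?T) z \<partial>?T)"
    by (intro nn_integral_cong) (auto split: split_indicator)
  also have "\<dots> = emeasure (density ?T ?d) (?pr -` A \<inter> space ?T)"
    by (rule emeasure_density[OF d prA, symmetric])
  also have "\<dots> = emeasure (distr (density ?T ?d) ?L ?pr) A"
  proof -
    have "?pr \<in> density ?T ?d \<rightarrow>\<^sub>M ?L" using pr by simp
    from emeasure_distr[OF this A] show ?thesis by (simp only: space_density)
  qed
  finally show "emeasure (prior_measure a b) A = emeasure (distr (density ?T ?d) ?L ?pr) A" .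
qed

section \<open>Moments of the kernel and the closed form of the Bayes rule\<close>

context scale_mixture begin

text \<open>The shrinkage factor, written \<open>Q\<close> in the overview.\<close>

definition mixmean :: "real \<Rightarrow> real" where
  "mixmean w = (\<integral>g. mix w g / (g + 1) \<partial>pos_lborel) / (\<integral>g. mix w g \<partial>pos_lborel)"

text \<open>Under the kernel \<open>g + 1\<close> is of order \<open>1 + w\<close> and \<eta> of
  order \<open>1 / s\<close>. Hence the powers \<open>i\<close> and \<open>j\<close> of the
  normalized quantities affect only the constant, while a genuine power \<open>l\<close> of
  \<open>1 / (g + 1)\<close> yields as many powers of \<open>1 / (1 + w)\<close>.\<close>

lemma nn_integral_kern_moment:
  assumes s: "s > 0" and w: "w = (norm x)\<^sup>2 / s"
    and i: "p / 2 + a + 2 + l + i > 1" "\<kappa> + j + 1 > p / 2 + a + 2 + l + i"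
  shows "(\<integral>\<^sup>+z. ennreal ((snd z + 1) powr (- l) * ((1 + w) / (snd z + 1)) powr i * (fst z * s) powr j * kern x s (fst z) (snd z))
       \<partial>pos_plane)
    \<le> ennreal (gamma_const j * (1 / (p / 2 + a + 1 + (l + i)) + 1 / (\<kappa> + j - (p / 2 + a + 1 + (l + i))))
         * s powr (- p / 2 - 2) * (1 + w) powr (- (p / 2 + a + 1 + l)))"
proof -
  have w0: "w \<ge> 0" using s w by simp
  have j: "\<kappa> + j > 0" using i by linarith
  define C where "C = 1 / (p / 2 + a + 1 + (l + i)) + 1 / (\<kappa> + j - (p / 2 + a + 1 + (l + i)))"
  have C: "C \<ge> 0" 
  proof -
    have "0 < p / 2 + a + 1 + (l + i)" "0 < \<kappa> + j - (p / 2 + a + 1 + (l + i))" using i by linarith+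
    then show ?thesis unfolding C_def by (intro add_nonneg_nonneg) (auto simp only: zero_le_divide_1_iff less_imp_le)
  qed
  have "(\<integral>\<^sup>+z. ennreal ((snd z + 1) powr (- l) * ((1 + w) / (snd z + 1)) powr i * (fst z * s) powr j * kern x s (fst z) (snd z))
       \<partial>pos_plane)
    = ennreal (gamma_const j * s powr (- p / 2 - 2)) *
      (\<integral>\<^sup>+g. ennreal (((g + 1) powr (- l) * ((1 + w) / (g + 1)) powr i) * (1 + w / (g + 1)) powr (- j) * mix w g) \<partial>pos_lborel)"
    using nn_integral_kern_eq[OF s j, of "\<lambda>g. (g + 1) powr (- l) * ((1 + w) / (g + 1)) powr i" x]
    by (simp add: w[symmetric])
  also have "(\<integral>\<^sup>+g. ennreal (((g + 1) powr (- l) * ((1 + w) / (g + 1)) powr i) * (1 + w / (g + 1)) powr (- j) * mix w g) \<partial>pos_lborel)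
    = (\<integral>\<^sup>+g. ennreal ((1 + w) powr i) * ennreal ((g + 1) powr (- (l + i)) * (1 + w / (g + 1)) powr (- j) * mix w g) \<partial>pos_lborel)"
  proof (intro nn_integral_cong)
    fix g assume "g \<in> space pos_lborel"
    then have g: "g > 0" by simp
    have "((1 + w) / (g + 1)) powr i = (1 + w) powr i * (g + 1) powr (- i)"
      using g w0 by (simp add: powr_divide powr_minus_divide)
    moreover have "(g + 1) powr (- (l + i)) = (g + 1) powr (- l) * (g + 1) powr (- i)"
      by (simp add: powr_add[symmetric])
    ultimately show "ennreal (((g + 1) powr (- l) * ((1 + w) / (g + 1)) powr i) * (1 + w / (g + 1)) powr (- j) * mix w g)
      = ennreal ((1 + w) powr i) * ennreal ((g + 1) powr (- (l + i)) * (1 + w / (g + 1)) powr (- j) * mix w g)"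
      by (simp add: ennreal_mult[symmetric] mult_ac)
  qed
  also have "\<dots> = ennreal ((1 + w) powr i) * (\<integral>\<^sup>+g. ennreal ((g + 1) powr (- (l + i)) * (1 + w / (g + 1)) powr (- j) * mix w g) \<partial>pos_lborel)"
    by (rule nn_integral_cmult) measurable
  also have "ennreal (gamma_const j * s powr (- p / 2 - 2)) * \<dots>
     \<le> ennreal (gamma_const j * s powr (- p / 2 - 2)) * (ennreal ((1 + w) powr i) * ennreal (C * (1 + w) powr (- (p / 2 + a + 1 + (l + i)))))"
    unfolding C_def using i w0 by (intro mult_left_mono nn_integral_mix_le) auto
  also have "\<dots> = ennreal (gamma_const j * C * s powr (- p / 2 - 2) * ((1 + w) powr i * (1 + w) powr (- (p / 2 + a + 1 + (l + i)))))"
    using gamma_const_pos[OF j] C by (simp add: ennreal_mult[symmetric] mult_ac)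
  also have "(1 + w) powr i * (1 + w) powr (- (p / 2 + a + 1 + (l + i))) = (1 + w) powr (- (p / 2 + a + 1 + l))"
    by (simp add: powr_add[symmetric] algebra_simps)
  finally show ?thesis unfolding C_def .
qed

lemma nn_integral_kern_moment_finite:
  assumes s: "s > 0" and i: "p / 2 + a + 2 + l > 1" "\<kappa> + j + 1 > p / 2 + a + 2 + l"
  shows "(\<integral>\<^sup>+z. ennreal ((snd z + 1) powr (- l) * (fst z * s) powr j * kern x s (fst z) (snd z))
       \<partial>pos_plane) < \<infinity>"
proof -
  define w where "w = (norm x)\<^sup>2 / s"
  have w: "w \<ge> 0" using s by (simp add: w_def)
  have "(\<integral>\<^sup>+z. ennreal ((snd z + 1) powr (- l) * (fst z * s) powr j * kern x s (fst z) (snd z))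
       \<partial>pos_plane) =
     (\<integral>\<^sup>+z. ennreal ((snd z + 1) powr (- l) * ((1 + w) / (snd z + 1)) powr 0 * (fst z * s) powr j * kern x s (fst z) (snd z))
       \<partial>pos_plane)"
    using w by (intro nn_integral_cong) (auto simp: space_pos2 add_pos_nonneg less_imp_neq[symmetric])
  also have "\<dots> < \<infinity>"
    using nn_integral_kern_moment[OF s w_def, of l 0 j] i by (auto intro: le_less_trans)
  finally show ?thesis .
qed

text \<open>The first inequality is \<open>a_less\<close> rewritten. It leaves room for the weight
  \<open>(g + 1) powr (- 2)\<close> together with small extra powers in the admissibility
  estimates.\<close>

lemma kappa_gt: "\<kappa> > p / 2 + a + 3" "\<kappa> > 5 / 2"
  using a_less p_ge n_ge by (auto simp: \<kappa>_def add_divide_distrib)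

lemma nn_integral_kern_finite:
  assumes s: "s > 0"
  shows "(\<integral>\<^sup>+z. ennreal (kern x s (fst z) (snd z)) \<partial>pos_plane) < \<infinity>"
proof -
  have "(\<integral>\<^sup>+z. ennreal (kern x s (fst z) (snd z)) \<partial>pos_plane) =
    (\<integral>\<^sup>+z. ennreal ((snd z + 1) powr (- 0) * (fst z * s) powr 0 * kern x s (fst z) (snd z))
       \<partial>pos_plane)"
    using s by (intro nn_integral_cong) (auto simp: space_pos2)
  also have "\<dots> < \<infinity>"
    using s kappa_gt a_ge p_ge by (intro nn_integral_kern_moment_finite) auto
  finally show ?thesis .
qed

lemma integrable_kern:
  assumes s: "s > 0"
  shows "integrable pos_plane (\<lambda>z. kern x s (fst z) (snd z))"
  using nn_integral_kern_finite[OF s] by (intro integrableI_nonneg) auto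

text \<open>Serves Fubini for the numerator of the Bayes rule: the posterior second moment of
  \<theta> contains a variance term of at most \<open>p / \<eta>\<close>.\<close>

lemma nn_integral_kern_div_precision_finite:
  assumes s: "s > 0"
  shows "(\<integral>\<^sup>+z. ennreal (kern x s (fst z) (snd z) / fst z) \<partial>pos_plane) < \<infinity>"
proof -
  have "(\<integral>\<^sup>+z. ennreal (kern x s (fst z) (snd z) / fst z) \<partial>pos_plane) =
    (\<integral>\<^sup>+z. ennreal s * ennreal ((snd z + 1) powr (- 0) * (fst z * s) powr (-1) * kern x s (fst z) (snd z))
       \<partial>pos_plane)"
    using s by (intro nn_integral_cong) (auto simp: space_pos2 ennreal_mult[symmetric] powr_minus_divide)
  also have "\<dots> = ennreal s * (\<integral>\<^sup>+z. ennreal ((snd z + 1) powr (- 0) * (fst z * s) powr (-1) * kern x s (fst z) (snd z))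
       \<partial>pos_plane)"
    by (rule nn_integral_cmult) measurable
  also have "\<dots> < \<infinity>"
    using s kappa_gt a_ge p_ge nn_integral_kern_moment_finite[OF s, of 0 "-1" x]
    by (auto simp: ennreal_mult_less_top)
  finally show ?thesis .
qed

text \<open>Fubini on the prior with the extra coordinate \<open>g\<close>, followed by conjugacy in
  \<theta>. The growth bound covers both integrands that occur, \<theta> itself in the numerator and
  the constant 1 in the denominator.\<close>

lemma integral_prior:
  fixes f :: "real ^ 'p \<Rightarrow> 'b :: {banach, second_countable_topology}"
  assumes s: "s > 0" and f [measurable]: "f \<in> borel_measurable borel" and bnd: "\<And>\<theta>. norm (f \<theta>) \<le> 1 + (norm \<theta>)\<^sup>2"
  shows "(\<integral>(\<theta>, \<eta>). (\<eta> * normal_dens \<theta> \<eta> x * chisq_dens n \<eta> s) *\<^sub>R f \<theta> \<partial>prior_measure a b)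
    = (\<integral>z. kern x s (fst z) (snd z) *\<^sub>R
        (\<integral>\<theta>. normal_dens ((snd z / (snd z + 1)) *\<^sub>R x) (fst z * (snd z + 1) / snd z) \<theta> *\<^sub>R f \<theta> \<partial>lborel)
        \<partial>pos_plane)"
proof -
  let ?T = "lborel \<Otimes>\<^sub>M pos_plane :: ((real ^ 'p) \<times> real \<times> real) measure"
  let ?L = "lborel \<Otimes>\<^sub>M pos_lborel :: ((real ^ 'p) \<times> real) measure"
  define d where "d = (\<lambda>z :: (real ^ 'p) \<times> real \<times> real. 1 / fst (snd z) * normal_dens 0 (fst (snd z) / snd (snd z)) (fst z) * mixing_dens a b (snd (snd z)))"
  define F where "F = (\<lambda>z :: (real ^ 'p) \<times> real. (snd z * normal_dens (fst z) (snd z) x * chisq_dens n (snd z) s) *\<^sub>R f (fst z))"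
  define N where "N = (\<lambda>(z :: real \<times> real) (\<theta> :: real ^ 'p). normal_dens ((snd z / (snd z + 1)) *\<^sub>R x) (fst z * (snd z + 1) / snd z) \<theta>)"
  have [measurable]: "d \<in> borel_measurable ?T" unfolding d_def by measurable
  have [measurable]: "F \<in> borel_measurable ?L" unfolding F_def by measurable
  have [measurable]: "(\<lambda>z. N (snd z) (fst z)) \<in> borel_measurable ?T" unfolding N_def by measurable
  have pe: "prior_measure a b = distr (density ?T (\<lambda>z. ennreal (d z))) ?L (\<lambda>z. (fst z, fst (snd z)))"
    unfolding prior_measure_eq_distr d_def by (simp add: case_prod_beta')
  have key: "d (\<theta>, z) *\<^sub>R F (\<theta>, fst z) = kern x s (fst z) (snd z) *\<^sub>R N z \<theta> *\<^sub>R f \<theta>"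
    if "fst z > 0" "snd z > 0" for \<theta> z
  proof -
    have "d (\<theta>, z) * (fst z * normal_dens \<theta> (fst z) x * chisq_dens n (fst z) s) =
       (normal_dens \<theta> (fst z) x * normal_dens 0 (fst z / snd z) \<theta>) * chisq_dens n (fst z) s * mixing_dens a b (snd z)"
      using that by (simp add: d_def)
    also have "\<dots> = kern x s (fst z) (snd z) * N z \<theta>"
      unfolding normal_dens_mult[OF that] kern_def N_def by (simp add: mult_ac)
    finally show ?thesis unfolding F_def by simp
  qed
  have "(\<integral>(\<theta>, \<eta>). (\<eta> * normal_dens \<theta> \<eta> x * chisq_dens n \<eta> s) *\<^sub>R f \<theta> \<partial>prior_measure a b)
      = (\<integral>z. F z \<partial>prior_measure a b)"
    by (simp add: F_def case_prod_beta')
  also have "\<dots> = (\<integral>z. F (fst z, fst (snd z)) \<partial>density ?T (\<lambda>z. ennreal (d z)))"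
    unfolding pe by (rule integral_distr) measurable
  also have "\<dots> = (\<integral>z. d z *\<^sub>R F (fst z, fst (snd z)) \<partial>?T)"
    by (subst integral_density) (auto simp: d_def space_pair_measure intro!: AE_I2)
  also have "\<dots> = (\<integral>z. (case z of (\<theta>, z) \<Rightarrow> kern x s (fst z) (snd z) *\<^sub>R N z \<theta> *\<^sub>R f \<theta>) \<partial>?T)"
    using key by (intro Bochner_Integration.integral_cong) (auto simp: space_pair_measure)
  also have "\<dots> = (\<integral>z. \<integral>\<theta>. kern x s (fst z) (snd z) *\<^sub>R N z \<theta> *\<^sub>R f \<theta> \<partial>lborel \<partial>pos_plane)"
  proof (rule param.integral_snd[symmetric])
    show "integrable ?T (\<lambda>(\<theta>, z). kern x s (fst z) (snd z) *\<^sub>R N z \<theta> *\<^sub>R f \<theta>)"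
    proof (rule integrableI_bounded)
      show m: "(\<lambda>(\<theta>, z). kern x s (fst z) (snd z) *\<^sub>R N z \<theta> *\<^sub>R f \<theta>) \<in> borel_measurable ?T"
        unfolding case_prod_beta' by measurable
      have "(\<integral>\<^sup>+z. ennreal (norm (case z of (\<theta>, z) \<Rightarrow> kern x s (fst z) (snd z) *\<^sub>R N z \<theta> *\<^sub>R f \<theta>)) \<partial>?T)
         = (\<integral>\<^sup>+z. \<integral>\<^sup>+\<theta>. ennreal (norm (kern x s (fst z) (snd z) *\<^sub>R N z \<theta> *\<^sub>R f \<theta>)) \<partial>lborel \<partial>pos_plane)"
        using m by (subst param.nn_integral_snd[symmetric]) auto
      also have "\<dots> \<le> (\<integral>\<^sup>+z. ennreal (1 + (norm x)\<^sup>2) * ennreal (kern x s (fst z) (snd z)) + ennreal p * ennreal (kern x s (fst z) (snd z) / fst z) \<partial>pos_plane)"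
      proof (intro nn_integral_mono)
        fix z :: "real \<times> real" assume "z \<in> space pos_plane"
        then have z: "fst z > 0" "snd z > 0" by (auto simp: space_pos2)
        define \<tau> where "\<tau> = fst z * (snd z + 1) / snd z"
        define m where "m = (snd z / (snd z + 1)) *\<^sub>R x"
        define k where "k = kern x s (fst z) (snd z)"
        have k: "k \<ge> 0" by (simp add: k_def)
        have \<tau>: "\<tau> > 0" using z by (simp add: \<tau>_def)
        have N: "N z \<theta> = normal_dens m \<tau> \<theta>" for \<theta> by (simp add: N_def m_def \<tau>_def)
        have "(\<integral>\<^sup>+\<theta>. ennreal (norm (k *\<^sub>R N z \<theta> *\<^sub>R f \<theta>)) \<partial>lborel)
           \<le> (\<integral>\<^sup>+\<theta>. ennreal k * (ennreal (normal_dens m \<tau> \<theta>) + ennreal (normal_dens m \<tau> \<theta> * (norm (\<theta> - 0))\<^sup>2)) \<partial>lborel)"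
        proof (intro nn_integral_mono)
          fix \<theta> :: "real ^ 'p"
          have "norm (k *\<^sub>R N z \<theta> *\<^sub>R f \<theta>) \<le> k * (normal_dens m \<tau> \<theta> * (1 + (norm \<theta>)\<^sup>2))"
            unfolding N norm_scaleR using k bnd[of \<theta>] by (intro mult_mono) (auto intro!: mult_left_mono)
          then have "ennreal (norm (k *\<^sub>R N z \<theta> *\<^sub>R f \<theta>)) \<le> ennreal (k * (normal_dens m \<tau> \<theta> * (1 + (norm \<theta>)\<^sup>2)))"
            by (rule ennreal_leI)
          also have "\<dots> = ennreal k * (ennreal (normal_dens m \<tau> \<theta>) + ennreal (normal_dens m \<tau> \<theta> * (norm (\<theta> - 0))\<^sup>2))"
            using k by (simp add: ennreal_mult[symmetric] ennreal_plus[symmetric] distrib_left del: ennreal_plus)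
          finally show "ennreal (norm (k *\<^sub>R N z \<theta> *\<^sub>R f \<theta>)) \<le> \<dots>" .
        qed
        also have "\<dots> = ennreal k * (1 + ennreal ((norm (m - 0))\<^sup>2 + real CARD('p) / \<tau>))"
          by (subst nn_integral_cmult, simp, subst nn_integral_add)
             (auto simp: nn_integral_normal_dens[OF \<tau>] nn_integral_normal_dens_sq_dist[OF \<tau>, of m 0, simplified])
        also have "\<dots> = ennreal (k * (1 + ((norm m)\<^sup>2 + p / \<tau>)))"
          using \<tau> k by (simp add: ennreal_mult'' p_eq flip: ennreal_1)
        also have "\<dots> \<le> ennreal (k * (1 + ((norm x)\<^sup>2 + p / fst z)))"
        proof (intro ennreal_leI mult_left_mono add_left_mono add_mono k)
          have "norm m \<le> 1 * norm x"
            unfolding m_def norm_scaleR using z by (intro mult_right_mono) auto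
          then show "(norm m)\<^sup>2 \<le> (norm x)\<^sup>2" by (intro power_mono) auto
          have "fst z \<le> \<tau>" unfolding \<tau>_def using z by (simp add: field_simps)
          then show "p / \<tau> \<le> p / fst z"
            using z p_ge \<tau> by (intro divide_left_mono) auto
        qed
        also have "\<dots> = ennreal ((1 + (norm x)\<^sup>2) * k + p * (k / fst z))"
          by (simp add: algebra_simps)
        also have "\<dots> = ennreal (1 + (norm x)\<^sup>2) * ennreal k + ennreal p * ennreal (k / fst z)"
          using k z p_ge by (simp add: ennreal_mult[symmetric] ennreal_plus[symmetric] del: ennreal_plus times_divide_eq_right)
        finally show "(\<integral>\<^sup>+\<theta>. ennreal (norm (kern x s (fst z) (snd z) *\<^sub>R N z \<theta> *\<^sub>R f \<theta>)) \<partial>lborel)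
           \<le> ennreal (1 + (norm x)\<^sup>2) * ennreal (kern x s (fst z) (snd z)) + ennreal p * ennreal (kern x s (fst z) (snd z) / fst z)"
          unfolding k_def .
      qed
      also have "\<dots> = ennreal (1 + (norm x)\<^sup>2) * (\<integral>\<^sup>+z. ennreal (kern x s (fst z) (snd z)) \<partial>pos_plane)
         + ennreal p * (\<integral>\<^sup>+z. ennreal (kern x s (fst z) (snd z) / fst z) \<partial>pos_plane)"
        by (subst nn_integral_add) (auto simp: nn_integral_cmult)
      also have "\<dots> < \<infinity>"
        using nn_integral_kern_finite[OF s, of x] nn_integral_kern_div_precision_finite[OF s, of x]
        by (auto simp: ennreal_mult_less_top)
      finally show "(\<integral>\<^sup>+z. ennreal (norm (case z of (\<theta>, z) \<Rightarrow> kern x s (fst z) (snd z) *\<^sub>R N z \<theta> *\<^sub>R f \<theta>)) \<partial>?T) < \<infinity>" .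
    qed
  qed
  also have "\<dots> = (\<integral>z. kern x s (fst z) (snd z) *\<^sub>R (\<integral>\<theta>. N z \<theta> *\<^sub>R f \<theta> \<partial>lborel) \<partial>pos_plane)"
    by (simp only: integral_scaleR_right)
  finally show ?thesis unfolding N_def .
qed

lemma integral_kern_eq:
  assumes s: "s > 0" and f [measurable]: "f \<in> borel_measurable borel" and f0: "\<And>g. g > 0 \<Longrightarrow> f g \<ge> 0"
  shows "(\<integral>z. f (snd z) * kern x s (fst z) (snd z) \<partial>pos_plane)
     = gamma_const 0 * s powr (- p / 2 - 2) * (\<integral>g. f g * mix ((norm x)\<^sup>2 / s) g \<partial>pos_lborel)"
proof -
  note [measurable] = borel_measurable_pos_lborelI[OF f]
  have g0: "gamma_const 0 > 0" using kappa_gt by (intro gamma_const_pos) auto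
  have "(\<integral>z. f (snd z) * kern x s (fst z) (snd z) \<partial>pos_plane)
    = enn2real (\<integral>\<^sup>+z. ennreal (f (snd z) * kern x s (fst z) (snd z)) \<partial>pos_plane)"
    using f0 by (intro integral_eq_nn_integral) (auto simp: space_pos2)
  also have "(\<integral>\<^sup>+z. ennreal (f (snd z) * kern x s (fst z) (snd z)) \<partial>pos_plane)
     = (\<integral>\<^sup>+z. ennreal (f (snd z) * (fst z * s) powr 0 * kern x s (fst z) (snd z)) \<partial>pos_plane)"
    using s by (intro nn_integral_cong) (auto simp: space_pos2)
  also have "\<dots> = ennreal (gamma_const 0 * s powr (- p / 2 - 2)) *
      (\<integral>\<^sup>+g. ennreal (f g * (1 + (norm x)\<^sup>2 / s / (g + 1)) powr (- 0) * mix ((norm x)\<^sup>2 / s) g) \<partial>pos_lborel)"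
    using kappa_gt f0 by (intro nn_integral_kern_eq[OF s]) auto
  also have "(\<integral>\<^sup>+g. ennreal (f g * (1 + (norm x)\<^sup>2 / s / (g + 1)) powr (- 0) * mix ((norm x)\<^sup>2 / s) g) \<partial>pos_lborel)
     = (\<integral>\<^sup>+g. ennreal (f g * mix ((norm x)\<^sup>2 / s) g) \<partial>pos_lborel)"
  proof (intro nn_integral_cong)
    fix g assume "g \<in> space pos_lborel"
    then have "0 < 1 + (norm x)\<^sup>2 / s / (g + 1)" using s by (intro add_pos_nonneg) auto
    then have "1 + (norm x)\<^sup>2 / s / (g + 1) \<noteq> 0" by linarith
    then show "ennreal (f g * (1 + (norm x)\<^sup>2 / s / (g + 1)) powr (- 0) * mix ((norm x)\<^sup>2 / s) g) = ennreal (f g * mix ((norm x)\<^sup>2 / s) g)"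
      by (simp only: minus_zero powr_zero_eq_one) simp
  qed
  also have "enn2real (ennreal (gamma_const 0 * s powr (- p / 2 - 2)) * \<dots>) = gamma_const 0 * s powr (- p / 2 - 2) * (\<integral>g. f g * mix ((norm x)\<^sup>2 / s) g \<partial>pos_lborel)"
    using g0 f0 by (subst integral_eq_nn_integral) (auto simp: enn2real_mult)
  finally show ?thesis .
qed

lemma integrable_mix: "w \<ge> 0 \<Longrightarrow> integrable pos_lborel (\<lambda>g. mix w g)"
proof (rule integrableI_nonneg)
  assume w: "w \<ge> 0"
  have "(\<integral>\<^sup>+g. ennreal (mix w g) \<partial>pos_lborel) = (\<integral>\<^sup>+g. ennreal ((g + 1) powr (- 0) * (1 + w / (g + 1)) powr (- 0) * mix w g) \<partial>pos_lborel)"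
    using w by (intro nn_integral_cong) (auto simp: add_pos_nonneg less_imp_neq[symmetric])
  also have "\<dots> < \<infinity>"
    using nn_integral_mix_le[of 0 0 w] w kappa_gt p_ge a_ge by (auto intro: le_less_trans)
  finally show "(\<integral>\<^sup>+g. ennreal (mix w g) \<partial>pos_lborel) < \<infinity>" .
qed auto

lemma integrable_mix_div: "w \<ge> 0 \<Longrightarrow> integrable pos_lborel (\<lambda>g. mix w g / (g + 1))"
  by (rule Bochner_Integration.integrable_bound[OF integrable_mix, of w])
     (auto simp: abs_mult divide_le_eq distrib_left intro!: AE_I2)

lemma integral_mix_pos: "w \<ge> 0 \<Longrightarrow> (\<integral>g. mix w g \<partial>pos_lborel) > 0"
proof -
  assume w: "w \<ge> 0"
  obtain c where c: "c > 0" "ennreal (c * (1 + w) powr (- (p / 2 + a + 1))) \<le> (\<integral>\<^sup>+g. ennreal (mix w g) \<partial>pos_lborel)"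
    using nn_integral_mix_ge w by blast
  have "(\<integral>\<^sup>+g. ennreal (mix w g) \<partial>pos_lborel) = ennreal (\<integral>g. mix w g \<partial>pos_lborel)"
    using integrable_mix[OF w] by (intro nn_integral_eq_integral) auto
  with c have "c * (1 + w) powr (- (p / 2 + a + 1)) \<le> (\<integral>g. mix w g \<partial>pos_lborel)"
    by (simp add: ennreal_le_iff integral_nonneg_AE)
  moreover have "c * (1 + w) powr (- (p / 2 + a + 1)) > 0" using c w by simp
  ultimately show ?thesis by linarith
qed

text \<open>After \<theta> and \<eta> are integrated out, numerator and denominator share the factor
  \<open>c\<close>, which carries all dependence on \<open>s\<close> other than through
  \<open>w\<close>, and it cancels. The posterior mean of \<theta> given \<open>g\<close> is
  \<open>g / (g + 1)\<close> times \<open>x\<close>, which gives one minus the mean of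
  \<open>1 / (g + 1)\<close>.\<close>

lemma gen_bayes_prior:
  fixes x :: "real ^ 'p"
  assumes s: "s > 0"
  shows "gen_bayes n (prior_measure a b) (x, s) = (1 - mixmean ((norm x)\<^sup>2 / s)) *\<^sub>R x"
proof -
  define w where "w = (norm x)\<^sup>2 / s"
  have w: "w \<ge> 0" using s by (simp add: w_def)
  define c where "c = gamma_const 0 * s powr (- p / 2 - 2)"
  have c: "c > 0" using s kappa_gt by (auto simp: c_def intro!: mult_pos_pos gamma_const_pos)
  have num: "(\<integral>(\<theta>, \<eta>). (\<eta> * normal_dens \<theta> \<eta> x * chisq_dens n \<eta> s) *\<^sub>R \<theta> \<partial>prior_measure a b)
     = (c * (\<integral>g. g / (g + 1) * mix w g \<partial>pos_lborel)) *\<^sub>R x"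
  proof -
    have "(\<integral>(\<theta>, \<eta>). (\<eta> * normal_dens \<theta> \<eta> x * chisq_dens n \<eta> s) *\<^sub>R \<theta> \<partial>prior_measure a b)
      = (\<integral>z. kern x s (fst z) (snd z) *\<^sub>R
        (\<integral>\<theta>. normal_dens ((snd z / (snd z + 1)) *\<^sub>R x) (fst z * (snd z + 1) / snd z) \<theta> *\<^sub>R \<theta> \<partial>lborel)
        \<partial>pos_plane)"
      using norm_le_one_plus_sq by (intro integral_prior[OF s]) auto
    also have "\<dots> = (\<integral>z. (snd z / (snd z + 1) * kern x s (fst z) (snd z)) *\<^sub>R x \<partial>pos_plane)"
      by (intro Bochner_Integration.integral_cong refl, subst integral_normal_dens_scaleR_id) (auto simp: space_pos2)
    also have "\<dots> = (\<integral>z. snd z / (snd z + 1) * kern x s (fst z) (snd z) \<partial>pos_plane) *\<^sub>R x"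
      by (rule integral_scaleR_left)
        (rule Bochner_Integration.integrable_bound[OF integrable_kern[OF s, of x]], simp,
         auto simp: space_pos2 abs_mult divide_le_eq distrib_left distrib_right mult.commute intro!: AE_I2)
    also have "(\<integral>z. snd z / (snd z + 1) * kern x s (fst z) (snd z) \<partial>pos_plane)
       = c * (\<integral>g. g / (g + 1) * mix w g \<partial>pos_lborel)"
      unfolding c_def w_def by (rule integral_kern_eq[OF s]) auto
    finally show ?thesis .
  qed
  have den: "(\<integral>(\<theta>, \<eta>). \<eta> * normal_dens \<theta> \<eta> x * chisq_dens n \<eta> s \<partial>prior_measure a b)
     = c * (\<integral>g. mix w g \<partial>pos_lborel)"
  proof -
    have "(\<integral>(\<theta>, \<eta>). (\<eta> * normal_dens \<theta> \<eta> x * chisq_dens n \<eta> s) *\<^sub>R (1::real) \<partial>prior_measure a b)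
      = (\<integral>z. kern x s (fst z) (snd z) *\<^sub>R
        (\<integral>\<theta>. normal_dens ((snd z / (snd z + 1)) *\<^sub>R x) (fst z * (snd z + 1) / snd z) \<theta> *\<^sub>R 1 \<partial>lborel)
        \<partial>pos_plane)"
      by (intro integral_prior[OF s]) auto
    also have "\<dots> = (\<integral>z. 1 * kern x s (fst z) (snd z) \<partial>pos_plane)"
      by (intro Bochner_Integration.integral_cong refl) (auto simp: space_pos2 integral_normal_dens)
    also have "\<dots> = c * (\<integral>g. 1 * mix w g \<partial>pos_lborel)"
      unfolding c_def w_def by (rule integral_kern_eq[OF s]) auto
    finally show ?thesis by simp
  qed
  have "(\<integral>g. g / (g + 1) * mix w g \<partial>pos_lborel) = (\<integral>g. mix w g - mix w g / (g + 1) \<partial>pos_lborel)"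
    by (intro Bochner_Integration.integral_cong refl) (auto simp: field_simps)
  also have "\<dots> = (\<integral>g. mix w g \<partial>pos_lborel) - (\<integral>g. mix w g / (g + 1) \<partial>pos_lborel)"
    using integrable_mix[OF w] integrable_mix_div[OF w] by simp
  finally have *: "(\<integral>g. g / (g + 1) * mix w g \<partial>pos_lborel) = (\<integral>g. mix w g \<partial>pos_lborel) - (\<integral>g. mix w g / (g + 1) \<partial>pos_lborel)" .
  show ?thesis
    unfolding gen_bayes_def prod.case num den w_def[symmetric] mixmean_def * scaleR_scaleR
    using c integral_mix_pos[OF w] by (intro arg_cong2[where f=scaleR] refl) (simp add: field_simps)
qed

end

section \<open>Monotonicity and boundedness of the shrinkage factor\<close>

text \<open>This test and the next replace integration by parts. A dilation inequality that holds on
  one side of \<open>c = 1\<close>, with equality at 1, gives a sign for the derivative there, and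
  that derivative is the desired relation between integrals.\<close>

lemma deriv_nonpos_of_max_right:
  fixes g :: "real \<Rightarrow> real"
  assumes "(g has_real_derivative d) (at x)" "\<And>c. c > x \<Longrightarrow> g c \<le> g x"
  shows "d \<le> 0"
proof (rule ccontr)
  assume "\<not> d \<le> 0"
  then obtain e where e: "e > 0" "\<And>h. h > 0 \<Longrightarrow> h < e \<Longrightarrow> g x < g (x + h)"
    using DERIV_pos_inc_right[OF assms(1)] by auto
  from e(2)[of "e / 2"] e(1) assms(2)[of "x + e / 2"] show False by auto
qed

lemma deriv_nonneg_of_max_left:
  fixes g :: "real \<Rightarrow> real"
  assumes "(g has_real_derivative d) (at x)" "y < x" "\<And>c. y < c \<Longrightarrow> c < x \<Longrightarrow> g c \<le> g x"
  shows "d \<ge> 0"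
proof (rule ccontr)
  assume "\<not> d \<ge> 0"
  then obtain e where e: "e > 0" "\<And>h. h > 0 \<Longrightarrow> h < e \<Longrightarrow> g x < g (x - h)"
    using DERIV_neg_dec_left[OF assms(1)] by auto
  define h where "h = min (e / 2) ((x - y) / 2)"
  have "h > 0" "h < e" "y < x - h" using e(1) assms(2) by (auto simp: h_def min_def field_simps)
  with e(2)[of h] assms(3)[of "x - h"] show False by auto
qed

text \<open>The factor \<open>(g / (g + 1)) powr b\<close> of the mixing density as a function of \<open>h = g + 1\<close>.\<close>

definition pos_part_powr :: "real \<Rightarrow> real \<Rightarrow> real" where
  "pos_part_powr b h = (if h > 1 then (1 - 1 / h) powr b else 0)"

lemma pos_part_powr_measurable [measurable]:
  assumes [measurable]: "f \<in> borel_measurable M"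
  shows "(\<lambda>x. pos_part_powr b (f x)) \<in> borel_measurable M"
  unfolding pos_part_powr_def by measurable

lemma pos_part_powr_nonneg [simp]: "pos_part_powr b h \<ge> 0"
  by (simp add: pos_part_powr_def)

lemma pos_part_powr_mono: "b \<ge> 0 \<Longrightarrow> h \<le> h' \<Longrightarrow> pos_part_powr b h \<le> pos_part_powr b h'"
  by (auto simp: pos_part_powr_def field_simps intro!: powr_mono2)

text \<open>Monotone likelihood ratio in cross-multiplied form, so that zeros of the weight need no
  division: the ratio of the values at \<open>w * u\<close> and \<open>v * u\<close> is
  nonincreasing in \<open>u\<close>. If \<open>v * u > 1\<close>, all four arguments exceed 1 and
  the claim comes from \<open>(1 / u - 1 / t) * (1 / v - 1 / w) \<ge> 0\<close>; otherwise the left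
  side vanishes.\<close>

lemma pos_part_powr_log_concave:
  assumes b: "b \<ge> 0" and v: "0 < v" "v \<le> w" and u: "0 < u" "u \<le> t"
  shows "pos_part_powr b (v * u) * pos_part_powr b (w * t) \<le> pos_part_powr b (w * u) * pos_part_powr b (v * t)"
proof (cases "v * u > 1")
  case True
  have le: "v * u \<le> w * u" "v * u \<le> v * t" "w * u \<le> w * t"
    using u v by (auto intro: mult_right_mono mult_left_mono)
  with True have gt: "w * u > 1" "v * t > 1" "w * t > 1" by linarith+
  have "(1 / u - 1 / t) * (1 / v - 1 / w) \<ge> 0"
    using u v by (intro mult_nonneg_nonneg) (auto simp: field_simps)
  then have "(1 - 1 / (v * u)) * (1 - 1 / (w * t)) \<le> (1 - 1 / (w * u)) * (1 - 1 / (v * t))"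
    by (simp add: algebra_simps)
  moreover have "0 \<le> (1 - 1 / (v * u)) * (1 - 1 / (w * t))" using True gt by (intro mult_nonneg_nonneg) auto
  ultimately have "((1 - 1 / (v * u)) * (1 - 1 / (w * t))) powr b \<le> ((1 - 1 / (w * u)) * (1 - 1 / (v * t))) powr b"
    using b by (intro powr_mono2) auto
  then show ?thesis using True gt by (simp add: pos_part_powr_def powr_mult)
next
  case False
  then show ?thesis by (simp add: pos_part_powr_def[of b "v * u"])
qed

section \<open>The shrinkage factor in the dilated variable \<open>u\<close>\<close>

context scale_mixture begin

text \<open>The density of \<open>mix w\<close> in the variable \<open>u = (g + 1) / w\<close> is \<open>wt u * pos_part_powr b (w * u)\<close>, up to a
  constant; \<open>w\<close> enters only through the second factor.\<close>

definition wt :: "real \<Rightarrow> real" where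
  "wt u = u powr (- (p / 2 + a + 2)) * (1 + 1 / u) powr (- \<kappa>)"

lemma wt_measurable [measurable]:
  assumes [measurable]: "f \<in> borel_measurable M"
  shows "(\<lambda>x. wt (f x)) \<in> borel_measurable M"
  unfolding wt_def by measurable

lemma wt_nonneg [simp]: "wt u \<ge> 0" by (simp add: wt_def)

lemma mix_rescale:
  assumes w: "w > 0" and u: "w * u > 1"
  shows "mix w (w * u - 1) = w powr (- (p / 2 + a + 2)) * (wt u * pos_part_powr b (w * u))"
proof -
  have u0: "u > 0" using w u by (metis less_trans zero_less_mult_pos zero_less_one)
  have 1: "(w * u) powr (- p / 2) * (1 / (w * u) powr (a + 2)) = w powr (- (p / 2 + a + 2)) * u powr (- (p / 2 + a + 2))"
    unfolding powr_minus_divide[symmetric] powr_add[symmetric] powr_mult[symmetric] by (simp add: algebra_simps)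
  have 2: "(w * u - 1) / (w * u) = 1 - 1 / (w * u)" "w / (w * u) = 1 / u"
    using w u0 by (auto simp: field_simps)
  have "mix w (w * u - 1) = ((w * u) powr (- p / 2) * (1 / (w * u) powr (a + 2))) * (1 + 1 / u) powr (- \<kappa>) * (1 - 1 / (w * u)) powr b"
    by (simp add: mix_def mixing_dens_def 2)
  then show ?thesis unfolding 1 using u by (simp add: wt_def pos_part_powr_def)
qed

lemma
  assumes w: "w > 0"
  shows integrable_wt: "integrable lborel (\<lambda>u. wt u * pos_part_powr b (w * u))"
    and integral_mix_rescale: "(\<integral>g. mix w g \<partial>pos_lborel) = w powr (1 - (p / 2 + a + 2)) * (\<integral>u. wt u * pos_part_powr b (w * u) \<partial>lborel)"
    and integrable_wt_div: "integrable lborel (\<lambda>u. wt u * pos_part_powr b (w * u) / u)"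
    and integral_mix_div_rescale: "(\<integral>g. mix w g / (g + 1) \<partial>pos_lborel) = w powr (- (p / 2 + a + 2)) * (\<integral>u. wt u * pos_part_powr b (w * u) / u \<partial>lborel)"
proof -
  define B where "B = p / 2 + a + 2"
  \<comment> \<open>The jump of \<open>pos_part_powr\<close> at 1 absorbs the indicator of
    \<open>g > 0\<close>, so the integrals in \<open>u\<close> may run over the whole line.\<close>
  have e: "indicator {0<..} (- 1 + w * u) *\<^sub>R mix w (- 1 + w * u) = w powr (- B) * (wt u * pos_part_powr b (w * u))" for u
    using mix_rescale[OF w, of u] by (auto simp: indicator_def B_def pos_part_powr_def)
  have e': "indicator {0<..} (- 1 + w * u) *\<^sub>R (mix w (- 1 + w * u) / (- 1 + w * u + 1)) = w powr (- B) / w * (wt u * pos_part_powr b (w * u) / u)" for u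
    using mix_rescale[OF w, of u] w by (auto simp: indicator_def B_def pos_part_powr_def)
  have i: "integrable lborel (\<lambda>g. indicator {0<..} g *\<^sub>R mix w g)"
    using integrable_mix[OF less_imp_le[OF w]] integrable_restrict_space[of "{0<..}" lborel "mix w"] by (simp add: pos_lborel_def)
  have i': "integrable lborel (\<lambda>g. indicator {0<..} g *\<^sub>R (mix w g / (g + 1)))"
    using integrable_mix_div[OF less_imp_le[OF w]] integrable_restrict_space[of "{0<..}" lborel "\<lambda>g. mix w g / (g + 1)"] by (simp add: pos_lborel_def)
  have nz: "w powr (- B) \<noteq> 0" "w powr (- B) / w \<noteq> 0" using w by auto
  have *: "w * w powr (- B) = w powr (1 - B)" using w by (simp add: powr_mult_base)
  show "integrable lborel (\<lambda>u. wt u * pos_part_powr b (w * u))"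
    using lborel_integrable_real_affine[OF i, of w "-1"] w unfolding e
    using nz by (simp add: integrable_mult_right_iff)
  show "integrable lborel (\<lambda>u. wt u * pos_part_powr b (w * u) / u)"
  proof -
    have "integrable lborel (\<lambda>u. w powr (- B) / w * (wt u * pos_part_powr b (w * u) / u))"
      using lborel_integrable_real_affine[OF i', of w "-1"] w unfolding e' by simp
    from integrable_mult_right[OF this, of "w / w powr (- B)"] show ?thesis using nz w by simp
  qed
  have "(\<integral>g. mix w g \<partial>pos_lborel) = (\<integral>g. indicator {0<..} g *\<^sub>R mix w g \<partial>lborel)"
    unfolding pos_lborel_def by (subst integral_restrict_space) auto
  also have "\<dots> = w * (\<integral>u. w powr (- B) * (wt u * pos_part_powr b (w * u)) \<partial>lborel)"
    using w lborel_integral_real_affine[of w "\<lambda>g. indicator {0<..} g *\<^sub>R mix w g" "-1"] unfolding e by simp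
  also have "\<dots> = w powr (1 - B) * (\<integral>u. wt u * pos_part_powr b (w * u) \<partial>lborel)"
    by (simp add: *[symmetric])
  finally show "(\<integral>g. mix w g \<partial>pos_lborel) = w powr (1 - (p / 2 + a + 2)) * (\<integral>u. wt u * pos_part_powr b (w * u) \<partial>lborel)"
    unfolding B_def .
  have "(\<integral>g. mix w g / (g + 1) \<partial>pos_lborel) = (\<integral>g. indicator {0<..} g *\<^sub>R (mix w g / (g + 1)) \<partial>lborel)"
    unfolding pos_lborel_def by (subst integral_restrict_space) auto
  also have "\<dots> = w * (\<integral>u. w powr (- B) / w * (wt u * pos_part_powr b (w * u) / u) \<partial>lborel)"
    using w lborel_integral_real_affine[of w "\<lambda>g. indicator {0<..} g *\<^sub>R (mix w g / (g + 1))" "-1"] unfolding e' by simp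
  also have "\<dots> = w * (w powr (- B) / w * (\<integral>u. wt u * pos_part_powr b (w * u) / u \<partial>lborel))"
    by (subst Bochner_Integration.integral_mult_right_zero) simp
  also have "\<dots> = w powr (- B) * (\<integral>u. wt u * pos_part_powr b (w * u) / u \<partial>lborel)" using w by simp
  finally show "(\<integral>g. mix w g / (g + 1) \<partial>pos_lborel) = w powr (- (p / 2 + a + 2)) * (\<integral>u. wt u * pos_part_powr b (w * u) / u \<partial>lborel)"
    unfolding B_def .
qed

lemma mixmean_measurable [measurable]: "mixmean \<in> borel_measurable borel"
  unfolding mixmean_def by measurable

lemma mixmean_nonneg: "w \<ge> 0 \<Longrightarrow> mixmean w \<ge> 0"
  using integral_mix_pos[of w] unfolding mixmean_def
  by (intro divide_nonneg_nonneg integral_nonneg_AE) (auto intro!: AE_I2)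

text \<open>Strictness is used in the monotonicity proof: it places the sign change \<open>t\<close>
  where \<open>v * t > 1\<close>, so that the weight there is positive and can be divided
  out.\<close>

lemma mixmean_less_1:
  assumes w: "w \<ge> 0"
  shows "mixmean w < 1"
proof -
  have "{0<..<1} \<subseteq> {0::real<..}" by auto
  from emeasure_mono[OF this, of lborel] have inf: "emeasure lborel {0::real<..} \<noteq> 0" by auto
  have em: "emeasure pos_lborel (space pos_lborel) \<noteq> 0"
  proof -
    have "emeasure pos_lborel (space pos_lborel) = emeasure lborel {0::real<..}"
      unfolding pos_lborel_def by (subst emeasure_restrict_space) (auto simp: space_restrict_space)
    then show ?thesis using inf by simp
  qed
  define f where "f = (\<lambda>g. mix w g - mix w g / (g + 1))"
  have f_pos: "f g > 0" if "g > 0" for g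
    using mix_pos[OF w that] that by (auto simp: f_def divide_less_eq distrib_left)
  have f_int: "integrable pos_lborel f"
    unfolding f_def using w by (intro Bochner_Integration.integrable_diff integrable_mix integrable_mix_div)
  have f0: "AE g in pos_lborel. 0 \<le> f g" using f_pos by (intro AE_I2) (auto intro: less_imp_le)
  have "(\<integral>g. f g \<partial>pos_lborel) \<noteq> 0"
  proof
    assume "(\<integral>g. f g \<partial>pos_lborel) = 0"
    then have "AE g in pos_lborel. f g = 0"
      using integral_nonneg_eq_0_iff_AE[OF f_int f0] by simp
    moreover have "AE g in pos_lborel. f g > 0" using f_pos by (intro AE_I2) auto
    ultimately have "AE g in pos_lborel. False" by eventually_elim simp
    moreover have "{x \<in> space pos_lborel. \<not> False} = space pos_lborel" by auto
    ultimately show False using em AE_iff_measurable[OF sets.top[of pos_lborel], of "\<lambda>_. False"] by metis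
  qed
  moreover have "0 \<le> (\<integral>g. f g \<partial>pos_lborel)" using f0 by (rule integral_nonneg_AE)
  ultimately have "0 < (\<integral>g. f g \<partial>pos_lborel)" by linarith
  then have "(\<integral>g. mix w g / (g + 1) \<partial>pos_lborel) < (\<integral>g. mix w g \<partial>pos_lborel)"
    unfolding f_def using w by (simp add: integrable_mix integrable_mix_div)
  then show ?thesis using integral_mix_pos[OF w] by (simp add: mixmean_def)
qed

lemma integral_wt_pos:
  assumes w: "w > 0"
  shows "(\<integral>u. wt u * pos_part_powr b (w * u) \<partial>lborel) > 0"
  using integral_mix_pos[of w] w integral_mix_rescale[OF w] by (simp add: zero_less_mult_iff)

text \<open>Since \<open>w / (g + 1)\<close> equals \<open>1 / u\<close>, the quantity
  \<open>w * mixmean w\<close> is a weighted mean of \<open>1 / u\<close>.\<close>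

lemma mixmean_eq_ratio:
  assumes w: "w > 0"
  shows "w * mixmean w = (\<integral>u. wt u * pos_part_powr b (w * u) / u \<partial>lborel) / (\<integral>u. wt u * pos_part_powr b (w * u) \<partial>lborel)"
proof -
  have "w powr (1 - (p / 2 + a + 2)) = w * w powr (- (p / 2 + a + 2))" using w by (simp add: powr_mult_base)
  then show ?thesis
    unfolding mixmean_def integral_mix_rescale[OF w] integral_mix_div_rescale[OF w]
    using w by simp
qed

text \<open>A Chebyshev-type argument. The function \<open>1 / u - \<phi>\<close> has weighted mean
  zero at \<open>v\<close> and is decreasing on the positive axis; passing from \<open>v\<close> to
  \<open>w\<close> multiplies the weight by a nonincreasing ratio, which favours the region where
  the function is positive.\<close>

lemma shrinkage_mono:
  assumes v: "0 \<le> v" "v \<le> w"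
  shows "v * mixmean v \<le> w * mixmean w"
proof (cases "v * mixmean v > 0")
  case False
  then show ?thesis using mixmean_nonneg[of w] v by (metis linorder_not_less mult_nonneg_nonneg order_trans)
next
  case True
  with v have v0: "v > 0" by (cases "v = 0") auto
  then have w0: "w > 0" using v by simp
  define \<phi> where "\<phi> = v * mixmean v"
  \<comment> \<open>The point at which \<open>1 / u - \<phi>\<close> changes sign.\<close>
  define t where "t = 1 / \<phi>"
  have t: "t > 0" using True by (simp add: t_def \<phi>_def)
  have "\<phi> < v" using mixmean_less_1[of v] v0 by (simp add: \<phi>_def)
  then have vt: "v * t > 1" using True unfolding t_def by (simp add: \<phi>_def[symmetric] less_divide_eq)
  define J0 where "J0 = (\<lambda>w. \<integral>u. wt u * pos_part_powr b (w * u) \<partial>lborel)"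
  define J1 where "J1 = (\<lambda>w. \<integral>u. wt u * pos_part_powr b (w * u) / u \<partial>lborel)"
  \<comment> \<open>Both factors change sign at \<open>u = t\<close>: before it both are
    nonnegative, after it both are nonpositive. The weights at \<open>t\<close> normalize the
    likelihood ratio to 1 there.\<close>
  have pw: "0 \<le> wt u * ((1 / u - \<phi>) * (pos_part_powr b (w * u) * pos_part_powr b (v * t) - pos_part_powr b (v * u) * pos_part_powr b (w * t)))" for u
  proof (cases "u > 0")
    case False
    then have "w * u \<le> 0" "v * u \<le> 0" using v0 w0 by (auto simp: mult_le_0_iff)
    then show ?thesis by (simp add: pos_part_powr_def)
  next
    case u: True
    have \<phi>t: "\<phi> = 1 / t" by (simp add: t_def)
    show ?thesis
    proof (cases "u \<le> t")
      case True
      then show ?thesis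
        using pos_part_powr_log_concave[OF b_ge v0 v(2) u True] u t unfolding \<phi>t
        by (intro mult_nonneg_nonneg) (auto simp: field_simps)
    next
      case False
      have "(1 / t - 1 / u) * (pos_part_powr b (v * u) * pos_part_powr b (w * t) - pos_part_powr b (w * u) * pos_part_powr b (v * t)) \<ge> 0"
        using pos_part_powr_log_concave[OF b_ge v0 v(2) t, of u] False u t
        by (intro mult_nonneg_nonneg) (auto simp: field_simps)
      moreover have "(\<alpha> - \<beta>) * (X - Y) = (\<beta> - \<alpha>) * (Y - X)" for X Y \<alpha> \<beta> :: real by (simp add: algebra_simps)
      ultimately have "(1 / u - 1 / t) * (pos_part_powr b (w * u) * pos_part_powr b (v * t) - pos_part_powr b (v * u) * pos_part_powr b (w * t)) \<ge> 0"
        by metis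
      then show ?thesis unfolding \<phi>t by (rule mult_nonneg_nonneg[OF wt_nonneg])
    qed
  qed
  have "0 \<le> (\<integral>u. wt u * ((1 / u - \<phi>) * (pos_part_powr b (w * u) * pos_part_powr b (v * t) - pos_part_powr b (v * u) * pos_part_powr b (w * t))) \<partial>lborel)"
    using pw by (intro integral_nonneg_AE) auto
  also have "\<dots> = (\<integral>u. (wt u * pos_part_powr b (w * u) / u - \<phi> * (wt u * pos_part_powr b (w * u))) * pos_part_powr b (v * t)
      - (wt u * pos_part_powr b (v * u) / u - \<phi> * (wt u * pos_part_powr b (v * u))) * pos_part_powr b (w * t) \<partial>lborel)"
    by (intro Bochner_Integration.integral_cong refl) (simp add: algebra_simps)
  also have "\<dots> = (J1 w - \<phi> * J0 w) * pos_part_powr b (v * t) - (J1 v - \<phi> * J0 v) * pos_part_powr b (w * t)"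
    unfolding J0_def J1_def
    by (simp add: integrable_wt[OF v0] integrable_wt[OF w0] integrable_wt_div[OF v0] integrable_wt_div[OF w0])
  also have "J1 v - \<phi> * J0 v = 0"
    using integral_wt_pos[OF v0] unfolding \<phi>_def mixmean_eq_ratio[OF v0] J0_def J1_def by simp
  finally have "0 \<le> (J1 w - \<phi> * J0 w) * pos_part_powr b (v * t)" by simp
  moreover have "pos_part_powr b (v * t) > 0" using vt by (simp add: pos_part_powr_def)
  ultimately have "\<phi> * J0 w \<le> J1 w" by (simp add: zero_le_mult_iff)
  then show ?thesis
    using integral_wt_pos[OF w0] unfolding \<phi>_def[symmetric] mixmean_eq_ratio[OF w0] J0_def J1_def by (simp add: pos_le_divide_eq)
qed

text \<open>For large \<open>w\<close> the factor \<open>pos_part_powr\<close> tends to 1 and the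
  ratio becomes one of complete beta integrals, equal to the stated bound. For finite
  \<open>w\<close> this would follow from an integration by parts whose extra term has a sign,
  because \<open>pos_part_powr\<close> is nondecreasing; the dilation
  \<open>u \<mapsto> c * u\<close> does the same without derivatives of the weight.\<close>

lemma shrinkage_le:
  assumes w: "w \<ge> 0"
  shows "w * mixmean w \<le> (p / 2 + a + 1) / (real n / 2 - a - 1)"
proof (cases "w = 0")
  case True
  then show ?thesis using p_ge a_ge a_less by simp
next
  case False
  with w have w: "w > 0" by simp
  define B where "B = p / 2 + a + 2"
  define m where "m = real n / 2 - a - 1"
  have m: "m > 0" "m = \<kappa> - B" using a_less by (auto simp: m_def B_def \<kappa>_def add_divide_distrib)
  define J0 where "J0 = (\<integral>u. wt u * pos_part_powr b (w * u) \<partial>lborel)"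
  define J1 where "J1 = (\<integral>u. wt u * pos_part_powr b (w * u) / u \<partial>lborel)"
  \<comment> \<open>The extra factor changes the exponent of \<open>1 + 1 / u\<close> to
    \<open>- (\<kappa> - 1)\<close>. The expansion of \<open>f (c * u)\<close> around
    \<open>c = 1\<close> then contains only \<open>f\<close> and the integrand of
    \<open>J0\<close>.\<close>
  define f where "f = (\<lambda>u. (1 + 1 / u) * (wt u * pos_part_powr b (w * u)))"
  have J0: "J0 > 0" using integral_wt_pos[OF w] by (simp add: J0_def)
  have fe: "f u = wt u * pos_part_powr b (w * u) + wt u * pos_part_powr b (w * u) / u" for u
    by (simp add: f_def algebra_simps)
  have f_int: "integrable lborel f"
    unfolding fe using integrable_wt[OF w] integrable_wt_div[OF w] by simp
  have f_eq: "(\<integral>u. f u \<partial>lborel) = J0 + J1"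
    unfolding fe J0_def J1_def using integrable_wt[OF w] integrable_wt_div[OF w] by simp
  \<comment> \<open>Equality holds at \<open>c = 1\<close>, so the derivative of the left side at 1
    is at most 0. That derivative is \<open>m * (J0 + J1) - (\<kappa> - 1) * J0\<close>.\<close>
  have main: "c powr m * (J0 + J1 - (\<kappa> - 1) * (c - 1) * J0) \<le> J0 + J1" if c: "c > 1" for c
  proof -
    have pw: "c powr m * (f u - (\<kappa> - 1) * (c - 1) * (wt u * pos_part_powr b (w * u))) \<le> c * f (c * u)" for u
    proof (cases "u > 0")
      case False
      then have "w * u \<le> 0" "w * (c * u) \<le> 0" using w c by (auto simp: mult_le_0_iff)
      then show ?thesis by (simp add: f_def pos_part_powr_def)
    next
      case u: True
      \<comment> \<open>Chosen so that \<open>1 + 1 / (c * u)\<close> equals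
        \<open>(1 + 1 / u) * (1 + y) / c\<close>: the dilation becomes a power of \<open>c\<close>
        and a small relative change.\<close>
      define y where "y = (c - 1) * u / (1 + u)"
      have y: "y \<ge> 0" using c u by (simp add: y_def)
      have \<kappa>1: "\<kappa> - 1 > 0" using kappa_gt by simp
      \<comment> \<open>Bernoulli's inequality for the negative exponent
        \<open>- (\<kappa> - 1)\<close>, obtained from \<open>exp z \<ge> 1 + z\<close> and
        \<open>ln (1 + y) \<le> y\<close>.\<close>
      have "1 + - (\<kappa> - 1) * ln (1 + y) \<le> exp (- (\<kappa> - 1) * ln (1 + y))" by (rule exp_ge_add_one_self)
      moreover have "ln (1 + y) \<le> y" using y by (intro ln_add_one_self_le_self) auto
      then have "(\<kappa> - 1) * ln (1 + y) \<le> (\<kappa> - 1) * y" using \<kappa>1 by (intro mult_left_mono) auto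
      ultimately have "1 - (\<kappa> - 1) * y \<le> exp (- (\<kappa> - 1) * ln (1 + y))" by linarith
      then have bern: "1 - (\<kappa> - 1) * y \<le> (1 + y) powr (- (\<kappa> - 1))"
        using y by (simp add: powr_def)
      define P where "P = u powr (- B) * (1 + 1 / u) powr (- (\<kappa> - 1))"
      have P: "P \<ge> 0" by (simp add: P_def)
      have wtP: "(1 + 1 / v) * wt v = v powr (- B) * (1 + 1 / v) powr (- (\<kappa> - 1))" if "v > 0" for v
        using powr_mult_base[of "1 + 1 / v" "- \<kappa>"] that by (simp add: wt_def B_def mult_ac)
      have e1: "1 + 1 / (c * u) = (1 + 1 / u) * (1 + y) / c"
      proof -
        have "1 + u \<noteq> 0" using u by simp
        then have "1 + y = (1 + c * u) / (1 + u)" "1 + 1 / u = (1 + u) / u" using u by (auto simp: y_def field_simps)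
        then have "(1 + 1 / u) * (1 + y) / c = (1 + c * u) / (c * u)" using \<open>1 + u \<noteq> 0\<close> by simp
        also have "\<dots> = 1 + 1 / (c * u)" using u c by (simp add: add_divide_distrib)
        finally show ?thesis ..
      qed
      have "(1 + 1 / (c * u)) powr (- (\<kappa> - 1)) = (1 + 1 / u) powr (- (\<kappa> - 1)) * (1 + y) powr (- (\<kappa> - 1)) * c powr (\<kappa> - 1)"
      proof -
        have "(A * D / c) powr (- r) = A powr (- r) * D powr (- r) * c powr r" for A D r
          by (simp add: powr_mult powr_divide powr_minus_divide)
        from this[of "1 + 1 / u" "1 + y" "\<kappa> - 1"] show ?thesis unfolding e1 .
      qed
      moreover have "(c * u) powr (- B) = c powr (- B) * u powr (- B)" by (rule powr_mult)
      ultimately have "(1 + 1 / (c * u)) * wt (c * u) = (c powr (- B) * c powr (\<kappa> - 1)) * (P * (1 + y) powr (- (\<kappa> - 1)))"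
        using wtP[of "c * u"] c u by (simp add: P_def mult_ac)
      also have "c powr (- B) * c powr (\<kappa> - 1) = c powr (m - 1)"
        by (simp add: powr_add[symmetric] m(2) algebra_simps)
      finally have e2: "(1 + 1 / (c * u)) * wt (c * u) = c powr (m - 1) * (P * (1 + y) powr (- (\<kappa> - 1)))" .
      have e3: "P * y = (c - 1) * wt u"
      proof -
        have "1 + u \<noteq> 0" "1 + 1 / u = (1 + u) / u" using u by (auto simp: field_simps)
        moreover have "P = (1 + 1 / u) * wt u" using wtP[OF u] by (simp add: P_def)
        ultimately have "P = (1 + u) / u * wt u" by simp
        then show ?thesis using u \<open>1 + u \<noteq> 0\<close> by (simp add: y_def)
      qed
      have "c powr m * (f u - (\<kappa> - 1) * (c - 1) * (wt u * pos_part_powr b (w * u)))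
        = c powr m * ((P - (\<kappa> - 1) * ((c - 1) * wt u)) * pos_part_powr b (w * u))"
      proof -
        have "f u = ((1 + 1 / u) * wt u) * pos_part_powr b (w * u)" by (simp only: f_def mult.assoc)
        also have "(1 + 1 / u) * wt u = P" using wtP[OF u] by (simp add: P_def)
        finally show ?thesis by (simp add: algebra_simps)
      qed
      also have "\<dots> = c powr m * (P * (1 - (\<kappa> - 1) * y) * pos_part_powr b (w * u))"
        unfolding e3[symmetric] by (simp add: algebra_simps)
      also have "\<dots> \<le> c powr m * (P * (1 + y) powr (- (\<kappa> - 1)) * pos_part_powr b (w * (c * u)))"
      proof (rule mult_left_mono)
        have "P * (1 - (\<kappa> - 1) * y) \<le> P * (1 + y) powr (- (\<kappa> - 1))"
          using bern P by (rule mult_left_mono)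
        then have "P * (1 - (\<kappa> - 1) * y) * pos_part_powr b (w * u) \<le> P * (1 + y) powr (- (\<kappa> - 1)) * pos_part_powr b (w * u)"
          by (rule mult_right_mono) simp
        \<comment> \<open>The place where \<open>b \<ge> 0\<close> enters: dilation by
          \<open>c > 1\<close> can only increase the factor, which fixes the direction of the
          inequality.\<close>
        also have "pos_part_powr b (w * u) \<le> pos_part_powr b (w * (c * u))"
          using u w c b_ge by (intro pos_part_powr_mono mult_left_mono) auto
        then have "P * (1 + y) powr (- (\<kappa> - 1)) * pos_part_powr b (w * u) \<le> P * (1 + y) powr (- (\<kappa> - 1)) * pos_part_powr b (w * (c * u))"
          using P by (intro mult_left_mono) auto
        finally show "P * (1 - (\<kappa> - 1) * y) * pos_part_powr b (w * u) \<le> P * (1 + y) powr (- (\<kappa> - 1)) * pos_part_powr b (w * (c * u))" .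
      qed simp
      also have "\<dots> = c * (c powr (m - 1) * (P * (1 + y) powr (- (\<kappa> - 1)))) * pos_part_powr b (w * (c * u))"
        using c powr_mult_base[of c "m - 1"] by simp
      also have "\<dots> = c * f (c * u)" unfolding e2[symmetric] f_def by simp
      finally show ?thesis .
    qed
    have "c powr m * (J0 + J1 - (\<kappa> - 1) * (c - 1) * J0)
       = (\<integral>u. c powr m * (f u - (\<kappa> - 1) * (c - 1) * (wt u * pos_part_powr b (w * u))) \<partial>lborel)"
      unfolding f_eq[symmetric] using f_int integrable_wt[OF w] by (simp add: J0_def)
    also have "\<dots> \<le> (\<integral>u. c * f (c * u) \<partial>lborel)"
    proof (rule integral_mono)
      show "integrable lborel (\<lambda>u. c * f (c * u))"
        using lborel_integrable_real_affine[OF f_int, of c 0] c by simp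
    qed (use pw f_int integrable_wt[OF w] in auto)
    also have "\<dots> = (\<integral>u. f u \<partial>lborel)"
      using lborel_integral_real_affine[of c f 0] c by simp
    finally show ?thesis unfolding f_eq .
  qed
  have "((\<lambda>c. c powr m * (J0 + J1 - (\<kappa> - 1) * (c - 1) * J0)) has_real_derivative m * (J0 + J1) - (\<kappa> - 1) * J0) (at 1)"
    by (auto intro!: derivative_eq_intros)
  then have "m * (J0 + J1) - (\<kappa> - 1) * J0 \<le> 0"
    by (rule deriv_nonpos_of_max_right) (use main in simp)
  then have "m * J1 \<le> (\<kappa> - 1 - m) * J0" by (simp add: algebra_simps)
  then have "J1 / J0 \<le> (\<kappa> - 1 - m) / m" using J0 m(1) by (simp add: field_simps)
  also have "\<kappa> - 1 - m = p / 2 + a + 1" by (simp add: m(2) B_def)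
  finally show ?thesis unfolding mixmean_eq_ratio[OF w] J0_def J1_def m_def .
qed

end

section \<open>Minimaxity\<close>

lemma integral_lborel_scaleR:
  fixes f :: "'a :: euclidean_space \<Rightarrow> real"
  assumes c: "c > 0" and [measurable]: "f \<in> borel_measurable borel"
  shows "(\<integral>x. f (c *\<^sub>R x) \<partial>lborel) = (\<integral>x. f x \<partial>lborel) / c ^ DIM('a)"
proof -
  have "(\<integral>x. f x \<partial>lborel) = (\<integral>x. f x \<partial>density (distr lborel borel (\<lambda>x. 0 + c *\<^sub>R x)) (\<lambda>_. ennreal (\<bar>c\<bar> ^ DIM('a))))"
    using lborel_affine[of c "0 :: 'a"] c by simp
  also have "\<dots> = \<bar>c\<bar> ^ DIM('a) * (\<integral>x. f (c *\<^sub>R x) \<partial>lborel)"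
    by (subst integral_density) (auto simp: integral_distr)
  finally show ?thesis using c by simp
qed

lemma
  assumes \<eta>: "\<eta> > 0" and n: "n > 0"
  shows nn_integral_chisq_dens: "(\<integral>\<^sup>+s. ennreal (chisq_dens n \<eta> s) \<partial>pos_lborel) = 1"
    and nn_integral_chisq_dens_id: "(\<integral>\<^sup>+s. ennreal (chisq_dens n \<eta> s * s) \<partial>pos_lborel) = ennreal (real n / \<eta>)"
proof -
  define K where "K = \<eta> powr (real n / 2) / (Gamma (real n / 2) * 2 powr (real n / 2))"
  have G: "Gamma (real n / 2) > 0" using n by (simp add: Gamma_real_pos)
  have K: "K > 0" using \<eta> G by (simp add: K_def)
  have e: "chisq_dens n \<eta> s = K * (s powr (real n / 2 - 1) * exp (- (\<eta> / 2 * s)))" for s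
    by (simp add: chisq_dens_def K_def)
  have "(\<integral>\<^sup>+s. ennreal (chisq_dens n \<eta> s) \<partial>pos_lborel) = ennreal K * ennreal (Gamma (real n / 2) / (\<eta> / 2) powr (real n / 2))"
    unfolding e using K n \<eta> nn_integral_gamma[of "real n / 2" "\<eta> / 2"]
    by (subst ennreal_mult) (auto simp: nn_integral_cmult intro!: borel_measurable_pos_lborelI)
  also have "\<dots> = ennreal (K * (Gamma (real n / 2) / (\<eta> / 2) powr (real n / 2)))"
    using K G by (intro ennreal_mult[symmetric]) auto
  also have "K * (Gamma (real n / 2) / (\<eta> / 2) powr (real n / 2)) = 1"
    using \<eta> G by (simp add: K_def powr_divide)
  finally show "(\<integral>\<^sup>+s. ennreal (chisq_dens n \<eta> s) \<partial>pos_lborel) = 1" by simp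
  have "(\<integral>\<^sup>+s. ennreal (chisq_dens n \<eta> s * s) \<partial>pos_lborel) = (\<integral>\<^sup>+s. ennreal K * ennreal (s powr ((real n / 2 + 1) - 1) * exp (- (\<eta> / 2 * s))) \<partial>pos_lborel)"
  proof (intro nn_integral_cong)
    fix s assume "s \<in> space pos_lborel"
    then have "s > 0" by simp
    then have p: "s powr ((real n / 2 + 1) - 1) = s powr (real n / 2 - 1) * s"
      using powr_mult_base[of s "real n / 2 - 1"] by (simp add: mult.commute)
    show "ennreal (chisq_dens n \<eta> s * s) = ennreal K * ennreal (s powr ((real n / 2 + 1) - 1) * exp (- (\<eta> / 2 * s)))"
      unfolding e p using K \<open>s > 0\<close> by (subst ennreal_mult[symmetric]) (auto simp: mult_ac)
  qed
  also have "\<dots> = ennreal K * ennreal (Gamma (real n / 2 + 1) / (\<eta> / 2) powr (real n / 2 + 1))"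
    using n \<eta> nn_integral_gamma[of "real n / 2 + 1" "\<eta> / 2"]
    by (subst nn_integral_cmult) (auto intro!: borel_measurable_pos_lborelI)
  also have "\<dots> = ennreal (K * (Gamma (real n / 2 + 1) / (\<eta> / 2) powr (real n / 2 + 1)))"
    using K n by (intro ennreal_mult[symmetric] divide_nonneg_nonneg) (auto simp: Gamma_real_nonneg)
  also have "Gamma (real n / 2 + 1) = real n / 2 * Gamma (real n / 2)"
    using n by (intro Gamma_plus1) (auto simp: nonpos_Ints_def)
  also have "K * (real n / 2 * Gamma (real n / 2) / (\<eta> / 2) powr (real n / 2 + 1)) = real n / \<eta>"
    using \<eta> G by (simp add: K_def powr_divide powr_add)
  finally show "(\<integral>\<^sup>+s. ennreal (chisq_dens n \<eta> s * s) \<partial>pos_lborel) = ennreal (real n / \<eta>)" .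
qed

lemma integrable_chisq_dens:
  "\<eta> > 0 \<Longrightarrow> n > 0 \<Longrightarrow> integrable pos_lborel (chisq_dens n \<eta>)"
  by (rule integrableI_nonneg) (auto simp: nn_integral_chisq_dens)

lemma integral_chisq_dens:
  "\<eta> > 0 \<Longrightarrow> n > 0 \<Longrightarrow> (\<integral>s. chisq_dens n \<eta> s \<partial>pos_lborel) = 1"
  by (subst integral_eq_nn_integral) (auto simp: nn_integral_chisq_dens)

lemma integrable_chisq_dens_id:
  "\<eta> > 0 \<Longrightarrow> n > 0 \<Longrightarrow> integrable pos_lborel (\<lambda>s. chisq_dens n \<eta> s * s)"
  by (rule integrableI_nonneg) (auto simp: nn_integral_chisq_dens_id intro!: AE_I2)

text \<open>Stein's identity as an inequality: differentiability of \<open>q\<close> is replaced by the scaling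
  hypothesis, which controls the derivative of \<open>c \<mapsto> \<integral> normal_dens \<theta> \<eta> (c x) q x dx\<close> at \<open>c = 1\<close>.\<close>

lemma stein_inequality:
  fixes \<theta> :: "real ^ 'p" and q :: "real ^ 'p \<Rightarrow> real"
  assumes \<eta>: "\<eta> > 0" and q [measurable]: "q \<in> borel_measurable borel"
    and q0: "\<And>x. 0 \<le> q x" and qC: "\<And>x. q x \<le> C"
    and scale: "\<And>c x. c > 1 \<Longrightarrow> q ((1 / c) *\<^sub>R x) \<le> c\<^sup>2 * q x"
  shows "- \<eta> * (\<integral>x. normal_dens \<theta> \<eta> x * (q x * (x \<bullet> (x - \<theta>))) \<partial>lborel)
     \<le> (2 - real CARD('p)) * (\<integral>x. normal_dens \<theta> \<eta> x * q x \<partial>lborel)"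
proof -
  let ?f = "normal_dens \<theta> \<eta>"
  define D where "D = (\<integral>x. ?f x * (q x * (x \<bullet> (x - \<theta>))) \<partial>lborel)"
  define E where "E = (\<integral>x. ?f x * q x \<partial>lborel)"
  define F where "F = (\<integral>x. ?f x * (q x * (norm x)\<^sup>2) \<partial>lborel)"
  have C0: "C \<ge> 0" using q0[of 0] qC[of 0] by linarith
  note n1 = norm_sq_le_shift[of _ \<theta>]
  have n2: "\<bar>x \<bullet> (x - \<theta>)\<bar> \<le> (norm \<theta>)\<^sup>2 + 2 * (norm (x - \<theta>))\<^sup>2" for x
  proof -
    have "\<bar>x \<bullet> (x - \<theta>)\<bar> \<le> norm x * norm (x - \<theta>)" by (rule Cauchy_Schwarz_ineq2)
    also have "\<dots> \<le> ((norm x)\<^sup>2 + (norm (x - \<theta>))\<^sup>2) / 2"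
      using zero_le_power2[of "norm x - norm (x - \<theta>)"] by (simp add: power2_eq_square algebra_simps)
    also have "\<dots> \<le> (norm \<theta>)\<^sup>2 + 2 * (norm (x - \<theta>))\<^sup>2" 
    proof -
      have "(X + D) / 2 \<le> T + 2 * D" if "X \<le> 2 * T + 2 * D" "0 \<le> D" for X T D :: real using that by simp
      then show ?thesis using n1[of x] zero_le_power2[of "norm (x - \<theta>)"] by blast
    qed
    finally show ?thesis .
  qed
  have iE: "integrable lborel (\<lambda>x. ?f x * q x)"
    using integrable_normal_dens_scaleR[OF \<eta> q, of C 0 \<theta>] q0 qC by simp
  have iD: "integrable lborel (\<lambda>x. ?f x * (q x * (x \<bullet> (x - \<theta>))))"
  proof -
    have "norm (q x * (x \<bullet> (x - \<theta>))) \<le> C * (norm \<theta>)\<^sup>2 + (C * 2) * (norm (x - \<theta>))\<^sup>2" for x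
      using mult_mono[OF qC[of x] n2[of x]] C0 q0[of x] by (simp add: abs_mult distrib_left mult.assoc)
    then show ?thesis using integrable_normal_dens_scaleR[OF \<eta>, of "\<lambda>x. q x * (x \<bullet> (x - \<theta>))" "C * (norm \<theta>)\<^sup>2" "C * 2" \<theta>] by simp
  qed
  have iF: "integrable lborel (\<lambda>x. ?f x * (q x * (norm x)\<^sup>2))"
  proof -
    have "norm (q x * (norm x)\<^sup>2) \<le> C * (2 * (norm \<theta>)\<^sup>2) + (C * 2) * (norm (x - \<theta>))\<^sup>2" for x
      using mult_mono[OF qC[of x] n1[of x]] C0 q0[of x] by (simp add: abs_mult distrib_left mult.assoc)
    then show ?thesis using integrable_normal_dens_scaleR[OF \<eta>, of "\<lambda>x. q x * (norm x)\<^sup>2" "C * (2 * (norm \<theta>)\<^sup>2)" "C * 2" \<theta>] by simp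
  qed
  \<comment> \<open>Expanding the density at \<open>c *\<^sub>R x\<close> by
    \<open>exp v \<ge> 1 + v\<close> gives the terms with \<open>D\<close> and \<open>F\<close>.
    Substituting back gives the Jacobian \<open>c\<close> to the power \<open>- p\<close>, with
    \<open>p\<close> the dimension, and the hypothesis on \<open>q\<close> gives
    \<open>c\<^sup>2\<close>, whence the exponent \<open>2 - p\<close>. The term with
    \<open>F\<close> is of second order and drops out of the derivative at
    \<open>c = 1\<close>.\<close>
  have main: "E - \<eta> * (c - 1) * D - \<eta> / 2 * (c - 1)\<^sup>2 * F - c powr (2 - real CARD('p)) * E \<le> 0" if c: "c > 1" for c
  proof -
    have pw: "?f x * q x - \<eta> * (c - 1) * (?f x * (q x * (x \<bullet> (x - \<theta>)))) - \<eta> / 2 * (c - 1)\<^sup>2 * (?f x * (q x * (norm x)\<^sup>2))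
       \<le> ?f (c *\<^sub>R x) * q x" for x
    proof -
      define v where "v = - \<eta> * (c - 1) * (x \<bullet> (x - \<theta>)) - \<eta> / 2 * (c - 1)\<^sup>2 * (norm x)\<^sup>2"
      have "(norm (c *\<^sub>R x - \<theta>))\<^sup>2 = (norm ((x - \<theta>) + (c - 1) *\<^sub>R x))\<^sup>2" by (simp add: algebra_simps)
      also have "\<dots> = (norm (x - \<theta>))\<^sup>2 + 2 * ((c - 1) * (x \<bullet> (x - \<theta>))) + (c - 1)\<^sup>2 * (norm x)\<^sup>2"
        unfolding power2_norm_eq_inner
        by (simp only: inner_add_left inner_add_right inner_scaleR_left inner_scaleR_right inner_commute[of "x - \<theta>" x] power2_eq_square) (simp only: distrib_left mult_2 mult.assoc add_ac)
      finally have "- \<eta> * (norm (c *\<^sub>R x - \<theta>))\<^sup>2 / 2 = - \<eta> * (norm (x - \<theta>))\<^sup>2 / 2 + v"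
      proof -
        have "- \<eta> * (M + 2 * (t * X) + t\<^sup>2 * R) / 2 = - \<eta> * M / 2 + (- \<eta> * t * X - \<eta> / 2 * t\<^sup>2 * R)" for M X R t :: real
          by (simp add: algebra_simps add_divide_distrib diff_divide_distrib)
        then show "(norm (c *\<^sub>R x - \<theta>))\<^sup>2 = (norm (x - \<theta>))\<^sup>2 + 2 * ((c - 1) * (x \<bullet> (x - \<theta>))) + (c - 1)\<^sup>2 * (norm x)\<^sup>2
            \<Longrightarrow> - \<eta> * (norm (c *\<^sub>R x - \<theta>))\<^sup>2 / 2 = - \<eta> * (norm (x - \<theta>))\<^sup>2 / 2 + v"
          unfolding v_def by metis
      qed
      then have "?f (c *\<^sub>R x) = ?f x * exp v"
        unfolding normal_dens_def by (simp only: exp_add mult.assoc)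
      moreover have "1 + v \<le> exp v" by (rule exp_ge_add_one_self)
      then have "?f x * (1 + v) * q x \<le> ?f x * exp v * q x"
        using q0[of x] by (intro mult_right_mono mult_left_mono) auto
      moreover have "?f x * (1 + v) * q x = ?f x * q x - \<eta> * (c - 1) * (?f x * (q x * (x \<bullet> (x - \<theta>)))) - \<eta> / 2 * (c - 1)\<^sup>2 * (?f x * (q x * (norm x)\<^sup>2))"
        unfolding v_def by (simp add: algebra_simps)
      ultimately show ?thesis by simp
    qed
    define h where "h = (\<lambda>y. ?f y * q ((1 / c) *\<^sub>R y))"
    have [measurable]: "h \<in> borel_measurable borel" unfolding h_def by measurable
    have hx: "h (c *\<^sub>R x) = ?f (c *\<^sub>R x) * q x" for x using c by (simp add: h_def)
    have ih: "integrable lborel h"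
      using integrable_normal_dens_scaleR[OF \<eta>, of "\<lambda>y. q ((1 / c) *\<^sub>R y)" C 0 \<theta>] q0 qC by (simp add: h_def)
    have ih': "integrable lborel (\<lambda>x. h (c *\<^sub>R x))"
    proof -
      have "integrable (density (distr lborel borel (\<lambda>x. 0 + c *\<^sub>R x)) (\<lambda>_. ennreal (\<bar>c\<bar> ^ DIM(real ^ 'p)))) h"
        using ih lborel_affine[of c "0 :: real ^ 'p"] c by simp
      then have "integrable lborel (\<lambda>x. \<bar>c\<bar> ^ DIM(real ^ 'p) * h (c *\<^sub>R x))"
        by (subst (asm) integrable_density) (auto simp: integrable_distr_eq)
      then show ?thesis using c by (simp add: integrable_mult_right_iff)
    qed
    have "E - \<eta> * (c - 1) * D - \<eta> / 2 * (c - 1)\<^sup>2 * F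
      = (\<integral>x. ?f x * q x - \<eta> * (c - 1) * (?f x * (q x * (x \<bullet> (x - \<theta>)))) - \<eta> / 2 * (c - 1)\<^sup>2 * (?f x * (q x * (norm x)\<^sup>2)) \<partial>lborel)"
      unfolding E_def D_def F_def
      by (subst Bochner_Integration.integral_diff; (intro Bochner_Integration.integrable_diff integrable_mult_right iE iD iF)?)
         (subst Bochner_Integration.integral_diff; (intro Bochner_Integration.integrable_diff integrable_mult_right iE iD iF)?; simp)
    also have "\<dots> \<le> (\<integral>x. h (c *\<^sub>R x) \<partial>lborel)"
      using pw ih' unfolding hx by (intro integral_mono Bochner_Integration.integrable_diff integrable_mult_right iE iD iF) auto
    also have "\<dots> = (\<integral>x. h x \<partial>lborel) / c ^ CARD('p)"
      using integral_lborel_scaleR[of c h] c by simp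
    also have "(\<integral>x. h x \<partial>lborel) \<le> (\<integral>x. c\<^sup>2 * (?f x * q x) \<partial>lborel)"
    proof (rule integral_mono[OF ih])
      fix x show "h x \<le> c\<^sup>2 * (?f x * q x)"
        using mult_left_mono[OF scale[OF c, of x], of "?f x"] by (simp add: h_def algebra_simps)
    qed (use iE in simp)
    then have "(\<integral>x. h x \<partial>lborel) / c ^ CARD('p) \<le> c\<^sup>2 * E / c ^ CARD('p)"
      using c by (intro divide_right_mono) (auto simp: E_def)
    also have "c\<^sup>2 * E / c ^ CARD('p) = c powr (2 - real CARD('p)) * E"
      using c by (simp add: powr_diff powr_realpow)
    finally show ?thesis by simp
  qed
  have "((\<lambda>c. E - \<eta> * (c - 1) * D - \<eta> / 2 * (c - 1)\<^sup>2 * F - c powr (2 - real CARD('p)) * E) has_real_derivative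
      (- \<eta> * D - (2 - real CARD('p)) * E)) (at 1)"
    by (auto intro!: derivative_eq_intros)
  then have "- \<eta> * D - (2 - real CARD('p)) * E \<le> 0"
    by (rule deriv_nonpos_of_max_right) (use main in simp)
  then show ?thesis unfolding D_def E_def by simp
qed

text \<open>The companion of the normal inequality for the scale variable. The hypothesis says that
  \<open>r s / s\<close> is nonincreasing; allowing growth of \<open>r\<close> up to linear order is
  what turns the mean \<open>n / \<eta>\<close> of the chi-square law into the factor
  \<open>n + 2\<close>.\<close>

lemma chisq_inequality:
  assumes \<eta>: "\<eta> > 0" and n: "n > 0" and r [measurable]: "r \<in> borel_measurable borel"
    and r0: "\<And>s. s > 0 \<Longrightarrow> 0 \<le> r s" and rC: "\<And>s. s > 0 \<Longrightarrow> r s \<le> C"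
    and scale: "\<And>c s. 0 < c \<Longrightarrow> c < 1 \<Longrightarrow> s > 0 \<Longrightarrow> r (s / c) \<le> r s / c"
  shows "\<eta> * (\<integral>s. chisq_dens n \<eta> s * (s * r s) \<partial>pos_lborel)
     \<le> (real n + 2) * (\<integral>s. chisq_dens n \<eta> s * r s \<partial>pos_lborel)"
proof -
  let ?f = "chisq_dens n \<eta>"
  note [measurable] = borel_measurable_pos_lborelI[OF r]
  define A where "A = (\<integral>s. ?f s * (s * r s) \<partial>pos_lborel)"
  define E where "E = (\<integral>s. ?f s * r s \<partial>pos_lborel)"
  have C0: "C \<ge> 0" using r0[of 1] rC[of 1] by simp
  have bnd: "norm (?f t * r s) \<le> norm (C * ?f t)" if "s > 0" for s t
    using mult_left_mono[OF rC[OF that], of "?f t"] r0[OF that] C0 by (simp add: abs_mult mult.commute)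
  have bnd': "norm (?f s * (s * r s)) \<le> norm (C * (?f s * s))" if "s > 0" for s
    using mult_right_mono[OF bnd[OF that, of s], of s] that C0 by (simp add: abs_mult mult_ac)
  have iE: "integrable pos_lborel (\<lambda>s. ?f s * r s)"
    by (rule Bochner_Integration.integrable_bound[OF integrable_mult_right[OF integrable_chisq_dens[OF \<eta> n], of C]])
       (use bnd in \<open>auto intro!: AE_I2\<close>)
  have iA: "integrable pos_lborel (\<lambda>s. ?f s * (s * r s))"
    by (rule Bochner_Integration.integrable_bound[OF integrable_mult_right[OF integrable_chisq_dens_id[OF \<eta> n], of C]])
       (use bnd' in \<open>auto intro!: AE_I2\<close>)
  \<comment> \<open>Three powers of \<open>c\<close> are collected: \<open>n / 2 - 1\<close> from
    the density, one from the Jacobian of \<open>s \<mapsto> c * s\<close> and one from the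
    hypothesis on \<open>r\<close>. Equality holds at \<open>c = 1\<close>, which is approached from
    the left.\<close>
  have main: "c powr (real n / 2 + 1) * (E + \<eta> * (1 - c) / 2 * A) \<le> E" if c: "0 < c" "c < 1" for c
  proof -
    define h where "h = (\<lambda>s. indicator {0<..} s * (?f s * r (s / c)))"
    have h: "integrable lborel h"
    proof -
      have "integrable pos_lborel (\<lambda>s. ?f s * r (s / c))"
        by (rule Bochner_Integration.integrable_bound[OF integrable_mult_right[OF integrable_chisq_dens[OF \<eta> n], of C]])
           (use bnd[of "_ / c"] c in \<open>auto intro!: AE_I2 borel_measurable_pos_lborelI\<close>)
      then show ?thesis unfolding pos_lborel_def h_def by (subst (asm) integrable_restrict_space) auto
    qed
    have hc: "h (0 + c * s) = indicator {0<..} s * (?f (c * s) * r s)" for s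
      using c by (auto simp: h_def indicator_def zero_less_mult_iff)
    \<comment> \<open>For \<open>c < 1\<close> the dilated density gains the factor
      \<open>exp (\<eta> * (1 - c) / 2 * s)\<close>; bounding it below by its linear part produces
      the term with \<open>A\<close>.\<close>
    have fc: "?f (c * s) \<ge> c powr (real n / 2 - 1) * (?f s * (1 + \<eta> * (1 - c) / 2 * s))" if "s > 0" for s
    proof -
      have "- \<eta> * (c * s) / 2 = - \<eta> * s / 2 + \<eta> * (1 - c) / 2 * s" by (simp add: algebra_simps)
      moreover have "(c * s) powr (real n / 2 - 1) = c powr (real n / 2 - 1) * s powr (real n / 2 - 1)"
        by (rule powr_mult)
      ultimately have "?f (c * s) = c powr (real n / 2 - 1) * (?f s * exp (\<eta> * (1 - c) / 2 * s))"
        unfolding chisq_dens_def by (simp only: exp_add) simp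
      moreover have "1 + \<eta> * (1 - c) / 2 * s \<le> exp (\<eta> * (1 - c) / 2 * s)" by (rule exp_ge_add_one_self)
      ultimately show ?thesis by (auto intro!: mult_left_mono)
    qed
    have ic: "integrable lborel (\<lambda>s. indicator {0<..} s * (?f (c * s) * r s))"
      using lborel_integrable_real_affine[OF h, of c 0] c unfolding hc by simp
    have ic': "integrable pos_lborel (\<lambda>s. ?f (c * s) * r s)"
      using ic integrable_restrict_space[of "{0<..}" lborel "\<lambda>s. ?f (c * s) * r s"] by (simp add: pos_lborel_def)
    have "c powr (real n / 2 - 1) * (E + \<eta> * (1 - c) / 2 * A)
       = (\<integral>s. c powr (real n / 2 - 1) * (?f s * r s + \<eta> * (1 - c) / 2 * (?f s * (s * r s))) \<partial>pos_lborel)"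
      unfolding E_def A_def using iE iA by simp
    also have "\<dots> \<le> (\<integral>s. ?f (c * s) * r s \<partial>pos_lborel)"
    proof (rule integral_mono_AE)
      show "AE s in pos_lborel. c powr (real n / 2 - 1) * (?f s * r s + \<eta> * (1 - c) / 2 * (?f s * (s * r s))) \<le> ?f (c * s) * r s"
      proof (rule AE_I2)
        fix s assume "s \<in> space pos_lborel"
        then have s: "s > 0" by simp
        from mult_right_mono[OF fc[OF s] r0[OF s]]
        show "c powr (real n / 2 - 1) * (?f s * r s + \<eta> * (1 - c) / 2 * (?f s * (s * r s))) \<le> ?f (c * s) * r s"
          by (simp add: algebra_simps)
      qed
    qed (use iE iA ic' in auto)
    also have "\<dots> = (\<integral>s. h (0 + c * s) \<partial>lborel)"
      unfolding hc pos_lborel_def by (subst integral_restrict_space) auto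
    also have "\<dots> = (\<integral>s. h s \<partial>lborel) / c"
      using lborel_integral_real_affine[of c h 0] c by simp
    also have "(\<integral>s. h s \<partial>lborel) = (\<integral>s. ?f s * r (s / c) \<partial>pos_lborel)"
      unfolding h_def pos_lborel_def by (subst integral_restrict_space) auto
    also have "\<dots> / c \<le> (\<integral>s. (?f s * r s) / c \<partial>pos_lborel) / c"
    proof (intro divide_right_mono integral_mono_AE)
      show "integrable pos_lborel (\<lambda>s. ?f s * r (s / c))"
        using h integrable_restrict_space[of "{0<..}" lborel "\<lambda>s. ?f s * r (s / c)"] by (simp add: pos_lborel_def h_def)
      show "AE s in pos_lborel. ?f s * r (s / c) \<le> ?f s * r s / c"
      proof (rule AE_I2)
        fix s assume "s \<in> space pos_lborel"
        then have s: "s > 0" by simp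
        from mult_left_mono[OF scale[OF c s], of "?f s"]
        show "?f s * r (s / c) \<le> ?f s * r s / c" by simp
      qed
    qed (use iE c in auto)
    also have "\<dots> = E / c\<^sup>2" by (simp add: E_def power2_eq_square)
    finally have "c\<^sup>2 * (c powr (real n / 2 - 1) * (E + \<eta> * (1 - c) / 2 * A)) \<le> c\<^sup>2 * (E / c\<^sup>2)"
      by (rule mult_left_mono) simp
    moreover have "c powr (real n / 2 + 1) = c\<^sup>2 * c powr (real n / 2 - 1)"
      using c powr_add[of c 2 "real n / 2 - 1"] by (simp add: add.commute)
    ultimately show ?thesis using c by (simp add: mult.assoc)
  qed
  have "((\<lambda>c. c powr (real n / 2 + 1) * (E + \<eta> * (1 - c) / 2 * A)) has_real_derivative
      (real n / 2 + 1) * E - \<eta> / 2 * A) (at 1)"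
    by (auto intro!: derivative_eq_intros)
  then have "0 \<le> (real n / 2 + 1) * E - \<eta> / 2 * A"
    by (rule deriv_nonneg_of_max_left[where y=0]) (use main in auto)
  then have "\<eta> * A \<le> (real n + 2) * E" by (simp add: algebra_simps)
  then show ?thesis unfolding A_def E_def .
qed

section \<open>The risk as one Lebesgue integral, and bounds for it\<close>

lemma risk_eq:
  fixes \<delta> :: "(real ^ 'p) \<times> real \<Rightarrow> real ^ 'p"
  assumes "estimator \<delta>" and \<eta>: "\<eta> > 0" and n: "n > 0"
  shows "risk n \<delta> \<theta> \<eta> = (\<integral>\<^sup>+z. ennreal (normal_dens \<theta> \<eta> (fst z) * chisq_dens n \<eta> (snd z) * (\<eta> * (norm (\<delta> z - \<theta>))\<^sup>2)) \<partial>(lborel \<Otimes>\<^sub>M pos_lborel))"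
proof -
  have [measurable]: "\<delta> \<in> borel_measurable (lborel \<Otimes>\<^sub>M pos_lborel)" using assms(1) by (simp add: estimator_def)
  have [measurable]: "chisq_dens n \<eta> \<in> borel_measurable pos_lborel" "normal_dens \<theta> \<eta> \<in> borel_measurable borel" by measurable
  have sf: "sigma_finite_measure (density pos_lborel (\<lambda>s. ennreal (chisq_dens n \<eta> s)))"
  proof (intro finite_measure.axioms(1) finite_measureI)
    have "emeasure (density pos_lborel (\<lambda>s. ennreal (chisq_dens n \<eta> s))) (space pos_lborel)
      = (\<integral>\<^sup>+s. ennreal (chisq_dens n \<eta> s) * indicator (space pos_lborel) s \<partial>pos_lborel)"
      by (rule emeasure_density[OF _ sets.top]) measurable
    also have "\<dots> = (\<integral>\<^sup>+s. ennreal (chisq_dens n \<eta> s) \<partial>pos_lborel)"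
      by (intro nn_integral_cong) auto
    finally show "emeasure (density pos_lborel (\<lambda>s. ennreal (chisq_dens n \<eta> s))) (space (density pos_lborel (\<lambda>s. ennreal (chisq_dens n \<eta> s)))) \<noteq> \<infinity>"
      using nn_integral_chisq_dens[OF \<eta> n] by simp
  qed
  have "sampling_law n \<theta> \<eta> = density (lborel \<Otimes>\<^sub>M pos_lborel) (\<lambda>(x, s). ennreal (normal_dens \<theta> \<eta> x) * ennreal (chisq_dens n \<eta> s))"
    unfolding sampling_law_def
    by (rule pair_measure_density) (use sf pos_lborel.sigma_finite_measure_axioms in auto)
  then have "risk n \<delta> \<theta> \<eta> = (\<integral>\<^sup>+z. (case z of (x, s) \<Rightarrow> ennreal (normal_dens \<theta> \<eta> x) * ennreal (chisq_dens n \<eta> s)) * ennreal (\<eta> * (norm (\<delta> z - \<theta>))\<^sup>2) \<partial>(lborel \<Otimes>\<^sub>M pos_lborel))"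
    unfolding risk_def by (subst nn_integral_density[symmetric]) auto
  also have "\<dots> = (\<integral>\<^sup>+z. ennreal (normal_dens \<theta> \<eta> (fst z) * chisq_dens n \<eta> (snd z) * (\<eta> * (norm (\<delta> z - \<theta>))\<^sup>2)) \<partial>(lborel \<Otimes>\<^sub>M pos_lborel))"
    using \<eta> by (intro nn_integral_cong) (simp add: case_prod_beta' ennreal_mult)
  finally show ?thesis .
qed

lemma integrable_product_dens:
  fixes \<theta> :: "real ^ 'p" and f :: "(real ^ 'p) \<times> real \<Rightarrow> real"
  assumes \<eta>: "\<eta> > 0" and n: "n > 0" and [measurable]: "f \<in> borel_measurable (lborel \<Otimes>\<^sub>M pos_lborel)"
    and bnd: "\<And>x s. s > 0 \<Longrightarrow> \<bar>f (x, s)\<bar> \<le> A + B * (norm (x - \<theta>))\<^sup>2" and AB: "A \<ge> 0" "B \<ge> 0"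
  shows "integrable (lborel \<Otimes>\<^sub>M pos_lborel) (\<lambda>(x, s). normal_dens \<theta> \<eta> x * chisq_dens n \<eta> s * f (x, s))"
proof (rule integrableI_bounded)
  show m: "(\<lambda>(x, s). normal_dens \<theta> \<eta> x * chisq_dens n \<eta> s * f (x, s)) \<in> borel_measurable (lborel \<Otimes>\<^sub>M pos_lborel)"
    unfolding case_prod_beta' by measurable
  have "(\<integral>\<^sup>+z. ennreal (norm (case z of (x, s) \<Rightarrow> normal_dens \<theta> \<eta> x * chisq_dens n \<eta> s * f (x, s))) \<partial>(lborel \<Otimes>\<^sub>M pos_lborel))
    = (\<integral>\<^sup>+x. \<integral>\<^sup>+s. ennreal (norm (normal_dens \<theta> \<eta> x * chisq_dens n \<eta> s * f (x, s))) \<partial>pos_lborel \<partial>lborel)"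
    using m by (subst pos_lborel.nn_integral_fst[symmetric]) auto
  also have "\<dots> \<le> (\<integral>\<^sup>+x. \<integral>\<^sup>+s. ennreal (normal_dens \<theta> \<eta> x * (A + B * (norm (x - \<theta>))\<^sup>2)) * ennreal (chisq_dens n \<eta> s) \<partial>pos_lborel \<partial>lborel)"
  proof (intro nn_integral_mono)
    fix x :: "real ^ 'p" and s assume "s \<in> space pos_lborel"
    then have s: "s > 0" by simp
    have "norm (normal_dens \<theta> \<eta> x * chisq_dens n \<eta> s * f (x, s)) \<le> normal_dens \<theta> \<eta> x * chisq_dens n \<eta> s * (A + B * (norm (x - \<theta>))\<^sup>2)"
      using bnd[OF s, of x] by (simp add: abs_mult mult_left_mono)
    also have "\<dots> = normal_dens \<theta> \<eta> x * (A + B * (norm (x - \<theta>))\<^sup>2) * chisq_dens n \<eta> s" by simp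
    finally show "ennreal (norm (normal_dens \<theta> \<eta> x * chisq_dens n \<eta> s * f (x, s)))
      \<le> ennreal (normal_dens \<theta> \<eta> x * (A + B * (norm (x - \<theta>))\<^sup>2)) * ennreal (chisq_dens n \<eta> s)"
      using AB by (subst ennreal_mult[symmetric]) (auto intro: ennreal_leI)
  qed
  also have "\<dots> = (\<integral>\<^sup>+x. ennreal (normal_dens \<theta> \<eta> x * (A + B * (norm (x - \<theta>))\<^sup>2)) \<partial>lborel)"
    by (subst nn_integral_cmult) (auto simp: nn_integral_chisq_dens[OF \<eta> n])
  also have "\<dots> < \<infinity>"
  proof -
    have "integrable lborel (\<lambda>x. normal_dens \<theta> \<eta> x *\<^sub>R (A + B * (norm (x - \<theta>))\<^sup>2))"
      using AB by (intro integrable_normal_dens_scaleR[OF \<eta>, of _ A B]) auto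
    then show ?thesis using AB by (subst nn_integral_eq_integral) auto
  qed
  finally show "(\<integral>\<^sup>+z. ennreal (norm (case z of (x, s) \<Rightarrow> normal_dens \<theta> \<eta> x * chisq_dens n \<eta> s * f (x, s))) \<partial>(lborel \<Otimes>\<^sub>M pos_lborel)) < \<infinity>" .
qed

text \<open>In the expanded square the term \<open>- 2 * \<eta> * E g1\<close> is at most
  \<open>2 * (2 - p) * E g3\<close> by the normal inequality, and \<open>\<eta> * E g2\<close> is at
  most \<open>(n + 2) * K * E g3\<close> by the chi-square inequality and
  \<open>w * Q w \<le> K\<close>. The value of \<open>K\<close> makes these two bounds cancel, and
  only \<open>\<eta> * E g0 = p\<close> remains.\<close>

theorem baranchik_risk_le:
  fixes \<delta> :: "(real ^ 'p) \<times> real \<Rightarrow> real ^ 'p" and Q :: "real \<Rightarrow> real"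
  assumes n: "n > 0" and p: "CARD('p) \<ge> 2" and \<eta>: "\<eta> > 0"
    and est: "estimator \<delta>" and \<delta>: "\<And>x s. s > 0 \<Longrightarrow> \<delta> (x, s) = (1 - Q ((norm x)\<^sup>2 / s)) *\<^sub>R x"
    and Q [measurable]: "Q \<in> borel_measurable borel" and Q0: "\<And>w. w \<ge> 0 \<Longrightarrow> 0 \<le> Q w" and Q1: "\<And>w. w \<ge> 0 \<Longrightarrow> Q w \<le> 1"
    and mono: "\<And>v w. 0 \<le> v \<Longrightarrow> v \<le> w \<Longrightarrow> v * Q v \<le> w * Q w"
    and le: "\<And>w. w \<ge> 0 \<Longrightarrow> w * Q w \<le> 2 * (real CARD('p) - 2) / (real n + 2)"
  shows "risk n \<delta> \<theta> \<eta> \<le> ennreal (real CARD('p))"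
proof -
  let ?M = "lborel \<Otimes>\<^sub>M pos_lborel :: ((real ^ 'p) \<times> real) measure"
  define f where "f = normal_dens \<theta> \<eta>"
  define h where "h = chisq_dens n \<eta>"
  define q where "q = (\<lambda>(x :: real ^ 'p) s. Q ((norm x)\<^sup>2 / s))"
  define p where "p = real CARD('p)"
  define K where "K = 2 * (p - 2) / (real n + 2)"
  have p2: "p \<ge> 2" using assms(2) by (simp add: p_def)
  have K0: "K \<ge> 0" using p2 by (simp add: K_def)
  have q0: "0 \<le> q x s" and q1: "q x s \<le> 1" if "s > 0" for x s using that Q0 Q1 by (auto simp: q_def)
  have wq: "(norm x)\<^sup>2 / s * q x s \<le> K" if "s > 0" for x s
    using le[of "(norm x)\<^sup>2 / s"] that by (simp add: q_def K_def p_def)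
  note n1 = norm_sq_le_shift[of _ \<theta>]
  have n2: "\<bar>x \<bullet> (x - \<theta>)\<bar> \<le> 2 * (norm \<theta>)\<^sup>2 + 3 * (norm (x - \<theta>))\<^sup>2" for x
  proof -
    have "\<bar>x \<bullet> (x - \<theta>)\<bar> \<le> norm x * norm (x - \<theta>)" by (rule Cauchy_Schwarz_ineq2)
    also have "\<dots> \<le> (norm x)\<^sup>2 + (norm (x - \<theta>))\<^sup>2"
    proof -
      have "\<alpha> * \<beta> \<le> \<alpha>\<^sup>2 + \<beta>\<^sup>2" if "\<alpha> \<ge> 0" "\<beta> \<ge> 0" for \<alpha> \<beta> :: real
        using zero_le_power2[of "\<alpha> - \<beta>"] mult_nonneg_nonneg[OF that] unfolding power2_diff by linarith
      then show ?thesis by simp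
    qed
    also have "\<dots> \<le> 2 * (norm \<theta>)\<^sup>2 + 3 * (norm (x - \<theta>))\<^sup>2" using n1[of x] by simp
    finally show ?thesis .
  qed
  have [measurable]: "(\<lambda>z. q (fst z) (snd z)) \<in> borel_measurable ?M" unfolding q_def by measurable
  have int: "integrable ?M (\<lambda>(x, s). f x * h s * g (x, s))"
    if "g \<in> borel_measurable ?M" "\<And>x s. s > 0 \<Longrightarrow> \<bar>g (x, s)\<bar> \<le> A + B * (norm (x - \<theta>))\<^sup>2" "A \<ge> 0" "B \<ge> 0" for g A B
    using integrable_product_dens[OF \<eta> n that] unfolding f_def h_def .
  let ?F = "\<lambda>g z. case z of (x, s) \<Rightarrow> f x * h s * g (x, s)"
  define E where "E = (\<lambda>g. \<integral>z. (case z of (x, s) \<Rightarrow> f x * h s * g (x, s)) \<partial>?M)"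
  define g0 g1 g2 g3 g4 where "g0 = (\<lambda>z :: (real ^ 'p) \<times> real. (norm (fst z - \<theta>))\<^sup>2)"
    and "g1 = (\<lambda>z :: (real ^ 'p) \<times> real. q (fst z) (snd z) * (fst z \<bullet> (fst z - \<theta>)))"
    and "g2 = (\<lambda>z :: (real ^ 'p) \<times> real. (q (fst z) (snd z))\<^sup>2 * (norm (fst z))\<^sup>2)"
    and "g3 = (\<lambda>z :: (real ^ 'p) \<times> real. q (fst z) (snd z))"
    and "g4 = (\<lambda>z :: (real ^ 'p) \<times> real. (norm (fst z))\<^sup>2 / snd z * (q (fst z) (snd z))\<^sup>2)"
  have [measurable]: "g0 \<in> borel_measurable ?M" "g1 \<in> borel_measurable ?M" "g2 \<in> borel_measurable ?M" "g3 \<in> borel_measurable ?M" "g4 \<in> borel_measurable ?M"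
    unfolding g0_def g1_def g2_def g3_def g4_def by measurable
  have i0: "integrable ?M (\<lambda>(x, s). f x * h s * g0 (x, s))"
    by (rule int[of _ 0 1]) (auto simp: g0_def)
  have i1: "integrable ?M (\<lambda>(x, s). f x * h s * g1 (x, s))"
  proof (rule int[of _ "2 * (norm \<theta>)\<^sup>2" 3])
    fix x s assume s: "(s :: real) > 0"
    have "\<bar>g1 (x, s)\<bar> = q x s * \<bar>x \<bullet> (x - \<theta>)\<bar>" using q0[OF s] by (simp add: g1_def abs_mult)
    also have "\<dots> \<le> 1 * \<bar>x \<bullet> (x - \<theta>)\<bar>" using q1[OF s] by (intro mult_right_mono) auto
    finally show "\<bar>g1 (x, s)\<bar> \<le> 2 * (norm \<theta>)\<^sup>2 + 3 * (norm (x - \<theta>))\<^sup>2" using n2[of x] by linarith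
  qed auto
  have i2: "integrable ?M (\<lambda>(x, s). f x * h s * g2 (x, s))"
  proof (rule int[of _ "2 * (norm \<theta>)\<^sup>2" 2])
    fix x s assume s: "(s :: real) > 0"
    have "(q x s)\<^sup>2 \<le> 1" using q0[OF s] q1[OF s] by (simp add: power_le_one)
    then have "(q x s)\<^sup>2 * (norm x)\<^sup>2 \<le> 1 * (norm x)\<^sup>2" by (intro mult_right_mono) auto
    then show "\<bar>g2 (x, s)\<bar> \<le> 2 * (norm \<theta>)\<^sup>2 + 2 * (norm (x - \<theta>))\<^sup>2" using n1[of x] by (simp add: g2_def)
  qed auto
  have i3: "integrable ?M (\<lambda>(x, s). f x * h s * g3 (x, s))"
    by (rule int[of _ 1 0]) (auto simp: g3_def q0 q1)
  have wqq: "(norm x)\<^sup>2 / s * (q x s)\<^sup>2 \<le> K * q x s" if s: "s > 0" for x s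
    using mult_right_mono[OF wq[OF s, of x] q0[OF s, of x]] by (simp add: power2_eq_square)
  have wqq': "(norm x)\<^sup>2 / s * (q x s)\<^sup>2 \<le> K" if s: "s > 0" for x s
    using wqq[OF s, of x] mult_left_mono[OF q1[OF s, of x] K0] by simp
  have i4: "integrable ?M (\<lambda>(x, s). f x * h s * g4 (x, s))"
    using wqq' K0 by (intro int[of _ K 0]) (auto simp: g4_def)
  have E0: "E g0 = p / \<eta>"
  proof -
    have "E g0 = (\<integral>x. \<integral>s. f x * h s * g0 (x, s) \<partial>pos_lborel \<partial>lborel)"
      unfolding E_def by (rule sample.integral_fst[symmetric, OF i0])
    also have "\<dots> = (\<integral>x. f x * (norm (x - \<theta>))\<^sup>2 \<partial>lborel)"
    proof (intro Bochner_Integration.integral_cong refl)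
      fix x
      have "(\<integral>s. f x * h s * g0 (x, s) \<partial>pos_lborel) = (\<integral>s. (f x * (norm (x - \<theta>))\<^sup>2) * h s \<partial>pos_lborel)"
        by (simp add: g0_def mult_ac)
      also have "\<dots> = f x * (norm (x - \<theta>))\<^sup>2"
        unfolding h_def by (simp add: integral_chisq_dens[OF \<eta> n])
      finally show "(\<integral>s. f x * h s * g0 (x, s) \<partial>pos_lborel) = f x * (norm (x - \<theta>))\<^sup>2" .
    qed
    also have "\<dots> = p / \<eta>"
      using \<eta> unfolding f_def p_def by (subst integral_eq_nn_integral) (auto simp: nn_integral_normal_dens_norm)
    finally show ?thesis .
  qed
  have E1: "- \<eta> * E g1 \<le> (2 - p) * E g3"
  proof -
    have "- \<eta> * E g1 = - \<eta> * (\<integral>s. \<integral>x. f x * h s * g1 (x, s) \<partial>lborel \<partial>pos_lborel)"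
      unfolding E_def by (subst sample.integral_snd[OF i1]) simp
    also have "\<dots> = (\<integral>s. - \<eta> * (\<integral>x. f x * h s * g1 (x, s) \<partial>lborel) \<partial>pos_lborel)" by simp
    also have "\<dots> \<le> (\<integral>s. (2 - p) * (\<integral>x. f x * h s * g3 (x, s) \<partial>lborel) \<partial>pos_lborel)"
    proof (rule integral_mono_AE)
      show "integrable pos_lborel (\<lambda>s. - \<eta> * (\<integral>x. f x * h s * g1 (x, s) \<partial>lborel))"
        by (intro integrable_mult_right sample.integrable_snd[OF i1])
      show "integrable pos_lborel (\<lambda>s. (2 - p) * (\<integral>x. f x * h s * g3 (x, s) \<partial>lborel))"
        by (intro integrable_mult_right sample.integrable_snd[OF i3])
      show "AE s in pos_lborel. - \<eta> * (\<integral>x. f x * h s * g1 (x, s) \<partial>lborel) \<le> (2 - p) * (\<integral>x. f x * h s * g3 (x, s) \<partial>lborel)"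
      proof (rule AE_I2)
        fix s assume "s \<in> space pos_lborel"
        then have s: "s > 0" by simp
        have "- \<eta> * (\<integral>x. f x * (q x s * (x \<bullet> (x - \<theta>))) \<partial>lborel) \<le> (2 - p) * (\<integral>x. f x * q x s \<partial>lborel)"
          unfolding f_def p_def
        proof (rule stein_inequality[OF \<eta>, where C = 1])
          \<comment> \<open>Along a ray, dividing \<open>x\<close> by \<open>c\<close> divides
            \<open>w\<close> by \<open>c\<^sup>2\<close>, so the scaling hypothesis is the
            monotonicity of \<open>w * Q w\<close>. The point \<open>x = 0\<close> is separate
            because there \<open>w\<close> cannot be cancelled.\<close>
          fix c x assume c: "(c :: real) > 1"
          show "q ((1 / c) *\<^sub>R x) s \<le> c\<^sup>2 * q x s"
          proof (cases "x = 0")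
            case True
            then show ?thesis using c q0[OF s, of 0] by (simp add: q_def mult_le_cancel_right1 power_le_one_iff one_le_power)
          next
            case False
            define w where "w = (norm x)\<^sup>2 / s"
            have w: "w > 0" using False s by (simp add: w_def)
            have c2: "c\<^sup>2 > 1" using c by simp
            have "(norm ((1 / c) *\<^sub>R x))\<^sup>2 / s = w / c\<^sup>2" using c by (simp add: w_def power_divide)
            moreover have "w / c\<^sup>2 * Q (w / c\<^sup>2) \<le> w * Q w"
              using w c2 by (intro mono) (auto simp: divide_le_eq)
            then have "w * (Q (w / c\<^sup>2) / c\<^sup>2) \<le> w * Q w" by simp
            then have "Q (w / c\<^sup>2) / c\<^sup>2 \<le> Q w" using w by (rule mult_left_le_imp_le)
            then have "Q (w / c\<^sup>2) \<le> c\<^sup>2 * Q w" using c2 c by (simp add: divide_le_eq mult.commute)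
            ultimately show ?thesis by (simp add: q_def w_def)
          qed
        qed (use s q0 q1 in \<open>auto simp: q_def\<close>)
        then have "h s * (- \<eta> * (\<integral>x. f x * (q x s * (x \<bullet> (x - \<theta>))) \<partial>lborel)) \<le> h s * ((2 - p) * (\<integral>x. f x * q x s \<partial>lborel))"
          by (rule mult_left_mono) (simp add: h_def)
        moreover have "(\<integral>x. f x * h s * g1 (x, s) \<partial>lborel) = h s * (\<integral>x. f x * (q x s * (x \<bullet> (x - \<theta>))) \<partial>lborel)"
          unfolding Bochner_Integration.integral_mult_right_zero[symmetric]
          by (intro Bochner_Integration.integral_cong refl) (simp add: g1_def)
        moreover have "(\<integral>x. f x * h s * g3 (x, s) \<partial>lborel) = h s * (\<integral>x. f x * q x s \<partial>lborel)"
          unfolding Bochner_Integration.integral_mult_right_zero[symmetric]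
          by (intro Bochner_Integration.integral_cong refl) (simp add: g3_def)
        ultimately show "- \<eta> * (\<integral>x. f x * h s * g1 (x, s) \<partial>lborel) \<le> (2 - p) * (\<integral>x. f x * h s * g3 (x, s) \<partial>lborel)"
          by (simp only: mult.left_commute[of "- \<eta>"] mult.left_commute[of "2 - p"])
      qed
    qed
    also have "\<dots> = (2 - p) * E g3"
      unfolding E_def by (subst sample.integral_snd[OF i3, symmetric]) simp
    finally show ?thesis .
  qed
  have E2: "\<eta> * E g2 \<le> (real n + 2) * E g4"
  proof -
    have "\<eta> * E g2 = (\<integral>x. \<eta> * (\<integral>s. f x * h s * g2 (x, s) \<partial>pos_lborel) \<partial>lborel)"
      unfolding E_def by (subst sample.integral_fst[OF i2, symmetric]) simp
    also have "\<dots> \<le> (\<integral>x. (real n + 2) * (\<integral>s. f x * h s * g4 (x, s) \<partial>pos_lborel) \<partial>lborel)"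
    proof (rule integral_mono_AE)
      show "integrable lborel (\<lambda>x. \<eta> * (\<integral>s. f x * h s * g2 (x, s) \<partial>pos_lborel))"
        by (intro integrable_mult_right sample.integrable_fst[OF i2])
      show "integrable lborel (\<lambda>x. (real n + 2) * (\<integral>s. f x * h s * g4 (x, s) \<partial>pos_lborel))"
        by (intro integrable_mult_right sample.integrable_fst[OF i4])
      show "AE x in lborel. \<eta> * (\<integral>s. f x * h s * g2 (x, s) \<partial>pos_lborel) \<le> (real n + 2) * (\<integral>s. f x * h s * g4 (x, s) \<partial>pos_lborel)"
      proof (rule AE_I2)
        fix x :: "real ^ 'p"
        define r where "r = (\<lambda>s. (norm x)\<^sup>2 / s * (q x s)\<^sup>2)"
        have "\<eta> * (\<integral>s. h s * (s * r s) \<partial>pos_lborel) \<le> (real n + 2) * (\<integral>s. h s * r s \<partial>pos_lborel)"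
          unfolding h_def
        proof (rule chisq_inequality[OF \<eta> n, where C = K])
          show "r \<in> borel_measurable borel" unfolding r_def q_def by measurable
          show "0 \<le> r s" if "s > 0" for s using that by (simp add: r_def)
          show "r s \<le> K" if "s > 0" for s using wqq'[OF that] by (simp add: r_def)
          fix c s :: real assume c: "0 < c" "c < 1" and s: "s > 0"
          show "r (s / c) \<le> r s / c"
          proof (cases "x = 0")
            case True
            then show ?thesis by (simp add: r_def)
          next
            case False
            define w where "w = (norm x)\<^sup>2 / s"
            have w: "w > 0" using False s by (simp add: w_def)
            have 1: "(norm x)\<^sup>2 / (s / c) = c * w" by (simp add: w_def)
            have "c * w * Q (c * w) \<le> w * Q w" using w c by (intro mono) auto
            \<comment> \<open>The function \<open>r\<close> is \<open>(w * Q w)\<^sup>2 / w\<close>: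
              its numerator is monotone in \<open>w\<close>, and its denominator supplies the
              permitted factor \<open>1 / c\<close>.\<close>
            then have "(c * w * Q (c * w))\<^sup>2 \<le> (w * Q w)\<^sup>2"
              using w c Q0[of "c * w"] by (intro power_mono) auto
            then have "(c * w * Q (c * w))\<^sup>2 / (c * w) \<le> (w * Q w)\<^sup>2 / (c * w)"
              using w c by (intro divide_right_mono) auto
            moreover have "(c * w * Q (c * w))\<^sup>2 / (c * w) = c * w * (Q (c * w))\<^sup>2" "(w * Q w)\<^sup>2 / (c * w) = w * (Q w)\<^sup>2 / c"
              using w c by (auto simp: power2_eq_square)
            ultimately show ?thesis unfolding r_def q_def 1 w_def[symmetric] by simp
          qed
        qed
        then have "f x * (\<eta> * (\<integral>s. h s * (s * r s) \<partial>pos_lborel)) \<le> f x * ((real n + 2) * (\<integral>s. h s * r s \<partial>pos_lborel))"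
          by (rule mult_left_mono) (simp add: f_def)
        moreover have "(\<integral>s. f x * h s * g2 (x, s) \<partial>pos_lborel) = f x * (\<integral>s. h s * (s * r s) \<partial>pos_lborel)"
          unfolding Bochner_Integration.integral_mult_right_zero[symmetric]
          by (intro Bochner_Integration.integral_cong refl) (simp add: g2_def r_def)
        moreover have "(\<integral>s. f x * h s * g4 (x, s) \<partial>pos_lborel) = f x * (\<integral>s. h s * r s \<partial>pos_lborel)"
          unfolding Bochner_Integration.integral_mult_right_zero[symmetric]
          by (intro Bochner_Integration.integral_cong refl) (simp add: g4_def r_def)
        ultimately show "\<eta> * (\<integral>s. f x * h s * g2 (x, s) \<partial>pos_lborel) \<le> (real n + 2) * (\<integral>s. f x * h s * g4 (x, s) \<partial>pos_lborel)"
          by (simp only: mult.left_commute[of \<eta>] mult.left_commute[of "real n + 2"])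
      qed
    qed
    also have "\<dots> = (real n + 2) * E g4"
      unfolding E_def by (subst sample.integral_fst[OF i4, symmetric]) simp
    finally show ?thesis .
  qed
  have E4: "E g4 \<le> K * E g3"
  proof -
    have "E g4 \<le> (\<integral>z. K * ?F g3 z \<partial>?M)"
      unfolding E_def
    proof (rule integral_mono_AE)
      show "AE z in ?M. ?F g4 z \<le> K * ?F g3 z"
      proof (rule AE_I2)
        fix z assume "z \<in> space ?M"
        then obtain x s where z: "z = (x, s)" and s: "s > 0" by (auto simp: space_pair_measure)
        have "f x * h s * g4 (x, s) \<le> f x * h s * (K * g3 (x, s))"
          using wqq[OF s, of x] by (intro mult_left_mono) (auto simp: g3_def g4_def f_def h_def)
        then show "?F g4 z \<le> K * ?F g3 z"
          by (simp add: z mult_ac)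
      qed
    qed (use i3 i4 in auto)
    then show ?thesis unfolding E_def by simp
  qed
  have "risk n \<delta> \<theta> \<eta> = (\<integral>\<^sup>+z. ennreal (\<eta> * ?F g0 z - 2 * \<eta> * ?F g1 z + \<eta> * ?F g2 z) \<partial>?M)"
    unfolding risk_eq[OF est \<eta> n]
  proof (intro nn_integral_cong arg_cong[where f=ennreal])
    fix z assume "z \<in> space ?M"
    then obtain x s where z: "z = (x, s)" and s: "s > 0" by (auto simp: space_pair_measure)
    have "\<delta> z - \<theta> = (x - \<theta>) - q x s *\<^sub>R x" unfolding z \<delta>[OF s] q_def by (simp add: algebra_simps)
    then have "(norm (\<delta> z - \<theta>))\<^sup>2 = (norm (x - \<theta>))\<^sup>2 - 2 * (q x s * (x \<bullet> (x - \<theta>))) + (q x s)\<^sup>2 * (norm x)\<^sup>2"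
      unfolding power2_norm_eq_inner
      by (simp only: inner_diff_left[of "x - \<theta>" "q x s *\<^sub>R x"] inner_diff_right[of _ "x - \<theta>" "q x s *\<^sub>R x"] inner_scaleR_left inner_scaleR_right inner_commute[of "x - \<theta>" x])
         (simp add: power2_eq_square algebra_simps)
    then show "normal_dens \<theta> \<eta> (fst z) * chisq_dens n \<eta> (snd z) * (\<eta> * (norm (\<delta> z - \<theta>))\<^sup>2)
      = \<eta> * ?F g0 z - 2 * \<eta> * ?F g1 z + \<eta> * ?F g2 z"
      by (simp only: z prod.case fst_conv snd_conv f_def h_def g0_def g1_def g2_def) (simp add: algebra_simps)
  qed
  also have "\<dots> = ennreal (\<integral>z. \<eta> * ?F g0 z - 2 * \<eta> * ?F g1 z + \<eta> * ?F g2 z \<partial>?M)"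
  proof (rule nn_integral_eq_integral)
    show "integrable ?M (\<lambda>z. \<eta> * ?F g0 z - 2 * \<eta> * ?F g1 z + \<eta> * ?F g2 z)"
      by (intro Bochner_Integration.integrable_add Bochner_Integration.integrable_diff integrable_mult_right i0 i1 i2)
    show "AE z in ?M. 0 \<le> \<eta> * ?F g0 z - 2 * \<eta> * ?F g1 z + \<eta> * ?F g2 z"
    proof (rule AE_I2)
      fix z :: "(real ^ 'p) \<times> real"
      obtain x s where z: "z = (x, s)" by fastforce
      have "0 \<le> (norm ((x - \<theta>) - q x s *\<^sub>R x))\<^sup>2" by simp
      also have "\<dots> = (norm (x - \<theta>))\<^sup>2 - 2 * (q x s * (x \<bullet> (x - \<theta>))) + (q x s)\<^sup>2 * (norm x)\<^sup>2"
        unfolding power2_norm_eq_inner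
        by (simp only: inner_diff_left[of "x - \<theta>" "q x s *\<^sub>R x"] inner_diff_right[of _ "x - \<theta>" "q x s *\<^sub>R x"] inner_scaleR_left inner_scaleR_right inner_commute[of "x - \<theta>" x])
           (simp add: power2_eq_square algebra_simps)
      finally have "0 \<le> \<eta> * (f x * h s) * \<dots>" using \<eta> by (intro mult_nonneg_nonneg) (auto simp: f_def h_def)
      then show "0 \<le> \<eta> * ?F g0 z - 2 * \<eta> * ?F g1 z + \<eta> * ?F g2 z"
        by (simp add: z g0_def g1_def g2_def algebra_simps)
    qed
  qed
  also have "(\<integral>z. \<eta> * ?F g0 z - 2 * \<eta> * ?F g1 z + \<eta> * ?F g2 z \<partial>?M)
     = \<eta> * E g0 - 2 * \<eta> * E g1 + \<eta> * E g2"
    unfolding E_def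
    by (simp only: Bochner_Integration.integral_add Bochner_Integration.integral_diff Bochner_Integration.integral_mult_right_zero
        Bochner_Integration.integrable_add Bochner_Integration.integrable_diff integrable_mult_right i0 i1 i2)
  also have "\<dots> \<le> p"
  proof -
    \<comment> \<open>Here \<open>(n + 2) * K\<close> becomes \<open>2 * (p - 2)\<close>, the exact
      opposite of twice the coefficient in \<open>E1\<close>.\<close>
    have "\<eta> * E g2 \<le> (real n + 2) * (K * E g3)"
      using E2 mult_left_mono[OF E4, of "real n + 2"] by linarith
    also have "\<dots> = 2 * (p - 2) * E g3" by (simp add: K_def)
    finally have "\<eta> * E g2 + 2 * (- \<eta> * E g1) \<le> 2 * (p - 2) * E g3 + 2 * ((2 - p) * E g3)"
      using E1 by linarith
    then have "\<eta> * E g2 - 2 * \<eta> * E g1 \<le> 0" by (simp add: algebra_simps)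
    moreover have "\<eta> * E g0 = p" using E0 \<eta> by simp
    ultimately show ?thesis by simp
  qed
  finally show ?thesis unfolding p_def by (simp add: ennreal_leI)
qed

text \<open>The maximal risk dominates every average of the risk. With \<eta> fixed at 1 and a
  normal prior of variance \<tau>, the posterior variance bounds the average below by
  \<open>p * \<tau> / (\<tau> + 1)\<close>, whatever use the estimator makes of
  \<open>s\<close>.\<close>

lemma risk_lower_bound:
  fixes \<delta> :: "(real ^ 'p) \<times> real \<Rightarrow> real ^ 'p"
  assumes est: "estimator \<delta>" and n: "n > 0"
  shows "ennreal (real CARD('p)) \<le> sup_risk n \<delta>"
proof -
  let ?M = "lborel \<Otimes>\<^sub>M pos_lborel :: ((real ^ 'p) \<times> real) measure"
  have [measurable]: "\<delta> \<in> borel_measurable ?M" using est by (simp add: estimator_def)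
  have le: "ennreal (real CARD('p) * \<tau> / (\<tau> + 1)) \<le> sup_risk n \<delta>" if \<tau>: "\<tau> > 0" for \<tau> :: real
  proof -
    have \<tau>': "1 / \<tau> > 0" "1 / (\<tau> + 1) > 0" "(\<tau> + 1) / \<tau> > 0" using \<tau> by auto
    have sup: "risk n \<delta> \<theta> 1 \<le> sup_risk n \<delta>" for \<theta>
      unfolding sup_risk_def by (rule SUP_upper2[of "(\<theta>, 1)"]) auto
    have key: "ennreal (normal_dens 0 (1 / \<tau>) \<theta>) * ennreal (normal_dens \<theta> 1 x * chisq_dens n 1 s * (1 * (norm (\<delta> (x, s) - \<theta>))\<^sup>2))
      = ennreal (normal_dens 0 (1 / (\<tau> + 1)) x * chisq_dens n 1 s) * ennreal (normal_dens ((\<tau> / (\<tau> + 1)) *\<^sub>R x) ((\<tau> + 1) / \<tau>) \<theta> * (norm (\<theta> - \<delta> (x, s)))\<^sup>2)" for \<theta> x s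
    proof -
      have "normal_dens 0 (1 / \<tau>) \<theta> * (normal_dens \<theta> 1 x * chisq_dens n 1 s * (1 * (norm (\<delta> (x, s) - \<theta>))\<^sup>2))
        = (normal_dens \<theta> 1 x * normal_dens 0 (1 / \<tau>) \<theta>) * (chisq_dens n 1 s * (norm (\<delta> (x, s) - \<theta>))\<^sup>2)" by simp
      also have "\<dots> = normal_dens 0 (1 / (\<tau> + 1)) x * chisq_dens n 1 s * (normal_dens ((\<tau> / (\<tau> + 1)) *\<^sub>R x) ((\<tau> + 1) / \<tau>) \<theta> * (norm (\<theta> - \<delta> (x, s)))\<^sup>2)"
        using normal_dens_mult[of 1 \<tau> \<theta> x] \<tau> by (simp add: norm_minus_commute)
      finally show ?thesis by (simp add: ennreal_mult[symmetric])
    qed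
    have "ennreal (real CARD('p) * \<tau> / (\<tau> + 1)) = (\<integral>\<^sup>+x. \<integral>\<^sup>+s. ennreal (normal_dens 0 (1 / (\<tau> + 1)) x) * ennreal (chisq_dens n 1 s) * ennreal (real CARD('p) * \<tau> / (\<tau> + 1)) \<partial>pos_lborel \<partial>(lborel :: (real ^ 'p) measure))"
      using \<tau>' n by (simp add: nn_integral_multc nn_integral_cmult nn_integral_chisq_dens nn_integral_normal_dens)
    also have "\<dots> \<le> (\<integral>\<^sup>+x. \<integral>\<^sup>+s. (\<integral>\<^sup>+\<theta>. ennreal (normal_dens 0 (1 / \<tau>) \<theta>) * ennreal (normal_dens \<theta> 1 x * chisq_dens n 1 s * (1 * (norm (\<delta> (x, s) - \<theta>))\<^sup>2)) \<partial>lborel) \<partial>pos_lborel \<partial>lborel)"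
    proof (intro nn_integral_mono)
      fix x :: "real ^ 'p" and s
      have "(\<integral>\<^sup>+\<theta>. ennreal (normal_dens 0 (1 / \<tau>) \<theta>) * ennreal (normal_dens \<theta> 1 x * chisq_dens n 1 s * (1 * (norm (\<delta> (x, s) - \<theta>))\<^sup>2)) \<partial>lborel)
        = ennreal (normal_dens 0 (1 / (\<tau> + 1)) x * chisq_dens n 1 s) * ennreal ((norm ((\<tau> / (\<tau> + 1)) *\<^sub>R x - \<delta> (x, s)))\<^sup>2 + real CARD('p) / ((\<tau> + 1) / \<tau>))"
        unfolding key by (subst nn_integral_cmult) (auto simp: nn_integral_normal_dens_sq_dist[OF \<tau>'(3)])
      also have "\<dots> \<ge> ennreal (normal_dens 0 (1 / (\<tau> + 1)) x * chisq_dens n 1 s) * ennreal (real CARD('p) * \<tau> / (\<tau> + 1))"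
        by (intro mult_left_mono ennreal_leI) auto
      finally show "ennreal (normal_dens 0 (1 / (\<tau> + 1)) x) * ennreal (chisq_dens n 1 s) * ennreal (real CARD('p) * \<tau> / (\<tau> + 1))
        \<le> (\<integral>\<^sup>+\<theta>. ennreal (normal_dens 0 (1 / \<tau>) \<theta>) * ennreal (normal_dens \<theta> 1 x * chisq_dens n 1 s * (1 * (norm (\<delta> (x, s) - \<theta>))\<^sup>2)) \<partial>lborel)"
        by (simp add: ennreal_mult)
    qed
    also have "\<dots> = (\<integral>\<^sup>+z. (\<integral>\<^sup>+\<theta>. ennreal (normal_dens 0 (1 / \<tau>) \<theta>) * ennreal (normal_dens \<theta> 1 (fst z) * chisq_dens n 1 (snd z) * (1 * (norm (\<delta> z - \<theta>))\<^sup>2)) \<partial>lborel) \<partial>?M)"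
      by (subst pos_lborel.nn_integral_fst[symmetric]) auto
    also have "\<dots> = (\<integral>\<^sup>+\<theta>. (\<integral>\<^sup>+z. ennreal (normal_dens 0 (1 / \<tau>) \<theta>) * ennreal (normal_dens \<theta> 1 (fst z) * chisq_dens n 1 (snd z) * (1 * (norm (\<delta> z - \<theta>))\<^sup>2)) \<partial>?M) \<partial>lborel)"
    proof -
      interpret pp: pair_sigma_finite ?M "lborel :: (real ^ 'p) measure" ..
      show ?thesis by (rule pp.Fubini'[symmetric]) measurable
    qed
    also have "\<dots> = (\<integral>\<^sup>+\<theta>. ennreal (normal_dens 0 (1 / \<tau>) \<theta>) * risk n \<delta> \<theta> 1 \<partial>lborel)"
      unfolding risk_eq[OF est zero_less_one n] by (subst nn_integral_cmult) auto
    also have "\<dots> \<le> (\<integral>\<^sup>+(\<theta> :: real ^ 'p). ennreal (normal_dens 0 (1 / \<tau>) \<theta>) * sup_risk n \<delta> \<partial>lborel)"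
      by (intro nn_integral_mono mult_left_mono sup) auto
    also have "\<dots> = sup_risk n \<delta>"
      using \<tau>' by (simp add: nn_integral_multc nn_integral_normal_dens)
    finally show ?thesis .
  qed
  have "((\<lambda>\<tau>. ennreal (real CARD('p) * \<tau> / (\<tau> + 1))) \<longlongrightarrow> ennreal (real CARD('p))) at_top"
    by (intro tendsto_ennrealI) real_asymp
  then show ?thesis
    by (rule tendsto_upperbound) (auto intro!: eventually_mono[OF eventually_gt_at_top[of 0]] le)
qed

lemma minimax_of_risk_le:
  fixes \<delta> :: "(real ^ 'p) \<times> real \<Rightarrow> real ^ 'p"
  assumes est: "estimator \<delta>" and n: "n > 0"
    and le: "\<And>\<theta> \<eta>. \<eta> > 0 \<Longrightarrow> risk n \<delta> \<theta> \<eta> \<le> ennreal (real CARD('p))"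
  shows "minimax n \<delta>"
proof -
  have "sup_risk n \<delta> \<le> ennreal (real CARD('p))"
    unfolding sup_risk_def by (intro SUP_least) (auto intro: le)
  also have "\<dots> \<le> (INF \<delta>' \<in> {\<delta>' :: (real ^ 'p) \<times> real \<Rightarrow> real ^ 'p. estimator \<delta>'}. sup_risk n \<delta>')"
    using n by (intro INF_greatest risk_lower_bound) auto
  finally have "sup_risk n \<delta> \<le> (INF \<delta>' \<in> {\<delta>' :: (real ^ 'p) \<times> real \<Rightarrow> real ^ 'p. estimator \<delta>'}. sup_risk n \<delta>')" .
  moreover have "(INF \<delta>' \<in> {\<delta>' :: (real ^ 'p) \<times> real \<Rightarrow> real ^ 'p. estimator \<delta>'}. sup_risk n \<delta>') \<le> sup_risk n \<delta>"
    using est by (intro INF_lower) auto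
  ultimately show ?thesis unfolding minimax_def using est by (auto intro: antisym)
qed

section \<open>Admissibility\<close>

lemma (in prob_space) square_expectation_le:
  fixes X :: "'a \<Rightarrow> real"
  assumes "integrable M X" "integrable M (\<lambda>\<omega>. (X \<omega>)\<^sup>2)"
  shows "(expectation X)\<^sup>2 \<le> expectation (\<lambda>\<omega>. (X \<omega>)\<^sup>2)"
  using variance_eq[OF assms] variance_positive[of X] by linarith

text \<open>Here \<open>expectation L\<close> is the shrinkage factor of the generalized Bayes rule and the weight
  \<open>H\<^sup>2\<close> comes from truncating the prior; the error term vanishes when \<open>H\<close> is constant.\<close>

lemma (in prob_space) weighted_square_perturbation:
  fixes L H k :: "'a \<Rightarrow> real" and x d :: "'b :: real_inner"
  assumes [measurable]: "L \<in> borel_measurable M" "H \<in> borel_measurable M" "k \<in> borel_measurable M"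
    and L: "\<And>\<omega>. \<omega> \<in> space M \<Longrightarrow> 0 \<le> L \<omega>" "\<And>\<omega>. \<omega> \<in> space M \<Longrightarrow> L \<omega> \<le> 1"
    and H: "\<And>\<omega>. \<omega> \<in> space M \<Longrightarrow> 0 \<le> H \<omega>" "\<And>\<omega>. \<omega> \<in> space M \<Longrightarrow> H \<omega> \<le> 1"
    and k: "\<And>\<omega>. \<omega> \<in> space M \<Longrightarrow> (H \<omega> - h)\<^sup>2 \<le> k \<omega>" "integrable M k"
  defines "q \<equiv> expectation L"
  shows "expectation (\<lambda>\<omega>. (H \<omega>)\<^sup>2 * (norm ((q - L \<omega>) *\<^sub>R x))\<^sup>2) + 1 / 2 * (norm d)\<^sup>2 * expectation (\<lambda>\<omega>. (H \<omega>)\<^sup>2)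
     \<le> expectation (\<lambda>\<omega>. (H \<omega>)\<^sup>2 * (norm ((q - L \<omega>) *\<^sub>R x - d))\<^sup>2)
       + 16 * (norm x)\<^sup>2 * (expectation (\<lambda>\<omega>. (L \<omega>)\<^sup>2 * k \<omega>) + 3 * expectation (\<lambda>\<omega>. (L \<omega>)\<^sup>2) * expectation k)"
proof -
  define m where "m = expectation H"
  have bdd: "integrable M f" if "f \<in> borel_measurable M" "\<And>\<omega>. \<omega> \<in> space M \<Longrightarrow> \<bar>f \<omega>\<bar> \<le> B" for f :: "'a \<Rightarrow> real" and B
    using that by (intro integrable_const_bound[of f B]) (auto intro!: AE_I2)
  have iL: "integrable M L" using L by (intro bdd[of _ 1]) auto
  have iH: "integrable M H" using H by (intro bdd[of _ 1]) auto
  have q: "0 \<le> q" "q \<le> 1"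
    unfolding q_def using L iL by (auto intro!: integral_nonneg_AE integral_le_const AE_I2)
  have m: "0 \<le> m" "m \<le> 1"
    unfolding m_def using H iH by (auto intro!: integral_nonneg_AE integral_le_const AE_I2)
  have L2: "0 \<le> (L \<omega>)\<^sup>2" "(L \<omega>)\<^sup>2 \<le> 1" if "\<omega> \<in> space M" for \<omega>
    using L[OF that] by (auto simp: power_le_one)
  have H2: "0 \<le> (H \<omega>)\<^sup>2" "(H \<omega>)\<^sup>2 \<le> 1" if "\<omega> \<in> space M" for \<omega>
    using H[OF that] by (auto simp: power_le_one)
  have qL: "\<bar>q - L \<omega>\<bar> \<le> 1" if "\<omega> \<in> space M" for \<omega> using L[OF that] q by auto
  have Hm: "\<bar>H \<omega> - m\<bar> \<le> 1" if "\<omega> \<in> space M" for \<omega> using H[OF that] m by auto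
  have iL2: "integrable M (\<lambda>\<omega>. (L \<omega>)\<^sup>2)" using L2 by (intro bdd[of _ 1]) auto
  have iH2: "integrable M (\<lambda>\<omega>. (H \<omega>)\<^sup>2)" using H2 by (intro bdd[of _ 1]) auto
  have ik: "integrable M k" by fact
  have iLk: "integrable M (\<lambda>\<omega>. (L \<omega>)\<^sup>2 * k \<omega>)"
  proof (rule Bochner_Integration.integrable_bound[OF ik])
    show "AE \<omega> in M. norm ((L \<omega>)\<^sup>2 * k \<omega>) \<le> norm (k \<omega>)"
      using L2 by (intro AE_I2) (auto simp: abs_mult intro: mult_left_le_one_le)
  qed simp
  have iu: "integrable M (\<lambda>\<omega>. (H \<omega>)\<^sup>2 * (q - L \<omega>))"
    using mult_mono[OF H2(2) qL] H2(1) by (intro bdd[of _ 1]) (auto simp: abs_mult)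
  have iu2: "integrable M (\<lambda>\<omega>. (H \<omega>)\<^sup>2 * (q - L \<omega>)\<^sup>2)"
  proof (intro bdd[of _ 1])
    fix \<omega> assume w: "\<omega> \<in> space M"
    have "(q - L \<omega>)\<^sup>2 \<le> 1" using qL[OF w] by (simp add: abs_square_le_1)
    then show "\<bar>(H \<omega>)\<^sup>2 * (q - L \<omega>)\<^sup>2\<bar> \<le> 1" using H2[OF w] mult_mono[of "(H \<omega>)\<^sup>2" 1 "(q - L \<omega>)\<^sup>2" 1] by (simp add: abs_mult)
  qed auto
  have iHh: "integrable M (\<lambda>\<omega>. (H \<omega> - h)\<^sup>2)"
    by (rule Bochner_Integration.integrable_bound[OF ik]) (use k(1) in \<open>auto intro!: AE_I2 order_trans[OF k(1) abs_ge_self]\<close>)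
  \<comment> \<open>The reference value \<open>h\<close> is arbitrary; by Jensen the mean
    \<open>m\<close> of \<open>H\<close> is as close to it as \<open>k\<close> allows, so
    \<open>h\<close> can be replaced by \<open>m\<close>.\<close>
  have mh: "(m - h)\<^sup>2 \<le> expectation k"
  proof -
    have "m - h = expectation (\<lambda>\<omega>. H \<omega> - h)" using iH by (simp add: m_def prob_space)
    then have "(m - h)\<^sup>2 \<le> expectation (\<lambda>\<omega>. (H \<omega> - h)\<^sup>2)"
      using square_expectation_le[of "\<lambda>\<omega>. H \<omega> - h"] iH iHh by simp
    also have "\<dots> \<le> expectation k" using iHh ik k(1) by (intro integral_mono) auto
    finally show ?thesis .
  qed
  have m2: "m\<^sup>2 \<le> expectation (\<lambda>\<omega>. (H \<omega>)\<^sup>2)" unfolding m_def by (rule square_expectation_le[OF iH iH2])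
  have q2: "q\<^sup>2 \<le> expectation (\<lambda>\<omega>. (L \<omega>)\<^sup>2)" unfolding q_def by (rule square_expectation_le[OF iL iL2])
  have ek: "0 \<le> expectation k"
    using k(1) by (intro integral_nonneg_AE AE_I2) (meson order_trans zero_le_power2)
  define R where "R = 2 * q\<^sup>2 * expectation k + 2 * q\<^sup>2 * expectation k + 2 * expectation (\<lambda>\<omega>. (L \<omega>)\<^sup>2 * k \<omega>) + 2 * expectation (\<lambda>\<omega>. (L \<omega>)\<^sup>2) * expectation k"
  \<comment> \<open>The cross term is the only one of indefinite sign. Because \<open>q - L\<close>
    has mean zero, \<open>H\<^sup>2\<close> may be replaced by
    \<open>H\<^sup>2 - m\<^sup>2 = (H - m) * (H + m)\<close>, which is small where \<open>H\<close>
    is nearly constant.\<close>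
  have "2 * (x \<bullet> d) * expectation (\<lambda>\<omega>. (H \<omega>)\<^sup>2 * (q - L \<omega>)) = expectation (\<lambda>\<omega>. 2 * (x \<bullet> d) * ((H \<omega>)\<^sup>2 * (q - L \<omega>)) - 2 * (x \<bullet> d) * m\<^sup>2 * (q - L \<omega>))"
    using iu iL by (simp add: q_def prob_space)
  also have "\<dots> \<le> expectation (\<lambda>\<omega>. 1 / 8 * (norm d)\<^sup>2 * (2 * (H \<omega>)\<^sup>2 + 2 * m\<^sup>2) + 8 * (norm x)\<^sup>2 * ((q\<^sup>2 + (L \<omega>)\<^sup>2) * (2 * k \<omega> + 2 * expectation k)))"
  proof (rule integral_mono)
    show "integrable M (\<lambda>\<omega>. 2 * (x \<bullet> d) * ((H \<omega>)\<^sup>2 * (q - L \<omega>)) - 2 * (x \<bullet> d) * m\<^sup>2 * (q - L \<omega>))"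
      using iu iL by simp
    show "integrable M (\<lambda>\<omega>. 1 / 8 * (norm d)\<^sup>2 * (2 * (H \<omega>)\<^sup>2 + 2 * m\<^sup>2) + 8 * (norm x)\<^sup>2 * ((q\<^sup>2 + (L \<omega>)\<^sup>2) * (2 * k \<omega> + 2 * expectation k)))"
      unfolding distrib_left distrib_right using iH2 iL2 ik iLk by (auto simp: mult.left_commute[of _ 2])
    fix \<omega> assume w: "\<omega> \<in> space M"
    define u V S where "u = q - L \<omega>" and "V = H \<omega> - m" and "S = H \<omega> + m"
    have "2 * (x \<bullet> d) * ((H \<omega>)\<^sup>2 * u) - 2 * (x \<bullet> d) * m\<^sup>2 * u = 2 * (x \<bullet> d) * (V * S * u)"
      by (simp add: V_def S_def power2_eq_square algebra_simps)
    also have "\<dots> \<le> 2 * \<bar>x \<bullet> d\<bar> * \<bar>V * S * u\<bar>"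
      using abs_ge_self[of "2 * (x \<bullet> d) * (V * S * u)"] by (simp add: abs_mult)
    also have "\<dots> \<le> 2 * (norm x * norm d) * \<bar>V * S * u\<bar>"
      by (intro mult_right_mono mult_left_mono Cauchy_Schwarz_ineq2) auto
    also have "\<dots> = 2 * (norm d * \<bar>S\<bar>) * (norm x * \<bar>u * V\<bar>)"
      by (simp add: abs_mult)
    \<comment> \<open>The weights 1/8 and 8 are chosen so that, with
      \<open>(H + m)\<^sup>2 \<le> 2 * H\<^sup>2 + 2 * m\<^sup>2\<close> and
      \<open>m\<^sup>2\<close> at most the mean of \<open>H\<^sup>2\<close>, the first summand uses
      up half of the gain \<open>(norm d)\<^sup>2\<close> times that mean.\<close>
    also have "\<dots> \<le> 1 / 8 * (norm d * \<bar>S\<bar>)\<^sup>2 + 8 * (norm x * \<bar>u * V\<bar>)\<^sup>2"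
    proof -
      have "2 * A * B \<le> 1 / 8 * A\<^sup>2 + 8 * B\<^sup>2" for A B :: real
        using zero_le_power2[of "A - 8 * B"] by (simp add: power2_eq_square algebra_simps)
      then show ?thesis .
    qed
    also have "\<dots> = 1 / 8 * (norm d)\<^sup>2 * S\<^sup>2 + 8 * (norm x)\<^sup>2 * (u\<^sup>2 * V\<^sup>2)"
      by (simp add: power_mult_distrib)
    also have "\<dots> \<le> 1 / 8 * (norm d)\<^sup>2 * (2 * (H \<omega>)\<^sup>2 + 2 * m\<^sup>2) + 8 * (norm x)\<^sup>2 * ((q\<^sup>2 + (L \<omega>)\<^sup>2) * (2 * k \<omega> + 2 * expectation k))"
    proof (intro add_mono mult_left_mono mult_mono)
      show "S\<^sup>2 \<le> 2 * (H \<omega>)\<^sup>2 + 2 * m\<^sup>2" unfolding S_def by (rule sq_sum_le)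
      \<comment> \<open>Nonnegativity of \<open>q * L\<close> lets the mixed term of the square be
        dropped, so \<open>L\<close> and \<open>q\<close> enter the error through their squares
        alone; this later yields the decay \<open>(1 + w) powr (- 2)\<close>.\<close>
      have "q * L \<omega> \<ge> 0" using q L[OF w] by simp
      then show "u\<^sup>2 \<le> q\<^sup>2 + (L \<omega>)\<^sup>2" by (simp add: u_def power2_diff)
      have "V\<^sup>2 \<le> 2 * (H \<omega> - h)\<^sup>2 + 2 * (h - m)\<^sup>2" using sq_sum_le[of "H \<omega> - h" "h - m"] by (simp add: V_def)
      also have "\<dots> \<le> 2 * k \<omega> + 2 * expectation k" using k(1)[OF w] mh by (simp add: power2_commute)
      finally show "V\<^sup>2 \<le> 2 * k \<omega> + 2 * expectation k" .
    qed auto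
    finally show "2 * (x \<bullet> d) * ((H \<omega>)\<^sup>2 * (q - L \<omega>)) - 2 * (x \<bullet> d) * m\<^sup>2 * (q - L \<omega>) \<le> 1 / 8 * (norm d)\<^sup>2 * (2 * (H \<omega>)\<^sup>2 + 2 * m\<^sup>2) + 8 * (norm x)\<^sup>2 * ((q\<^sup>2 + (L \<omega>)\<^sup>2) * (2 * k \<omega> + 2 * expectation k))"
      unfolding u_def .
  qed
  also have "\<dots> = 1 / 8 * (norm d)\<^sup>2 * (2 * expectation (\<lambda>\<omega>. (H \<omega>)\<^sup>2) + 2 * m\<^sup>2) + 8 * (norm x)\<^sup>2 * R"
  proof -
    have "expectation (\<lambda>\<omega>. 1 / 8 * (norm d)\<^sup>2 * (2 * (H \<omega>)\<^sup>2 + 2 * m\<^sup>2) + 8 * (norm x)\<^sup>2 * ((q\<^sup>2 + (L \<omega>)\<^sup>2) * (2 * k \<omega> + 2 * expectation k)))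
      = expectation (\<lambda>\<omega>. 1 / 8 * (norm d)\<^sup>2 * (2 * (H \<omega>)\<^sup>2 + 2 * m\<^sup>2) + 8 * (norm x)\<^sup>2 * (2 * q\<^sup>2 * k \<omega> + 2 * q\<^sup>2 * expectation k + 2 * ((L \<omega>)\<^sup>2 * k \<omega>) + 2 * expectation k * (L \<omega>)\<^sup>2))"
      by (intro Bochner_Integration.integral_cong refl) (simp add: algebra_simps)
    also have "\<dots> = 1 / 8 * (norm d)\<^sup>2 * (2 * expectation (\<lambda>\<omega>. (H \<omega>)\<^sup>2) + 2 * m\<^sup>2) + 8 * (norm x)\<^sup>2 * R"
      unfolding R_def using iH2 iL2 ik iLk by (simp add: prob_space)
    finally show ?thesis .
  qed
  also have "\<dots> \<le> 1 / 2 * (norm d)\<^sup>2 * expectation (\<lambda>\<omega>. (H \<omega>)\<^sup>2) + 16 * (norm x)\<^sup>2 * (expectation (\<lambda>\<omega>. (L \<omega>)\<^sup>2 * k \<omega>) + 3 * expectation (\<lambda>\<omega>. (L \<omega>)\<^sup>2) * expectation k)"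
  proof (rule add_mono)
    have "(norm d)\<^sup>2 * (2 * expectation (\<lambda>\<omega>. (H \<omega>)\<^sup>2) + 2 * m\<^sup>2) \<le> (norm d)\<^sup>2 * (4 * expectation (\<lambda>\<omega>. (H \<omega>)\<^sup>2))"
      using m2 by (intro mult_left_mono) auto
    then show "1 / 8 * (norm d)\<^sup>2 * (2 * expectation (\<lambda>\<omega>. (H \<omega>)\<^sup>2) + 2 * m\<^sup>2) \<le> 1 / 2 * (norm d)\<^sup>2 * expectation (\<lambda>\<omega>. (H \<omega>)\<^sup>2)" by simp
    have "R \<le> 2 * (expectation (\<lambda>\<omega>. (L \<omega>)\<^sup>2 * k \<omega>) + 3 * expectation (\<lambda>\<omega>. (L \<omega>)\<^sup>2) * expectation k)"
      unfolding R_def using mult_right_mono[OF q2 ek] by (simp only: distrib_left mult.assoc)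
    then have "8 * (norm x)\<^sup>2 * R \<le> 8 * (norm x)\<^sup>2 * (2 * (expectation (\<lambda>\<omega>. (L \<omega>)\<^sup>2 * k \<omega>) + 3 * expectation (\<lambda>\<omega>. (L \<omega>)\<^sup>2) * expectation k))"
      by (intro mult_left_mono) auto
    then show "8 * (norm x)\<^sup>2 * R \<le> 16 * (norm x)\<^sup>2 * (expectation (\<lambda>\<omega>. (L \<omega>)\<^sup>2 * k \<omega>) + 3 * expectation (\<lambda>\<omega>. (L \<omega>)\<^sup>2) * expectation k)" by (simp only: distrib_left mult.assoc mult.left_commute)
  qed
  finally have main: "2 * (x \<bullet> d) * expectation (\<lambda>\<omega>. (H \<omega>)\<^sup>2 * (q - L \<omega>)) \<le> \<dots>" .
  have eq: "(H \<omega>)\<^sup>2 * (norm ((q - L \<omega>) *\<^sub>R x - d))\<^sup>2 = (norm x)\<^sup>2 * ((H \<omega>)\<^sup>2 * (q - L \<omega>)\<^sup>2) - 2 * (x \<bullet> d) * ((H \<omega>)\<^sup>2 * (q - L \<omega>)) + (norm d)\<^sup>2 * (H \<omega>)\<^sup>2" for \<omega>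
  proof -
    have nt: "(norm (t *\<^sub>R x - d))\<^sup>2 = t\<^sup>2 * (norm x)\<^sup>2 - 2 * (t * (x \<bullet> d)) + (norm d)\<^sup>2" for t
      unfolding power2_norm_eq_inner by (simp only: inner_diff_left inner_diff_right inner_scaleR_left inner_scaleR_right inner_commute[of d x]) (simp add: power2_eq_square algebra_simps)
    show ?thesis unfolding nt by (simp add: algebra_simps)
  qed
  have "expectation (\<lambda>\<omega>. (H \<omega>)\<^sup>2 * (norm ((q - L \<omega>) *\<^sub>R x - d))\<^sup>2)
     = (norm x)\<^sup>2 * expectation (\<lambda>\<omega>. (H \<omega>)\<^sup>2 * (q - L \<omega>)\<^sup>2) - 2 * (x \<bullet> d) * expectation (\<lambda>\<omega>. (H \<omega>)\<^sup>2 * (q - L \<omega>)) + (norm d)\<^sup>2 * expectation (\<lambda>\<omega>. (H \<omega>)\<^sup>2)"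
    unfolding eq using iu iu2 iH2 by simp
  moreover have "expectation (\<lambda>\<omega>. (H \<omega>)\<^sup>2 * (norm ((q - L \<omega>) *\<^sub>R x))\<^sup>2) = (norm x)\<^sup>2 * expectation (\<lambda>\<omega>. (H \<omega>)\<^sup>2 * (q - L \<omega>)\<^sup>2)"
    unfolding Bochner_Integration.integral_mult_right_zero[symmetric]
    by (intro Bochner_Integration.integral_cong refl) (simp add: power_mult_distrib)
  ultimately show ?thesis using main by simp
qed

section \<open>Oscillation of a negative power, with constants proportional to the exponent\<close>

lemma powr_neg_lipschitz:
  fixes \<epsilon> r t D :: real
  assumes \<epsilon>: "0 < \<epsilon>" "\<epsilon> \<le> 1" and r: "0 \<le> r" "0 \<le> t" and D: "\<bar>r - t\<bar> \<le> D"
  shows "\<bar>(1 + r) powr (- \<epsilon>) - (1 + t) powr (- \<epsilon>)\<bar> \<le> \<epsilon> * (1 + t) powr (- 1 - \<epsilon>) * (1 + D) ^ 3"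
proof -
  have D0: "D \<ge> 0" using D by linarith
  \<comment> \<open>Moves the derivative from an intermediate point \<open>z\<close> to the
    reference point \<open>t\<close>. Since \<open>1 + t \<le> (1 + z) * (1 + D)\<close> and
    \<open>\<epsilon> \<le> 1\<close>, this costs two powers of \<open>1 + D\<close>; the length of
    the interval costs the third.\<close>
  have low: "(1 + z) powr (- 1 - \<epsilon>) \<le> (1 + t) powr (- 1 - \<epsilon>) * (1 + D)\<^sup>2" if "z \<ge> 0" "t \<le> z + D" for z
  proof -
    have "1 + t \<le> 1 + z + D" using that by simp
    also have "\<dots> \<le> (1 + z) * (1 + D)" using that D0 by (simp add: algebra_simps)
    finally have "1 + t \<le> (1 + z) * (1 + D)" .
    then have "((1 + z) * (1 + D)) powr (- 1 - \<epsilon>) \<le> (1 + t) powr (- 1 - \<epsilon>)"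
      using r \<epsilon> by (intro powr_mono2') auto
    then have "(1 + z) powr (- 1 - \<epsilon>) * (1 + D) powr (- 1 - \<epsilon>) \<le> (1 + t) powr (- 1 - \<epsilon>)"
      by (simp only: powr_mult)
    then have "(1 + z) powr (- 1 - \<epsilon>) * (1 + D) powr (- 1 - \<epsilon>) * (1 + D) powr (1 + \<epsilon>) \<le> (1 + t) powr (- 1 - \<epsilon>) * (1 + D) powr (1 + \<epsilon>)"
      by (rule mult_right_mono) simp
    also have "(1 + z) powr (- 1 - \<epsilon>) * (1 + D) powr (- 1 - \<epsilon>) * (1 + D) powr (1 + \<epsilon>) = (1 + z) powr (- 1 - \<epsilon>)"
    proof -
      have "(1 + D) powr (- 1 - \<epsilon>) * (1 + D) powr (1 + \<epsilon>) = 1" using D0 by (simp add: powr_add[symmetric])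
      then show ?thesis by (simp only: mult.assoc mult_1_right)
    qed
    also have "(1 + t) powr (- 1 - \<epsilon>) * (1 + D) powr (1 + \<epsilon>) \<le> (1 + t) powr (- 1 - \<epsilon>) * (1 + D) powr 2"
      using \<epsilon> D0 by (intro mult_left_mono powr_mono) auto
    finally show ?thesis using D0 by simp
  qed
  have der: "((\<lambda>z. (1 + z) powr (- \<epsilon>)) has_real_derivative - \<epsilon> * (1 + z) powr (- 1 - \<epsilon>)) (at z)" if "z \<ge> 0" for z
    using that by (auto intro!: derivative_eq_intros simp: minus_diff_commute)
  have step: "\<bar>(1 + v) powr (- \<epsilon>) - (1 + u) powr (- \<epsilon>)\<bar> \<le> \<epsilon> * (1 + t) powr (- 1 - \<epsilon>) * (1 + D) ^ 3"
    if uv: "0 \<le> u" "u < v" "v - u \<le> D" and tz: "\<And>z. u \<le> z \<Longrightarrow> t \<le> z + D" for u v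
  proof -
    obtain z where z: "u < z" "z < v" "(1 + v) powr (- \<epsilon>) - (1 + u) powr (- \<epsilon>) = (v - u) * (- \<epsilon> * (1 + z) powr (- 1 - \<epsilon>))"
      using MVT2[OF uv(2), of "\<lambda>z. (1 + z) powr (- \<epsilon>)" "\<lambda>z. - \<epsilon> * (1 + z) powr (- 1 - \<epsilon>)"] der uv by force
    have "\<bar>(1 + v) powr (- \<epsilon>) - (1 + u) powr (- \<epsilon>)\<bar> = \<epsilon> * ((v - u) * (1 + z) powr (- 1 - \<epsilon>))"
      unfolding z(3) using uv \<epsilon> by (simp add: abs_mult)
    also have "\<dots> \<le> \<epsilon> * ((1 + D) * ((1 + t) powr (- 1 - \<epsilon>) * (1 + D)\<^sup>2))"
      using z uv \<epsilon> D0 tz[of z] by (intro mult_left_mono mult_mono low) auto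
    finally show ?thesis by (simp add: power3_eq_cube power2_eq_square mult_ac)
  qed
  consider "r = t" | "r < t" | "t < r" by linarith
  then show ?thesis
  proof cases
    case 1
    then show ?thesis using \<epsilon> D0 by simp
  next
    case 2
    then show ?thesis using step[of r t] r D by (auto simp: abs_minus_commute)
  next
    case 3
    then show ?thesis using step[of t r] r D D0 by auto
  qed
qed

text \<open>The power 6 is the square of the cubic factor in the Lipschitz bound. The exponential
  rate may be arbitrarily small, which is what makes the resulting posterior moments finite.\<close>

lemma power_le_exp:
  assumes "0 < \<tau>" "\<tau> \<le> 6" "D \<ge> 0"
  shows "(1 + D) ^ 6 \<le> (6 / \<tau>) ^ 6 * exp (\<tau> * D :: real)"
proof -
  have "\<tau> / 6 * (1 + D) \<le> 1 + \<tau> * D / 6" using assms by (simp add: algebra_simps)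
  also have "\<dots> \<le> exp (\<tau> * D / 6)" by (rule exp_ge_add_one_self)
  finally have "1 + D \<le> 6 / \<tau> * exp (\<tau> * D / 6)" using assms by (simp add: field_simps)
  then have "(1 + D) ^ 6 \<le> (6 / \<tau> * exp (\<tau> * D / 6)) ^ 6" using assms by (intro power_mono) auto
  also have "\<dots> = (6 / \<tau>) ^ 6 * exp (\<tau> * D)"
    by (simp only: power_mult_distrib exp_of_nat_mult[symmetric]) simp
  finally show ?thesis .
qed

text \<open>Exchanges the absolute logarithm for two powers, whose posterior moments are
  explicit.\<close>

lemma exp_abs_ln_le:
  fixes v \<tau> :: real
  assumes v: "v > 0"
  shows "exp (\<tau> * \<bar>ln v\<bar>) \<le> v powr \<tau> + v powr (- \<tau>)"
proof -
  have "exp (\<tau> * \<bar>ln v\<bar>) = v powr \<tau> \<or> exp (\<tau> * \<bar>ln v\<bar>) = v powr (- \<tau>)"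
    using v by (cases "ln v \<ge> 0") (auto simp: powr_def)
  then show ?thesis by auto
qed

section \<open>Polar coordinates and the total energy of the cutoff\<close>

lemma nn_integral_norm:
  fixes f :: "real \<Rightarrow> ennreal"
  assumes [measurable]: "f \<in> borel_measurable borel"
  shows "(\<integral>\<^sup>+x. f (norm x) \<partial>(lborel :: ('a :: euclidean_space) measure))
    = (\<integral>\<^sup>+r. f r * (ennreal (DIM('a) * unit_ball_vol DIM('a) * r ^ (DIM('a) - 1)) * indicator {0..} r) \<partial>lborel)"
proof -
  define d where "d = (\<lambda>r :: real. ennreal (DIM('a) * unit_ball_vol DIM('a) * r ^ (DIM('a) - 1)) * indicator {0..} r)"
  have [measurable]: "d \<in> borel_measurable borel" unfolding d_def by measurable
  have D: "DIM('a) > 0" by simp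
  have em: "emeasure (distr (lborel :: 'a measure) borel norm) {..r} = ennreal (if r < 0 then 0 else unit_ball_vol DIM('a) * r ^ DIM('a))" for r
  proof -
    have "emeasure (distr (lborel :: 'a measure) borel norm) {..r} = emeasure lborel (cball (0 :: 'a) r)"
      by (subst emeasure_distr) (auto intro!: arg_cong2[where f=emeasure] simp: cball_def)
    also have "\<dots> = ennreal (if r < 0 then 0 else unit_ball_vol DIM('a) * r ^ DIM('a))"
      by (auto simp: emeasure_cball)
    finally show ?thesis .
  qed
  \<comment> \<open>The law of the norm is identified on half-lines, where it is the volume of a
    ball, instead of by a change of variables on the sphere.\<close>
  have "distr (lborel :: 'a measure) borel norm = density lborel d"
  proof (rule measure_eqI_generator_eq[where E = "range (\<lambda>a. {..a})" and \<Omega> = UNIV and A = "\<lambda>n. {..real n}"])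
    show "Int_stable (range (\<lambda>a :: real. {..a}))" by (auto simp: Int_stable_def)
    show "sets (distr (lborel :: 'a measure) borel norm) = sigma_sets UNIV (range (\<lambda>a :: real. {..a}))"
      by (simp add: borel_eq_atMost[where 'a=real])
    show "sets (density lborel d) = sigma_sets UNIV (range (\<lambda>a :: real. {..a}))"
      by (simp add: borel_eq_atMost[where 'a=real])
    show "(\<Union>i. {..real i}) = UNIV" by (auto intro: real_arch_simple)
    show "emeasure (distr (lborel :: 'a measure) borel norm) {..real i} \<noteq> \<infinity>" for i by (simp add: em)
    fix X assume "X \<in> range (\<lambda>a :: real. {..a})"
    then obtain r where X: "X = {..r}" by auto
    have "emeasure (density lborel d) {..r} = (\<integral>\<^sup>+x. d x * indicator {..r} x \<partial>lborel)"
      by (rule emeasure_density) auto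
    also have "\<dots> = (\<integral>\<^sup>+x. ennreal (DIM('a) * unit_ball_vol DIM('a) * x ^ (DIM('a) - 1)) * indicator {0..r} x \<partial>lborel)"
      by (intro nn_integral_cong) (auto simp: d_def split: split_indicator)
    also have "\<dots> = ennreal (if r < 0 then 0 else unit_ball_vol DIM('a) * r ^ DIM('a))"
    proof (cases "r < 0")
      case False
      have "(\<integral>\<^sup>+x. ennreal (DIM('a) * unit_ball_vol DIM('a) * x ^ (DIM('a) - 1)) * indicator {0..r} x \<partial>lborel)
        = ennreal (unit_ball_vol DIM('a) * r ^ DIM('a) - unit_ball_vol DIM('a) * 0 ^ DIM('a))"
      proof (rule nn_integral_FTC_Icc)
        show "((\<lambda>x. unit_ball_vol DIM('a) * x ^ DIM('a)) has_real_derivative DIM('a) * unit_ball_vol DIM('a) * x ^ (DIM('a) - 1)) (at x)" for x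
          by (auto intro!: derivative_eq_intros)
      qed (use False in auto)
      then show ?thesis using False D by simp
    qed auto
    finally show "emeasure (distr (lborel :: 'a measure) borel norm) X = emeasure (density lborel d) X"
      unfolding X em ..
  qed auto
  moreover have "(\<integral>\<^sup>+x. f (norm x) \<partial>(lborel :: 'a measure)) = (\<integral>\<^sup>+r. f r \<partial>distr (lborel :: 'a measure) borel norm)"
    by (rule nn_integral_distr[symmetric]) auto
  ultimately have "(\<integral>\<^sup>+x. f (norm x) \<partial>(lborel :: 'a measure)) = (\<integral>\<^sup>+r. f r \<partial>density lborel d)" by simp
  also have "\<dots> = (\<integral>\<^sup>+r. d r * f r \<partial>lborel)" by (rule nn_integral_density) auto
  finally show ?thesis by (simp add: d_def mult.commute)
qed

text \<open>In the variable \<open>ln s\<close> this is twice the integral of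
  \<open>(A + t) powr (- 2 - 2 * \<epsilon>)\<close> over positive \<open>t\<close>; one
  antiderivative is used on each side of \<open>s = 1\<close>.\<close>

lemma nn_integral_abs_ln:
  assumes A: "A \<ge> 1" and \<epsilon>: "\<epsilon> > 0"
  shows "(\<integral>\<^sup>+s. ennreal ((A + \<bar>ln s\<bar>) powr (- 2 - 2 * \<epsilon>) / s) \<partial>pos_lborel) \<le> ennreal (2 * A powr (- 1 - 2 * \<epsilon>))"
proof -
  define k where "k = 1 + 2 * \<epsilon>"
  have k: "k > 1" using \<epsilon> by (simp add: k_def)
  have ek: "- 2 - 2 * \<epsilon> = - 1 - k" "- 1 - 2 * \<epsilon> = - k" by (simp_all add: k_def)
  have up: "(\<integral>\<^sup>+s. ennreal ((A + ln s) powr (- 1 - k) / s) * indicator {1..} s \<partial>lborel) = ennreal (A powr (- k) / k)"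
  proof -
    have "(\<integral>\<^sup>+s. ennreal ((A + ln s) powr (- 1 - k) / s) * indicator {1..} s \<partial>lborel) = ennreal (0 - (- ((A + ln 1) powr (- k) / k)))"
    proof (rule nn_integral_FTC_atLeast)
      show "((\<lambda>s. - ((A + ln s) powr (- k) / k)) \<longlongrightarrow> 0) at_top" using k by real_asymp
      fix s :: real assume s: "1 \<le> s"
      then have "A + ln s > 0" using A by (simp add: add_pos_nonneg)
      then have "((\<lambda>s. (A + ln s) powr (- k)) has_real_derivative - k * ((A + ln s) powr (- 1 - k) / s)) (at s)"
        using s by (auto intro!: derivative_eq_intros simp: minus_diff_commute)
      from DERIV_minus[OF DERIV_cdivide[OF this, of k]]
      show "((\<lambda>s. - ((A + ln s) powr (- k) / k)) has_real_derivative (A + ln s) powr (- 1 - k) / s) (at s)"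
        using k by simp
    qed auto
    then show ?thesis by simp
  qed
  have down: "(\<integral>\<^sup>+s. ennreal ((A - ln s) powr (- 1 - k) / s) * indicator {0..1} s \<partial>lborel) = ennreal (A powr (- k) / k)"
  proof -
    \<comment> \<open>The value 0 for \<open>s \<le> 0\<close> is the limit of the antiderivative at
      0 from the right. It makes \<open>F\<close> continuous on the closed interval, although the
      integrand is singular at the endpoint.\<close>
    define F where "F = (\<lambda>s. if s \<le> 0 then 0 else (A - ln s) powr (- k) / k)"
    have der: "(F has_real_derivative (A - ln s) powr (- 1 - k) / s) (at s)" if s: "0 < s" "s \<le> 1" for s
    proof -
      have "A - ln s > 0" using A s by (smt (verit) ln_le_zero_iff)
      then have "((\<lambda>s. (A - ln s) powr (- k)) has_real_derivative k * ((A - ln s) powr (- 1 - k) / s)) (at s)"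
        using s by (auto intro!: derivative_eq_intros simp: minus_diff_commute)
      from DERIV_cdivide[OF this, of k]
      have "((\<lambda>s. (A - ln s) powr (- k) / k) has_real_derivative (A - ln s) powr (- 1 - k) / s) (at s)" using k by simp
      moreover have "\<forall>\<^sub>F t in nhds s. (A - ln t) powr (- k) / k = F t"
        using s eventually_nhds_in_open[of "{0<..}" s] by (auto elim!: eventually_mono simp: F_def)
      ultimately show ?thesis using s by (subst DERIV_cong_ev[OF refl _ refl, symmetric]) auto
    qed
    have "((\<lambda>s. (A - ln s) powr (- 1 - k) / s) has_integral (F 1 - F 0)) {0..1}"
    proof (rule fundamental_theorem_of_calculus_interior)
      show "continuous_on {0..1} F"
      proof (rule continuous_at_imp_continuous_on, intro ballI)
        fix s :: real assume s: "s \<in> {0..1}"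
        show "isCont F s"
        proof (cases "s = 0")
          case False
          then show ?thesis using der[of s] s by (auto intro: DERIV_isCont)
        next
          case True
          have "(F \<longlongrightarrow> 0) (at_right 0)"
          proof (rule Lim_transform_eventually)
            show "((\<lambda>s. (A - ln s) powr (- k) / k) \<longlongrightarrow> 0) (at_right 0)" using k by real_asymp
            show "\<forall>\<^sub>F s in at_right 0. (A - ln s) powr (- k) / k = F s"
              by (auto simp: F_def eventually_at_filter)
          qed
          moreover have "(F \<longlongrightarrow> 0) (at_left 0)"
            by (rule Lim_transform_eventually[OF tendsto_const]) (auto simp: F_def eventually_at_filter)
          ultimately show ?thesis unfolding True isCont_def
            by (simp add: F_def filterlim_split_at)
        qed
      qed
      show "(F has_vector_derivative (A - ln s) powr (- 1 - k) / s) (at s)" if "s \<in> {0<..<1}" for s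
        using der[of s] that by (simp add: has_real_derivative_iff_has_vector_derivative)
    qed auto
    then have "((\<lambda>s. (A - ln s) powr (- 1 - k) / s) has_integral (A powr (- k) / k)) {0..1}"
      by (simp add: F_def)
    from nn_integral_has_integral_lebesgue'[OF _ this] show ?thesis by auto
  qed
  have "(\<integral>\<^sup>+s. ennreal ((A + \<bar>ln s\<bar>) powr (- 1 - k) / s) \<partial>pos_lborel)
    \<le> (\<integral>\<^sup>+s. ennreal ((A + ln s) powr (- 1 - k) / s) * indicator {1..} s + ennreal ((A - ln s) powr (- 1 - k) / s) * indicator {0..1} s \<partial>lborel)"
    unfolding nn_integral_pos_lborel by (intro nn_integral_mono) (auto split: split_indicator simp: abs_if)
  also have "\<dots> = ennreal (A powr (- k) / k) + ennreal (A powr (- k) / k)"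
    by (subst nn_integral_add) (auto simp: up down)
  also have "\<dots> = ennreal (2 * (A powr (- k) / k))"
    using k by (subst ennreal_plus[symmetric]) auto
  also have "\<dots> \<le> ennreal (2 * A powr (- k))"
    using k by (intro ennreal_leI) (simp add: divide_le_eq mult_le_cancel_left1)
  finally show ?thesis unfolding ek .
qed

text \<open>In polar coordinates the powers reduce to at most \<open>r / (1 + r\<^sup>2)\<close>,
  half the derivative of \<open>ln (1 + r\<^sup>2)\<close>. What is left is a logarithmic integral
  that converges only through the exponent \<open>2 * \<epsilon>\<close>, hence the factor
  \<open>1 / \<epsilon>\<close>.\<close>

lemma nn_integral_log_tail:
  assumes \<epsilon>: "\<epsilon> > 0" and D: "DIM('a :: euclidean_space) \<ge> 2"
  shows "(\<integral>\<^sup>+x. ennreal ((1 + (norm x)\<^sup>2) powr (- real DIM('a) / 2) * (1 + ln (1 + (norm x)\<^sup>2)) powr (- 1 - 2 * \<epsilon>)) \<partial>(lborel :: 'a measure))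
     \<le> ennreal (real DIM('a) * unit_ball_vol (real DIM('a)) / (4 * \<epsilon>))"
proof -
  define V where "V = real DIM('a) * unit_ball_vol (real DIM('a))"
  have V: "V \<ge> 0" by (simp add: V_def)
  define f where "f = (\<lambda>r :: real. (1 + r\<^sup>2) powr (- real DIM('a) / 2) * (1 + ln (1 + r\<^sup>2)) powr (- 1 - 2 * \<epsilon>))"
  define g where "g = (\<lambda>r :: real. r / (1 + r\<^sup>2) * (1 + ln (1 + r\<^sup>2)) powr (- 1 - 2 * \<epsilon>))"
  have [measurable]: "f \<in> borel_measurable borel" unfolding f_def by measurable
  have "(\<integral>\<^sup>+x. ennreal (f (norm x)) \<partial>(lborel :: 'a measure)) = (\<integral>\<^sup>+r. ennreal (f r) * (ennreal (V * r ^ (DIM('a) - 1)) * indicator {0..} r) \<partial>lborel)"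
    unfolding V_def by (rule nn_integral_norm) simp
  also have "\<dots> \<le> (\<integral>\<^sup>+r. ennreal V * (ennreal (g r) * indicator {0..} r) \<partial>lborel)"
  proof (intro nn_integral_mono)
    fix r :: real
    show "ennreal (f r) * (ennreal (V * r ^ (DIM('a) - 1)) * indicator {0..} r) \<le> ennreal V * (ennreal (g r) * indicator {0..} r)"
    proof (cases "r \<ge> 0")
      case r: True
      have r1: "1 + r\<^sup>2 > 0" by (simp add: add_pos_nonneg)
      have "r ^ (DIM('a) - 2) \<le> (1 + r\<^sup>2) powr (real (DIM('a) - 2) / 2)"
      proof -
        have "r \<le> sqrt (1 + r\<^sup>2)" using r by (intro real_le_rsqrt) auto
        then have "r ^ (DIM('a) - 2) \<le> sqrt (1 + r\<^sup>2) ^ (DIM('a) - 2)" using r by (intro power_mono) auto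
        also have "\<dots> = (1 + r\<^sup>2) powr (real (DIM('a) - 2) / 2)"
          using r1 by (simp add: powr_half_sqrt[symmetric] powr_realpow[symmetric] powr_powr)
        finally show ?thesis .
      qed
      then have "r ^ (DIM('a) - 2) * (1 + r\<^sup>2) powr (- real DIM('a) / 2) \<le> (1 + r\<^sup>2) powr (real (DIM('a) - 2) / 2) * (1 + r\<^sup>2) powr (- real DIM('a) / 2)"
        by (rule mult_right_mono) simp
      also have "\<dots> = 1 / (1 + r\<^sup>2)"
      proof -
        have "real (DIM('a) - 2) / 2 + - real DIM('a) / 2 = - 1" using D by (simp add: of_nat_diff diff_divide_distrib)
        then show ?thesis using r1 by (simp only: powr_add[symmetric]) (simp add: powr_minus_divide)
      qed
      finally have "r * (r ^ (DIM('a) - 2) * (1 + r\<^sup>2) powr (- real DIM('a) / 2)) \<le> r * (1 / (1 + r\<^sup>2))"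
        using r by (rule mult_left_mono)
      moreover have "r ^ (DIM('a) - 1) = r * r ^ (DIM('a) - 2)"
        using D by (metis Suc_1 Suc_diff_Suc Suc_le_lessD power_Suc)
      ultimately have "r ^ (DIM('a) - 1) * (1 + r\<^sup>2) powr (- real DIM('a) / 2) \<le> r / (1 + r\<^sup>2)" by simp
      then have "f r * r ^ (DIM('a) - 1) \<le> g r"
        unfolding f_def g_def using mult_right_mono[of "r ^ (DIM('a) - 1) * (1 + r\<^sup>2) powr (- real DIM('a) / 2)" "r / (1 + r\<^sup>2)" "(1 + ln (1 + r\<^sup>2)) powr (- 1 - 2 * \<epsilon>)"]
        by (simp add: mult_ac)
      then have "V * (f r * r ^ (DIM('a) - 1)) \<le> V * g r" using V by (rule mult_left_mono)
      moreover have "f r \<ge> 0" "g r \<ge> 0" using r by (auto simp: f_def g_def)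
      ultimately show ?thesis using r V by (simp add: ennreal_mult[symmetric] mult_ac ennreal_leI)
    qed auto
  qed
  also have "\<dots> = ennreal V * (\<integral>\<^sup>+r. ennreal (g r) * indicator {0..} r \<partial>lborel)"
    by (rule nn_integral_cmult) (simp add: g_def)
  also have "(\<integral>\<^sup>+r. ennreal (g r) * indicator {0..} r \<partial>lborel) = ennreal (0 - (- ((1 + ln (1 + 0\<^sup>2)) powr (- (2 * \<epsilon>)) / (4 * \<epsilon>))))"
  proof (rule nn_integral_FTC_atLeast)
    show "g \<in> borel_measurable borel" unfolding g_def by measurable
    show "((\<lambda>r. - ((1 + ln (1 + r\<^sup>2)) powr (- (2 * \<epsilon>)) / (4 * \<epsilon>))) \<longlongrightarrow> 0) at_top" using \<epsilon> by real_asymp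
    fix r :: real assume r: "0 \<le> r"
    show "0 \<le> g r" using r by (simp add: g_def)
    have pos: "1 + r\<^sup>2 > 0" "1 + ln (1 + r\<^sup>2) > 0" by (auto simp: add_pos_nonneg)
    have "((\<lambda>r. (1 + ln (1 + r\<^sup>2)) powr (- (2 * \<epsilon>))) has_real_derivative (- (4 * \<epsilon>)) * g r) (at r)"
    proof -
      have "((\<lambda>y. y powr (- (2 * \<epsilon>))) has_real_derivative - (2 * \<epsilon>) * (1 + ln (1 + r\<^sup>2)) powr (- 1 - 2 * \<epsilon>)) (at (1 + ln (1 + r\<^sup>2)))"
        using pos by (auto intro!: derivative_eq_intros simp: minus_diff_commute)
      moreover have "((\<lambda>r. 1 + ln (1 + r\<^sup>2)) has_real_derivative 2 * r / (1 + r\<^sup>2)) (at r)"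
        using pos by (auto intro!: derivative_eq_intros)
      ultimately have "((\<lambda>r. (1 + ln (1 + r\<^sup>2)) powr (- (2 * \<epsilon>))) has_real_derivative
          (- (2 * \<epsilon>) * (1 + ln (1 + r\<^sup>2)) powr (- 1 - 2 * \<epsilon>)) * (2 * r / (1 + r\<^sup>2))) (at r)"
        by (rule DERIV_chain2)
      then show ?thesis by (simp add: g_def mult_ac)
    qed
    from DERIV_minus[OF DERIV_cdivide[OF this, of "4 * \<epsilon>"]]
    show "((\<lambda>r. - ((1 + ln (1 + r\<^sup>2)) powr (- (2 * \<epsilon>)) / (4 * \<epsilon>))) has_real_derivative g r) (at r)" using \<epsilon> by simp
  qed
  finally have "(\<integral>\<^sup>+x. ennreal (f (norm x)) \<partial>(lborel :: 'a measure)) \<le> ennreal V * ennreal (1 / (4 * \<epsilon>))" by simp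
  also have "\<dots> = ennreal (V / (4 * \<epsilon>))" using V \<epsilon> by (subst ennreal_mult[symmetric]) auto
  finally show ?thesis unfolding f_def V_def .
qed

lemma nn_integral_lborel_scaleR:
  fixes f :: "'a :: euclidean_space \<Rightarrow> ennreal"
  assumes c: "c > 0" and [measurable]: "f \<in> borel_measurable borel"
  shows "(\<integral>\<^sup>+x. f x \<partial>lborel) = ennreal (c ^ DIM('a)) * (\<integral>\<^sup>+x. f (c *\<^sub>R x) \<partial>lborel)"
proof -
  have "(\<integral>\<^sup>+x. f x \<partial>lborel) = (\<integral>\<^sup>+x. f x \<partial>density (distr lborel borel (\<lambda>x. 0 + c *\<^sub>R x)) (\<lambda>_. ennreal (\<bar>c\<bar> ^ DIM('a))))"
    using lborel_affine[of c "0 :: 'a"] c by simp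
  also have "\<dots> = ennreal (c ^ DIM('a)) * (\<integral>\<^sup>+x. f (c *\<^sub>R x) \<partial>lborel)"
    using c by (subst nn_integral_density) (auto simp: nn_integral_distr nn_integral_cmult)
  finally show ?thesis .
qed

text \<open>With \<open>x = sqrt s *\<^sub>R y\<close> the Jacobian turns
  \<open>s powr (- p / 2 - 1)\<close> into \<open>1 / s\<close>, so that \<open>ln s\<close> and
  \<open>ln (1 + (norm y)\<^sup>2)\<close> become the two coordinates of the plane. Integrating over
  \<open>s\<close> first lowers the exponent by one; the remaining integral is of order
  \<open>1 / \<epsilon>\<close>, and the prefactor \<open>\<epsilon>\<^sup>2\<close> leaves order
  \<epsilon>.\<close>

lemma nn_integral_energy:
  assumes \<epsilon>: "\<epsilon> > 0" and D: "CARD('p) \<ge> 2"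
  shows "(\<integral>\<^sup>+u. ennreal (\<epsilon>\<^sup>2 * (1 + \<bar>ln (snd u)\<bar> + ln (1 + (norm (fst u))\<^sup>2 / snd u)) powr (- 2 - 2 * \<epsilon>)
            * (snd u powr (- real CARD('p) / 2 - 1) * (1 + (norm (fst u))\<^sup>2 / snd u) powr (- real CARD('p) / 2)))
          \<partial>(lborel \<Otimes>\<^sub>M pos_lborel :: ((real ^ 'p) \<times> real) measure))
     \<le> ennreal (real CARD('p) * unit_ball_vol (real CARD('p)) / 2 * \<epsilon>)"
proof -
  define p where "p = real CARD('p)"
  define f where "f = (\<lambda>(t :: real) (s :: real). \<epsilon>\<^sup>2 * (1 + \<bar>ln s\<bar> + ln (1 + t)) powr (- 2 - 2 * \<epsilon>) * (1 + t) powr (- p / 2))"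
  have [measurable]: "(\<lambda>z. f (g z) (h z)) \<in> borel_measurable M" if [measurable]: "g \<in> borel_measurable M" "h \<in> borel_measurable M" for g h and M :: "'z measure"
    unfolding f_def by measurable
  have f0: "f t s \<ge> 0" for t s by (simp add: f_def)
  have "(\<integral>\<^sup>+u. ennreal (\<epsilon>\<^sup>2 * (1 + \<bar>ln (snd u)\<bar> + ln (1 + (norm (fst u))\<^sup>2 / snd u)) powr (- 2 - 2 * \<epsilon>)
            * (snd u powr (- p / 2 - 1) * (1 + (norm (fst u))\<^sup>2 / snd u) powr (- p / 2)))
          \<partial>(lborel \<Otimes>\<^sub>M pos_lborel :: ((real ^ 'p) \<times> real) measure))
     = (\<integral>\<^sup>+u. ennreal (snd u powr (- p / 2 - 1) * f ((norm (fst u))\<^sup>2 / snd u) (snd u)) \<partial>(lborel \<Otimes>\<^sub>M pos_lborel :: ((real ^ 'p) \<times> real) measure))"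
    unfolding f_def by (simp add: mult_ac)
  also have "\<dots> = (\<integral>\<^sup>+s. \<integral>\<^sup>+(x :: real ^ 'p). ennreal (s powr (- p / 2 - 1) * f ((norm x)\<^sup>2 / s) s) \<partial>lborel \<partial>pos_lborel)"
    by (subst sample.nn_integral_snd[symmetric]) (auto simp: f_def)
  also have "\<dots> = (\<integral>\<^sup>+s. \<integral>\<^sup>+(y :: real ^ 'p). ennreal (f ((norm y)\<^sup>2) s / s) \<partial>lborel \<partial>pos_lborel)"
  proof (rule nn_integral_cong)
    fix s assume "s \<in> space pos_lborel"
    then have s: "s > 0" by simp
    have "(\<integral>\<^sup>+(x :: real ^ 'p). ennreal (s powr (- p / 2 - 1) * f ((norm x)\<^sup>2 / s) s) \<partial>lborel)
       = ennreal (sqrt s ^ CARD('p)) * (\<integral>\<^sup>+(y :: real ^ 'p). ennreal (s powr (- p / 2 - 1) * f ((norm (sqrt s *\<^sub>R y))\<^sup>2 / s) s) \<partial>lborel)"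
      using nn_integral_lborel_scaleR[of "sqrt s" "\<lambda>x :: real ^ 'p. ennreal (s powr (- p / 2 - 1) * f ((norm x)\<^sup>2 / s) s)"] s by (simp add: f_def)
    also have "\<dots> = (\<integral>\<^sup>+(y :: real ^ 'p). ennreal (sqrt s ^ CARD('p)) * ennreal (s powr (- p / 2 - 1) * f ((norm (sqrt s *\<^sub>R y))\<^sup>2 / s) s) \<partial>lborel)"
      by (rule nn_integral_cmult[symmetric]) (simp add: f_def)
    also have "\<dots> = (\<integral>\<^sup>+(y :: real ^ 'p). ennreal (f ((norm y)\<^sup>2) s / s) \<partial>lborel)"
    proof (intro nn_integral_cong)
      fix y :: "real ^ 'p"
      have 1: "(norm (sqrt s *\<^sub>R y))\<^sup>2 / s = (norm y)\<^sup>2" using s by (simp add: power_mult_distrib)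
      have "sqrt s ^ CARD('p) = s powr (p / 2)"
        using s by (simp add: powr_half_sqrt[symmetric] powr_realpow[symmetric] powr_powr p_def)
      then have "sqrt s ^ CARD('p) * s powr (- p / 2 - 1) = s powr (- 1)" by (simp add: powr_add[symmetric])
      then have 2: "sqrt s ^ CARD('p) * s powr (- p / 2 - 1) = 1 / s" using s by (simp add: powr_minus_divide)
      have "sqrt s ^ CARD('p) * (s powr (- p / 2 - 1) * f ((norm (sqrt s *\<^sub>R y))\<^sup>2 / s) s) = f ((norm y)\<^sup>2) s / s"
        unfolding 1 mult.assoc[symmetric] 2 by simp
      then show "ennreal (sqrt s ^ CARD('p)) * ennreal (s powr (- p / 2 - 1) * f ((norm (sqrt s *\<^sub>R y))\<^sup>2 / s) s) = ennreal (f ((norm y)\<^sup>2) s / s)"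
        using s f0 by (simp add: ennreal_mult[symmetric])
    qed
    finally show "(\<integral>\<^sup>+(x :: real ^ 'p). ennreal (s powr (- p / 2 - 1) * f ((norm x)\<^sup>2 / s) s) \<partial>lborel) = (\<integral>\<^sup>+(y :: real ^ 'p). ennreal (f ((norm y)\<^sup>2) s / s) \<partial>lborel)" .
  qed
  also have "\<dots> = (\<integral>\<^sup>+(y :: real ^ 'p). \<integral>\<^sup>+s. ennreal (f ((norm y)\<^sup>2) s / s) \<partial>pos_lborel \<partial>lborel)"
    by (rule sample.Fubini') (simp add: f_def)
  also have "\<dots> \<le> (\<integral>\<^sup>+(y :: real ^ 'p). ennreal (2 * \<epsilon>\<^sup>2) * ennreal ((1 + (norm y)\<^sup>2) powr (- p / 2) * (1 + ln (1 + (norm y)\<^sup>2)) powr (- 1 - 2 * \<epsilon>)) \<partial>lborel)"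
  proof (intro nn_integral_mono)
    fix y :: "real ^ 'p"
    define A where "A = 1 + ln (1 + (norm y)\<^sup>2)"
    define q where "q = \<epsilon>\<^sup>2 * (1 + (norm y)\<^sup>2) powr (- p / 2)"
    have A: "A \<ge> 1" by (simp add: A_def)
    have q: "q \<ge> 0" by (simp add: q_def)
    have "(\<integral>\<^sup>+s. ennreal (f ((norm y)\<^sup>2) s / s) \<partial>pos_lborel) = (\<integral>\<^sup>+s. ennreal q * ennreal ((A + \<bar>ln s\<bar>) powr (- 2 - 2 * \<epsilon>) / s) \<partial>pos_lborel)"
      using q by (intro nn_integral_cong) (auto simp: f_def q_def A_def ennreal_mult[symmetric] algebra_simps)
    also have "\<dots> = ennreal q * (\<integral>\<^sup>+s. ennreal ((A + \<bar>ln s\<bar>) powr (- 2 - 2 * \<epsilon>) / s) \<partial>pos_lborel)"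
      by (rule nn_integral_cmult) measurable
    also have "\<dots> \<le> ennreal q * ennreal (2 * A powr (- 1 - 2 * \<epsilon>))"
      by (intro mult_left_mono nn_integral_abs_ln A \<epsilon>) simp
    also have "\<dots> = ennreal (2 * \<epsilon>\<^sup>2) * ennreal ((1 + (norm y)\<^sup>2) powr (- p / 2) * A powr (- 1 - 2 * \<epsilon>))"
      using q by (simp add: ennreal_mult[symmetric] q_def mult_ac)
    finally show "(\<integral>\<^sup>+s. ennreal (f ((norm y)\<^sup>2) s / s) \<partial>pos_lborel) \<le> ennreal (2 * \<epsilon>\<^sup>2) * ennreal ((1 + (norm y)\<^sup>2) powr (- p / 2) * (1 + ln (1 + (norm y)\<^sup>2)) powr (- 1 - 2 * \<epsilon>))"
      unfolding A_def .
  qed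
  also have "\<dots> = ennreal (2 * \<epsilon>\<^sup>2) * (\<integral>\<^sup>+(y :: real ^ 'p). ennreal ((1 + (norm y)\<^sup>2) powr (- p / 2) * (1 + ln (1 + (norm y)\<^sup>2)) powr (- 1 - 2 * \<epsilon>)) \<partial>lborel)"
    by (rule nn_integral_cmult) measurable
  also have "\<dots> \<le> ennreal (2 * \<epsilon>\<^sup>2) * ennreal (p * unit_ball_vol p / (4 * \<epsilon>))"
    using nn_integral_log_tail[where 'a="real ^ 'p", OF \<epsilon>] D by (intro mult_left_mono) (auto simp: p_def)
  also have "\<dots> = ennreal (p * unit_ball_vol p / 2 * \<epsilon>)"
    using \<epsilon> by (subst ennreal_mult[symmetric]) (auto simp: p_def power2_eq_square intro!: mult_nonneg_nonneg divide_nonneg_nonneg)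
  finally show ?thesis unfolding p_def .
qed

text \<open>A product of a cutoff in \<open>\<eta>\<close> and one in \<open>g\<close> would not have small energy when \<open>a = -2\<close>: the problem is
  two-dimensional. Subtracting \<open>1 / 4\<close> makes the support bounded, hence the truncated prior finite,
  without increasing the oscillation.\<close>

definition log_cutoff :: "real \<Rightarrow> real \<times> real \<Rightarrow> real" where
  "log_cutoff \<epsilon> z = max 0 ((1 + (\<bar>ln (fst z)\<bar> + ln (snd z + 1))) powr (- \<epsilon>) - 1 / 4)"

lemma log_cutoff_measurable [measurable]: "log_cutoff \<epsilon> \<in> borel_measurable pos_plane"
  unfolding log_cutoff_def by measurable

lemma log_cutoff_nonneg: "log_cutoff \<epsilon> z \<ge> 0"
  by (simp add: log_cutoff_def)

lemma log_cutoff_le_1: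
  assumes "\<epsilon> > 0" "snd z > 0"
  shows "log_cutoff \<epsilon> z \<le> 1"
proof -
  have "1 + (\<bar>ln (fst z)\<bar> + ln (snd z + 1)) \<ge> 1" using assms by simp
  then have "(1 + (\<bar>ln (fst z)\<bar> + ln (snd z + 1))) powr (- \<epsilon>) \<le> (1 + (\<bar>ln (fst z)\<bar> + ln (snd z + 1))) powr 0"
    using assms by (intro powr_mono) auto
  also have "\<dots> \<le> 1" by simp
  finally show ?thesis by (simp add: log_cutoff_def)
qed

text \<open>Uniform in \<epsilon>: on a fixed region the weight stays bounded below while the energy
  tends to zero. The bound is \<open>2 powr (- 1) - 1 / 4\<close>.\<close>

lemma log_cutoff_ge:
  assumes \<epsilon>: "0 < \<epsilon>" "\<epsilon> \<le> 1" and z: "\<bar>ln (fst z)\<bar> + ln (snd z + 1) \<le> 1" "snd z > 0"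
  shows "log_cutoff \<epsilon> z \<ge> 1 / 4"
proof -
  define r where "r = \<bar>ln (fst z)\<bar> + ln (snd z + 1)"
  have r: "r \<ge> 0" "r \<le> 1" using z by (auto simp: r_def)
  have "1 / 2 = 2 powr (- 1 :: real)" by (simp add: powr_minus_divide)
  also have "\<dots> \<le> 2 powr (- \<epsilon>)" using \<epsilon> by (intro powr_mono) auto
  also have "\<dots> \<le> (1 + r) powr (- \<epsilon>)" using \<epsilon> r by (intro powr_mono2') auto
  finally show ?thesis by (simp add: log_cutoff_def r_def)
qed

lemma log_cutoff_eq_0:
  assumes \<epsilon>: "0 < \<epsilon>" and z: "\<bar>ln (fst z)\<bar> + ln (snd z + 1) \<ge> 4 powr (1 / \<epsilon>)"
  shows "log_cutoff \<epsilon> z = 0"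
proof -
  define r where "r = \<bar>ln (fst z)\<bar> + ln (snd z + 1)"
  have "(1 + r) powr (- \<epsilon>) \<le> (4 powr (1 / \<epsilon>)) powr (- \<epsilon>)"
    using z \<epsilon> by (intro powr_mono2') (auto simp: r_def)
  also have "\<dots> = 1 / 4" using \<epsilon> by (simp add: powr_powr powr_minus_divide)
  finally show ?thesis by (simp add: log_cutoff_def r_def)
qed

text \<open>The reference value is that of the cutoff at \<open>\<eta> = 1 / s\<close> and
  \<open>g = w\<close>. In logarithmic coordinates the distance to this point is at most
  \<open>\<bar>ln v\<bar> + \<bar>ln y\<bar>\<close>, where \<open>v\<close> and \<open>y\<close>
  are the scale-free quantities of the kernel moments. The data enter the bound through the gradient
  at \<open>r\<close> and otherwise only through powers of \<open>v\<close> and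
  \<open>y\<close>.\<close>

lemma log_cutoff_oscillation:
  assumes \<epsilon>: "0 < \<epsilon>" "\<epsilon> \<le> 1" and \<tau>: "0 < \<tau>" "\<tau> \<le> 6" and s: "s > 0" and w: "w \<ge> 0" and z: "fst z > 0" "snd z > 0"
  defines "r \<equiv> \<bar>ln s\<bar> + ln (1 + w)" and "v \<equiv> fst z * s" and "y \<equiv> (1 + w) / (snd z + 1)"
  shows "(log_cutoff \<epsilon> z - max 0 ((1 + r) powr (- \<epsilon>) - 1 / 4))\<^sup>2
     \<le> \<epsilon>\<^sup>2 * (1 + r) powr (- 2 - 2 * \<epsilon>) * (6 / \<tau>) ^ 6 * ((v powr \<tau> + v powr (- \<tau>)) * (y powr \<tau> + y powr (- \<tau>)))"
proof -
  define t where "t = \<bar>ln (fst z)\<bar> + ln (snd z + 1)"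
  define D where "D = \<bar>ln v\<bar> + \<bar>ln y\<bar>"
  have D0: "D \<ge> 0" by (simp add: D_def)
  have t: "t \<ge> 0" using z by (simp add: t_def)
  have r: "r \<ge> 0" using w by (simp add: r_def)
  have vy: "v > 0" "y > 0" using s w z by (auto simp: v_def y_def)
  have "ln v = ln (fst z) + ln s" unfolding v_def using z s by (simp add: ln_mult)
  moreover have "ln y = ln (1 + w) - ln (snd z + 1)" unfolding y_def using z w by (simp add: ln_div)
  ultimately have "\<bar>t - r\<bar> \<le> D" unfolding t_def r_def D_def by linarith
  then have lip: "\<bar>(1 + t) powr (- \<epsilon>) - (1 + r) powr (- \<epsilon>)\<bar> \<le> \<epsilon> * (1 + r) powr (- 1 - \<epsilon>) * (1 + D) ^ 3"
    using \<epsilon> t r by (intro powr_neg_lipschitz) auto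
  have "\<bar>log_cutoff \<epsilon> z - max 0 ((1 + r) powr (- \<epsilon>) - 1 / 4)\<bar> \<le> \<bar>(1 + t) powr (- \<epsilon>) - (1 + r) powr (- \<epsilon>)\<bar>"
    unfolding log_cutoff_def t_def by (auto simp: max_def abs_if)
  with lip have "\<bar>log_cutoff \<epsilon> z - max 0 ((1 + r) powr (- \<epsilon>) - 1 / 4)\<bar> \<le> \<epsilon> * (1 + r) powr (- 1 - \<epsilon>) * (1 + D) ^ 3" by linarith
  then have "(log_cutoff \<epsilon> z - max 0 ((1 + r) powr (- \<epsilon>) - 1 / 4))\<^sup>2 \<le> (\<epsilon> * (1 + r) powr (- 1 - \<epsilon>) * (1 + D) ^ 3)\<^sup>2"
    by (metis abs_ge_zero power2_abs power_mono)
  also have "\<dots> = \<epsilon>\<^sup>2 * (1 + r) powr (- 2 - 2 * \<epsilon>) * (1 + D) ^ 6"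
  proof -
    have "((1 + r) powr (- 1 - \<epsilon>))\<^sup>2 = (1 + r) powr (- 2 - 2 * \<epsilon>)"
      unfolding power2_eq_square powr_add[symmetric] by simp
    then show ?thesis by (simp add: power_mult_distrib power_mult[symmetric])
  qed
  also have "\<dots> \<le> \<epsilon>\<^sup>2 * (1 + r) powr (- 2 - 2 * \<epsilon>) * ((6 / \<tau>) ^ 6 * exp (\<tau> * D))"
    using power_le_exp[OF \<tau> D0] by (intro mult_left_mono) auto
  also have "exp (\<tau> * D) = exp (\<tau> * \<bar>ln v\<bar>) * exp (\<tau> * \<bar>ln y\<bar>)"
    unfolding D_def by (simp add: distrib_left exp_add)
  also have "\<epsilon>\<^sup>2 * (1 + r) powr (- 2 - 2 * \<epsilon>) * ((6 / \<tau>) ^ 6 * (exp (\<tau> * \<bar>ln v\<bar>) * exp (\<tau> * \<bar>ln y\<bar>)))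
     \<le> \<epsilon>\<^sup>2 * (1 + r) powr (- 2 - 2 * \<epsilon>) * ((6 / \<tau>) ^ 6 * ((v powr \<tau> + v powr (- \<tau>)) * (y powr \<tau> + y powr (- \<tau>))))"
    using \<tau> vy by (intro mult_left_mono mult_mono exp_abs_ln_le) auto
  finally show ?thesis by (simp only: mult.assoc)
qed

section \<open>Effect of the cutoff on posterior expected loss\<close>

context scale_mixture begin

abbreviation bayes :: "(real ^ 'p) \<times> real \<Rightarrow> real ^ 'p" where
  "bayes \<equiv> gen_bayes n (prior_measure a b)"

lemma estimator_bayes: "estimator bayes"
  unfolding estimator_def
proof (subst measurable_cong)
  show "bayes u = (1 - mixmean ((norm (fst u))\<^sup>2 / snd u)) *\<^sub>R fst u" if "u \<in> space (lborel \<Otimes>\<^sub>M pos_lborel)" for u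
    using that gen_bayes_prior[of "snd u" "fst u"] by (auto simp: space_pair_measure)
qed measurable

abbreviation post_mean :: "real ^ 'p \<Rightarrow> real \<Rightarrow> real ^ 'p" where
  "post_mean x g \<equiv> (g / (g + 1)) *\<^sub>R x"

lemma post_mean_minus_bayes:
  assumes "s > 0" "g > 0"
  shows "post_mean x g - bayes (x, s) = (mixmean ((norm x)\<^sup>2 / s) - 1 / (g + 1)) *\<^sub>R x"
proof -
  have e: "g / (g + 1) = 1 - 1 / (g + 1)" using assms by (simp add: field_simps)
  show ?thesis unfolding gen_bayes_prior[OF assms(1)] e scaleR_left_diff_distrib[symmetric] by simp
qed

text \<open>For fixed data the kernel is normalized to the posterior law of \<eta> and
  \<open>g\<close>, and the abstract inequality is applied with \<open>L = 1 / (g + 1)\<close>,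
  whose mean is the shrinkage factor. The bounds \<open>B1\<close>, \<open>B2\<close>,
  \<open>B3\<close> concern unnormalized integrals, so the product of two expectations calls for the
  lower bound \<open>m\<close> on the total mass.\<close>

lemma kern_perturbation:
  fixes x d :: "real ^ 'p" and H k :: "real \<times> real \<Rightarrow> real"
  assumes s: "s > 0" and [measurable]: "H \<in> borel_measurable pos_plane" "k \<in> borel_measurable pos_plane"
    and H: "\<And>z. snd z > 0 \<Longrightarrow> 0 \<le> H z" "\<And>z. snd z > 0 \<Longrightarrow> H z \<le> 1"
    and k: "\<And>z. fst z > 0 \<Longrightarrow> snd z > 0 \<Longrightarrow> (H z - h)\<^sup>2 \<le> k z"
    and B1: "(\<integral>\<^sup>+z. ennreal ((1 / (snd z + 1))\<^sup>2 * k z * kern x s (fst z) (snd z)) \<partial>pos_plane) \<le> ennreal B1"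
    and B2: "(\<integral>\<^sup>+z. ennreal ((1 / (snd z + 1))\<^sup>2 * kern x s (fst z) (snd z)) \<partial>pos_plane) \<le> ennreal B2"
    and B3: "(\<integral>\<^sup>+z. ennreal (k z * kern x s (fst z) (snd z)) \<partial>pos_plane) \<le> ennreal B3"
    and m: "ennreal m \<le> (\<integral>\<^sup>+z. ennreal (kern x s (fst z) (snd z)) \<partial>pos_plane)"
    and pos: "m > 0" "B1 \<ge> 0" "B2 \<ge> 0" "B3 \<ge> 0"
  shows "(\<integral>\<^sup>+z. ennreal ((H z)\<^sup>2 * (norm (post_mean x (snd z) - bayes (x, s)))\<^sup>2 * kern x s (fst z) (snd z)) \<partial>pos_plane)
       + ennreal (1 / 2 * (norm d)\<^sup>2) * (\<integral>\<^sup>+z. ennreal ((H z)\<^sup>2 * kern x s (fst z) (snd z)) \<partial>pos_plane)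
     \<le> (\<integral>\<^sup>+z. ennreal ((H z)\<^sup>2 * (norm (post_mean x (snd z) - bayes (x, s) - d))\<^sup>2 * kern x s (fst z) (snd z)) \<partial>pos_plane)
       + ennreal (16 * (norm x)\<^sup>2 * (B1 + 3 * B2 * B3 / m))"
proof -
  define K where "K = (\<lambda>z. kern x s (fst z) (snd z))"
  define M0 where "M0 = (\<integral>z. K z \<partial>pos_plane)"
  have [measurable]: "K \<in> borel_measurable pos_plane" unfolding K_def by measurable
  have K0: "K z \<ge> 0" for z by (simp add: K_def)
  have iK: "integrable pos_plane K" unfolding K_def by (rule integrable_kern[OF s])
  have nnK: "(\<integral>\<^sup>+z. ennreal (K z) \<partial>pos_plane) = ennreal M0"
    unfolding M0_def using iK K0 by (intro nn_integral_eq_integral) auto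
  have mM: "m \<le> M0"
  proof -
    have "ennreal m \<le> ennreal M0" using m nnK unfolding K_def by simp
    moreover have "M0 \<ge> 0" unfolding M0_def using K0 by (intro integral_nonneg_AE) auto
    ultimately show ?thesis by (simp add: ennreal_le_iff)
  qed
  then have M0: "M0 > 0" using pos by linarith
  define P where "P = density pos_plane (\<lambda>z. ennreal (K z / M0))"
  have sP [simp]: "space P = space pos_plane" "sets P = sets pos_plane" by (simp_all add: P_def)
  have mP: "f \<in> borel_measurable P \<longleftrightarrow> f \<in> borel_measurable pos_plane" for f :: "real \<times> real \<Rightarrow> real" by (simp add: P_def)
  interpret P: prob_space P
  proof (rule prob_spaceI)
    have "emeasure P (space P) = (\<integral>\<^sup>+z. ennreal (K z / M0) * indicator (space pos_plane) z \<partial>pos_plane)"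
      unfolding P_def space_density by (rule emeasure_density[OF _ sets.top]) measurable
    also have "\<dots> = (\<integral>\<^sup>+z. ennreal (1 / M0) * ennreal (K z) \<partial>pos_plane)"
      using M0 K0 by (intro nn_integral_cong) (auto simp: ennreal_mult[symmetric])
    also have "\<dots> = ennreal (1 / M0) * ennreal M0" using nnK by (subst nn_integral_cmult) auto
    also have "\<dots> = 1" using M0 by (subst ennreal_mult[symmetric]) auto
    finally show "emeasure P (space P) = 1" .
  qed
  have nnP: "(\<integral>\<^sup>+z. ennreal (f z * K z) \<partial>pos_plane) = ennreal M0 * (\<integral>\<^sup>+z. ennreal (f z) \<partial>P)"
    if [measurable]: "f \<in> borel_measurable pos_plane" and f: "\<And>z. z \<in> space pos_plane \<Longrightarrow> f z \<ge> 0" for f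
  proof -
    have "ennreal M0 * (\<integral>\<^sup>+z. ennreal (f z) \<partial>P) = ennreal M0 * (\<integral>\<^sup>+z. ennreal (K z / M0) * ennreal (f z) \<partial>pos_plane)"
      unfolding P_def by (subst nn_integral_density) auto
    also have "\<dots> = (\<integral>\<^sup>+z. ennreal M0 * (ennreal (K z / M0) * ennreal (f z)) \<partial>pos_plane)"
      by (rule nn_integral_cmult[symmetric]) measurable
    also have "\<dots> = (\<integral>\<^sup>+z. ennreal (f z * K z) \<partial>pos_plane)"
      using M0 K0 f by (intro nn_integral_cong) (auto simp: ennreal_mult[symmetric] mult.commute)
    finally show ?thesis ..
  qed
  have eP: "(\<integral>\<^sup>+z. ennreal (f z * K z) \<partial>pos_plane) = ennreal (M0 * P.expectation f)"
    if "f \<in> borel_measurable pos_plane" "\<And>z. z \<in> space pos_plane \<Longrightarrow> f z \<ge> 0" "integrable P f" for f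
  proof -
    have "(\<integral>\<^sup>+z. ennreal (f z) \<partial>P) = ennreal (P.expectation f)"
      using that by (intro nn_integral_eq_integral) (auto intro!: AE_I2)
    then show ?thesis using nnP[OF that(1,2)] M0 by (simp add: ennreal_mult')
  qed
  have bdd: "integrable P f" if "f \<in> borel_measurable pos_plane" "\<And>z. z \<in> space pos_plane \<Longrightarrow> \<bar>f z\<bar> \<le> B" for f :: "real \<times> real \<Rightarrow> real" and B
    using that by (intro P.integrable_const_bound[of f B]) (auto intro!: AE_I2 simp: mP)
  define L where "L = (\<lambda>z :: real \<times> real. 1 / (snd z + 1))"
  have [measurable]: "L \<in> borel_measurable pos_plane" unfolding L_def by measurable
  have L: "0 \<le> L z" "L z \<le> 1" if "z \<in> space pos_plane" for z using that by (auto simp: L_def space_pos2)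
  have HP: "0 \<le> H z" "H z \<le> 1" if "z \<in> space pos_plane" for z using that H by (auto simp: space_pos2)
  have kP: "(H z - h)\<^sup>2 \<le> k z" if "z \<in> space pos_plane" for z using that k by (auto simp: space_pos2)
  have k0: "k z \<ge> 0" if "z \<in> space pos_plane" for z using kP[OF that] by (meson order_trans zero_le_power2)
  have ik: "integrable P k"
  proof (rule integrableI_nonneg)
    show "k \<in> borel_measurable P" by (simp add: mP)
    show "AE z in P. 0 \<le> k z" using k0 by (intro AE_I2) auto
    have "ennreal M0 * (\<integral>\<^sup>+z. ennreal (k z) \<partial>P) < \<infinity>"
      using nnP[of k] k0 B3 unfolding K_def by (auto intro: le_less_trans)
    then show "(\<integral>\<^sup>+z. ennreal (k z) \<partial>P) < \<infinity>" using M0 by (auto simp: ennreal_mult_less_top)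
  qed
  have L2: "(L z)\<^sup>2 \<le> 1" if "z \<in> space pos_plane" for z using L[OF that] by (simp add: power_le_one)
  have iLk: "integrable P (\<lambda>z. (L z)\<^sup>2 * k z)"
  proof (rule Bochner_Integration.integrable_bound[OF ik])
    show "AE z in P. norm ((L z)\<^sup>2 * k z) \<le> norm (k z)"
      using L2 by (intro AE_I2) (auto simp: abs_mult intro: mult_left_le_one_le)
  qed (simp add: mP)
  have q: "P.expectation L = mixmean ((norm x)\<^sup>2 / s)"
  proof -
    have "ennreal (M0 * P.expectation L) = (\<integral>\<^sup>+z. ennreal (L z * K z) \<partial>pos_plane)"
      using L by (intro eP[symmetric] bdd[of _ 1]) auto
    also have "\<dots> = ennreal (\<integral>z. L z * K z \<partial>pos_plane)"
    proof (rule nn_integral_eq_integral)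
      show "integrable pos_plane (\<lambda>z. L z * K z)"
        by (rule Bochner_Integration.integrable_bound[OF iK])
           (use L K0 in \<open>auto intro!: AE_I2 mult_left_le_one_le simp: abs_mult\<close>)
    qed (use L K0 in \<open>auto intro!: AE_I2\<close>)
    finally have "M0 * P.expectation L = (\<integral>z. L z * K z \<partial>pos_plane)"
      using M0 L K0 by (subst (asm) ennreal_inj) (auto intro!: mult_nonneg_nonneg integral_nonneg_AE AE_I2)
    moreover define C where "C = gamma_const 0 * s powr (- p / 2 - 2)"
    moreover have "(\<integral>z. L z * K z \<partial>pos_plane) = C * (\<integral>g. 1 / (g + 1) * mix ((norm x)\<^sup>2 / s) g \<partial>pos_lborel)"
      unfolding L_def K_def C_def by (rule integral_kern_eq[OF s]) auto
    moreover have "M0 = C * (\<integral>g. 1 * mix ((norm x)\<^sup>2 / s) g \<partial>pos_lborel)"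
      using integral_kern_eq[OF s, of "\<lambda>_. 1" x] unfolding M0_def K_def C_def by simp
    ultimately have "C * ((\<integral>g. mix ((norm x)\<^sup>2 / s) g \<partial>pos_lborel) * P.expectation L) = C * (\<integral>g. mix ((norm x)\<^sup>2 / s) g / (g + 1) \<partial>pos_lborel)"
      by (simp add: mult_ac)
    moreover have "C \<noteq> 0" using M0 \<open>M0 = C * _\<close> by auto
    moreover have "(\<integral>g. mix ((norm x)\<^sup>2 / s) g \<partial>pos_lborel) > 0" using s by (intro integral_mix_pos) auto
    ultimately show ?thesis unfolding mixmean_def by (simp add: eq_divide_eq mult.commute)
  qed
  have pm: "post_mean x (snd z) - bayes (x, s) = (P.expectation L - L z) *\<^sub>R x" if "z \<in> space pos_plane" for z
  proof -
    have "snd z > 0" using that by (auto simp: space_pos2)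
    from post_mean_minus_bayes[OF s this] show ?thesis unfolding q by (simp only: L_def)
  qed
  have q01: "0 \<le> P.expectation L" "P.expectation L \<le> 1"
    unfolding q using mixmean_nonneg[of "(norm x)\<^sup>2 / s"] mixmean_less_1[of "(norm x)\<^sup>2 / s"] s by auto
  have qL: "\<bar>P.expectation L - L z\<bar> \<le> 1" if "z \<in> space pos_plane" for z using L[OF that] q01 by auto
  have H2: "(H z)\<^sup>2 \<le> 1" if "z \<in> space pos_plane" for z using HP[OF that] by (simp add: power_le_one)
  define F1 where "F1 = (\<lambda>z. (H z)\<^sup>2 * (norm ((P.expectation L - L z) *\<^sub>R x))\<^sup>2)"
  define F2 where "F2 = (\<lambda>z. (H z)\<^sup>2 * (norm ((P.expectation L - L z) *\<^sub>R x - d))\<^sup>2)"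
  have [measurable]: "F1 \<in> borel_measurable pos_plane" "F2 \<in> borel_measurable pos_plane" unfolding F1_def F2_def by measurable
  have nx: "norm ((P.expectation L - L z) *\<^sub>R x) \<le> norm x" if "z \<in> space pos_plane" for z
    using mult_right_mono[OF qL[OF that], of "norm x"] by simp
  have iF1: "integrable P F1"
  proof (rule bdd[of _ "(norm x)\<^sup>2"])
    fix z assume z: "z \<in> space pos_plane"
    have "F1 z \<le> 1 * (norm x)\<^sup>2" unfolding F1_def using H2[OF z] nx[OF z] by (intro mult_mono power_mono) auto
    then show "\<bar>F1 z\<bar> \<le> (norm x)\<^sup>2" by (simp add: F1_def)
  qed simp
  have iF2: "integrable P F2"
  proof (rule bdd[of _ "(norm x + norm d)\<^sup>2"])
    fix z assume z: "z \<in> space pos_plane"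
    have "norm ((P.expectation L - L z) *\<^sub>R x - d) \<le> norm x + norm d"
      using norm_triangle_ineq4[of "(P.expectation L - L z) *\<^sub>R x" d] nx[OF z] by linarith
    then have "F2 z \<le> 1 * (norm x + norm d)\<^sup>2" unfolding F2_def using H2[OF z] by (intro mult_mono power_mono) auto
    then show "\<bar>F2 z\<bar> \<le> (norm x + norm d)\<^sup>2" by (simp add: F2_def)
  qed simp
  have iH2: "integrable P (\<lambda>z. (H z)\<^sup>2)" using H2 by (intro bdd[of _ 1]) auto
  have iL2: "integrable P (\<lambda>z. (L z)\<^sup>2)" using L2 by (intro bdd[of _ 1]) auto
  have main: "P.expectation F1 + 1 / 2 * (norm d)\<^sup>2 * P.expectation (\<lambda>z. (H z)\<^sup>2)
     \<le> P.expectation F2 + 16 * (norm x)\<^sup>2 * (P.expectation (\<lambda>z. (L z)\<^sup>2 * k z) + 3 * P.expectation (\<lambda>z. (L z)\<^sup>2) * P.expectation k)"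
    unfolding F1_def F2_def
    by (rule P.weighted_square_perturbation[where h=h]) (use L HP kP ik in \<open>auto simp: mP\<close>)
  have b1: "M0 * P.expectation (\<lambda>z. (L z)\<^sup>2 * k z) \<le> B1"
  proof -
    have "ennreal (M0 * P.expectation (\<lambda>z. (L z)\<^sup>2 * k z)) \<le> ennreal B1"
      using B1 iLk k0 by (subst eP[symmetric]) (auto simp: L_def K_def)
    then show ?thesis using pos by (simp add: ennreal_le_iff)
  qed
  have b2: "M0 * P.expectation (\<lambda>z. (L z)\<^sup>2) \<le> B2"
  proof -
    have "ennreal (M0 * P.expectation (\<lambda>z. (L z)\<^sup>2)) \<le> ennreal B2"
      using B2 iL2 by (subst eP[symmetric]) (auto simp: L_def K_def)
    then show ?thesis using pos by (simp add: ennreal_le_iff)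
  qed
  have b3: "M0 * P.expectation k \<le> B3"
  proof -
    have "ennreal (M0 * P.expectation k) \<le> ennreal B3"
      using B3 ik k0 by (subst eP[symmetric]) (auto simp: K_def)
    then show ?thesis using pos by (simp add: ennreal_le_iff)
  qed
  have ek: "P.expectation k \<ge> 0" using k0 by (intro integral_nonneg_AE AE_I2) auto
  have eL: "P.expectation (\<lambda>z. (L z)\<^sup>2) \<ge> 0" by (intro integral_nonneg_AE AE_I2) auto
  \<comment> \<open>Each expectation absorbs a factor \<open>M0\<close>, while only one is
    available; the surplus division by \<open>M0\<close> is bounded through
    \<open>m\<close>.\<close>
  have b23: "M0 * (P.expectation (\<lambda>z. (L z)\<^sup>2) * P.expectation k) \<le> B2 * B3 / m"
  proof -
    have "(M0 * P.expectation (\<lambda>z. (L z)\<^sup>2)) * (M0 * P.expectation k) \<le> B2 * B3"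
      using b2 b3 pos M0 ek eL by (intro mult_mono) auto
    then have "M0 * (P.expectation (\<lambda>z. (L z)\<^sup>2) * P.expectation k) \<le> B2 * B3 / M0"
      using M0 by (simp add: pos_le_divide_eq mult_ac)
    also have "\<dots> \<le> B2 * B3 / m" using mM pos by (intro divide_left_mono) auto
    finally show ?thesis .
  qed
  have main': "M0 * P.expectation F1 + 1 / 2 * (norm d)\<^sup>2 * (M0 * P.expectation (\<lambda>z. (H z)\<^sup>2))
     \<le> M0 * P.expectation F2 + 16 * (norm x)\<^sup>2 * (B1 + 3 * B2 * B3 / m)"
  proof -
    have "M0 * P.expectation F1 + 1 / 2 * (norm d)\<^sup>2 * (M0 * P.expectation (\<lambda>z. (H z)\<^sup>2)) = M0 * (P.expectation F1 + 1 / 2 * (norm d)\<^sup>2 * P.expectation (\<lambda>z. (H z)\<^sup>2))"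
      by (simp add: algebra_simps)
    also have "\<dots> \<le> M0 * (P.expectation F2 + 16 * (norm x)\<^sup>2 * (P.expectation (\<lambda>z. (L z)\<^sup>2 * k z) + 3 * P.expectation (\<lambda>z. (L z)\<^sup>2) * P.expectation k))"
      using main M0 by (intro mult_left_mono) auto
    also have "\<dots> = M0 * P.expectation F2 + 16 * (norm x)\<^sup>2 * (M0 * P.expectation (\<lambda>z. (L z)\<^sup>2 * k z) + 3 * (M0 * (P.expectation (\<lambda>z. (L z)\<^sup>2) * P.expectation k)))"
      by (simp add: algebra_simps)
    also have "\<dots> \<le> M0 * P.expectation F2 + 16 * (norm x)\<^sup>2 * (B1 + 3 * (B2 * B3 / m))"
      using b1 b23 by (intro add_left_mono mult_left_mono add_mono) auto
    finally show ?thesis by (simp add: mult.assoc)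
  qed
  have "(\<integral>\<^sup>+z. ennreal ((H z)\<^sup>2 * (norm (post_mean x (snd z) - bayes (x, s)))\<^sup>2 * K z) \<partial>pos_plane) = (\<integral>\<^sup>+z. ennreal (F1 z * K z) \<partial>pos_plane)"
    by (intro nn_integral_cong) (simp only: pm F1_def)
  also have "\<dots> = ennreal (M0 * P.expectation F1)" using iF1 by (intro eP) (auto simp: F1_def)
  finally have e1: "(\<integral>\<^sup>+z. ennreal ((H z)\<^sup>2 * (norm (post_mean x (snd z) - bayes (x, s)))\<^sup>2 * K z) \<partial>pos_plane) = ennreal (M0 * P.expectation F1)" .
  have "(\<integral>\<^sup>+z. ennreal ((H z)\<^sup>2 * (norm (post_mean x (snd z) - bayes (x, s) - d))\<^sup>2 * K z) \<partial>pos_plane) = (\<integral>\<^sup>+z. ennreal (F2 z * K z) \<partial>pos_plane)"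
    by (intro nn_integral_cong) (simp only: pm F2_def)
  also have "\<dots> = ennreal (M0 * P.expectation F2)" using iF2 by (intro eP) (auto simp: F2_def)
  finally have e2: "(\<integral>\<^sup>+z. ennreal ((H z)\<^sup>2 * (norm (post_mean x (snd z) - bayes (x, s) - d))\<^sup>2 * K z) \<partial>pos_plane) = ennreal (M0 * P.expectation F2)" .
  have e3: "(\<integral>\<^sup>+z. ennreal ((H z)\<^sup>2 * K z) \<partial>pos_plane) = ennreal (M0 * P.expectation (\<lambda>z. (H z)\<^sup>2))"
    using iH2 by (intro eP) auto
  have nn: "0 \<le> M0 * P.expectation F1" "0 \<le> M0 * P.expectation F2" "0 \<le> M0 * P.expectation (\<lambda>z. (H z)\<^sup>2)"
    using M0 by (auto intro!: mult_nonneg_nonneg integral_nonneg_AE AE_I2 simp: F1_def F2_def)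
  have "ennreal (M0 * P.expectation F1) + ennreal (1 / 2 * (norm d)\<^sup>2) * ennreal (M0 * P.expectation (\<lambda>z. (H z)\<^sup>2))
     = ennreal (M0 * P.expectation F1 + 1 / 2 * (norm d)\<^sup>2 * (M0 * P.expectation (\<lambda>z. (H z)\<^sup>2)))"
    using nn by (subst ennreal_mult[symmetric]) (auto intro!: ennreal_plus[symmetric])
  also have "\<dots> \<le> ennreal (M0 * P.expectation F2 + 16 * (norm x)\<^sup>2 * (B1 + 3 * B2 * B3 / m))"
    by (rule ennreal_leI[OF main'])
  also have "\<dots> = ennreal (M0 * P.expectation F2) + ennreal (16 * (norm x)\<^sup>2 * (B1 + 3 * B2 * B3 / m))"
    using nn pos by (intro ennreal_plus) auto
  finally show ?thesis unfolding e1[unfolded K_def] e2[unfolded K_def] e3[unfolded K_def] .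
qed


text \<open>The moment factors are those of the oscillation bound for the cutoff. The exponent is
  used with \<open>l = 0\<close> for the error alone and with \<open>l = 2\<close> for the error
  weighted by the squared shrinkage \<open>1 / (g + 1)\<close>.\<close>

abbreviation kern_osc :: "real \<Rightarrow> real \<Rightarrow> real ^ 'p \<Rightarrow> real \<Rightarrow> ennreal" where
  "kern_osc l \<tau> x s \<equiv> (\<integral>\<^sup>+z. ennreal ((snd z + 1) powr (- l) *
     (((fst z * s) powr \<tau> + (fst z * s) powr (- \<tau>)) *
      (((1 + (norm x)\<^sup>2 / s) / (snd z + 1)) powr \<tau> + ((1 + (norm x)\<^sup>2 / s) / (snd z + 1)) powr (- \<tau>))) *
     kern x s (fst z) (snd z)) \<partial>pos_plane)"

abbreviation cut_sq :: "real \<Rightarrow> real ^ 'p \<Rightarrow> real \<Rightarrow> (real \<times> real \<Rightarrow> real ^ 'p) \<Rightarrow> ennreal" where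
  "cut_sq \<epsilon> x s f \<equiv> (\<integral>\<^sup>+z. ennreal ((log_cutoff \<epsilon> z)\<^sup>2 * (norm (f z))\<^sup>2 * kern x s (fst z) (snd z)) \<partial>pos_plane)"

abbreviation cut_mass :: "real \<Rightarrow> real ^ 'p \<Rightarrow> real \<Rightarrow> ennreal" where
  "cut_mass \<epsilon> x s \<equiv> (\<integral>\<^sup>+z. ennreal ((log_cutoff \<epsilon> z)\<^sup>2 * kern x s (fst z) (snd z)) \<partial>pos_plane)"

text \<open>The squared gradient of the cutoff at the typical posterior point, times the weight in
  data space that remains at the boundary \<open>a = -2\<close>.\<close>

abbreviation cut_energy :: "real \<Rightarrow> real ^ 'p \<Rightarrow> real \<Rightarrow> real" where
  "cut_energy \<epsilon> x s \<equiv> (\<epsilon>\<^sup>2 * (1 + \<bar>ln s\<bar> + ln (1 + (norm x)\<^sup>2 / s)) powr (- 2 - 2 * \<epsilon>)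
     * (s powr (- p / 2 - 1) * (1 + (norm x)\<^sup>2 / s) powr (- p / 2)))"

text \<open>The product of the two sums expands into four kernel moments with exponents \<tau> or
  \<open>- \<tau>\<close>. The least favourable signs cost \<tau> in the first convergence condition
  and \<open>2 * \<tau>\<close> in the second.\<close>

lemma nn_integral_kern_oscillation:
  assumes \<tau>: "\<tau> > 0" "p / 2 + a + 2 + l - \<tau> > 1" "\<kappa> + 1 > p / 2 + a + 2 + l + 2 * \<tau>"
  shows "\<exists>C\<ge>0. \<forall>(x :: real ^ 'p) s. s > 0 \<longrightarrow>
    kern_osc l \<tau> x s
    \<le> ennreal (C * (s powr (- p / 2 - 2) * (1 + (norm x)\<^sup>2 / s) powr (- (p / 2 + a + 1 + l))))"
proof -
  define c where "c = (\<lambda>i j. gamma_const j * (1 / (p / 2 + a + 1 + (l + i)) + 1 / (\<kappa> + j - (p / 2 + a + 1 + (l + i)))))"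
  have c: "c i j \<ge> 0" if "i \<in> {\<tau>, - \<tau>}" "j \<in> {\<tau>, - \<tau>}" for i j
  proof -
    have "p / 2 + a + 1 + (l + i) > 0" "\<kappa> + j - (p / 2 + a + 1 + (l + i)) > 0" "\<kappa> + j > 0"
      using that \<tau> by auto
    then show ?thesis unfolding c_def using gamma_const_pos[of j] by (intro mult_nonneg_nonneg add_nonneg_nonneg) auto
  qed
  define C where "C = c \<tau> \<tau> + c \<tau> (- \<tau>) + c (- \<tau>) \<tau> + c (- \<tau>) (- \<tau>)"
  show ?thesis
  proof (intro exI conjI allI impI)
    show "C \<ge> 0" unfolding C_def using c by auto
    fix x :: "real ^ 'p" and s :: real assume s: "s > 0"
    define w where "w = (norm x)\<^sup>2 / s"
    define S where "S = s powr (- p / 2 - 2) * (1 + w) powr (- (p / 2 + a + 1 + l))"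
    have S: "S \<ge> 0" by (simp add: S_def)
    define m where "m = (\<lambda>i j z. (snd z + 1) powr (- l) * ((1 + w) / (snd z + 1)) powr i * (fst z * s) powr j * kern x s (fst z) (snd z))"
    have m0: "m i j z \<ge> 0" for i j z by (simp add: m_def)
    have [measurable]: "m i j \<in> borel_measurable pos_plane" for i j unfolding m_def by measurable
    have mb: "(\<integral>\<^sup>+z. ennreal (m i j z) \<partial>pos_plane) \<le> ennreal (c i j * S)"
      if "i \<in> {\<tau>, - \<tau>}" "j \<in> {\<tau>, - \<tau>}" for i j
      using nn_integral_kern_moment[OF s w_def, of l i j] that \<tau> unfolding m_def c_def S_def by (auto simp: mult.assoc)
    have "(\<integral>\<^sup>+z. ennreal ((snd z + 1) powr (- l) *
       (((fst z * s) powr \<tau> + (fst z * s) powr (- \<tau>)) *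
        (((1 + w) / (snd z + 1)) powr \<tau> + ((1 + w) / (snd z + 1)) powr (- \<tau>))) *
       kern x s (fst z) (snd z)) \<partial>pos_plane)
     = (\<integral>\<^sup>+z. ennreal (m \<tau> \<tau> z) + ennreal (m \<tau> (- \<tau>) z) + ennreal (m (- \<tau>) \<tau> z) + ennreal (m (- \<tau>) (- \<tau>) z) \<partial>pos_plane)"
      using m0 by (intro nn_integral_cong) (simp add: ennreal_plus[symmetric] m_def algebra_simps del: ennreal_plus)
    also have "\<dots> = (\<integral>\<^sup>+z. ennreal (m \<tau> \<tau> z) \<partial>pos_plane) + (\<integral>\<^sup>+z. ennreal (m \<tau> (- \<tau>) z) \<partial>pos_plane)
        + (\<integral>\<^sup>+z. ennreal (m (- \<tau>) \<tau> z) \<partial>pos_plane) + (\<integral>\<^sup>+z. ennreal (m (- \<tau>) (- \<tau>) z) \<partial>pos_plane)"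
      by (simp add: nn_integral_add)
    also have "\<dots> \<le> ennreal (c \<tau> \<tau> * S) + ennreal (c \<tau> (- \<tau>) * S) + ennreal (c (- \<tau>) \<tau> * S) + ennreal (c (- \<tau>) (- \<tau>) * S)"
      by (intro add_mono mb) auto
    also have "\<dots> = ennreal (C * S)"
      using c S by (simp add: ennreal_plus[symmetric] C_def distrib_right del: ennreal_plus)
    finally show "kern_osc l \<tau> x s
      \<le> ennreal (C * (s powr (- p / 2 - 2) * (1 + (norm x)\<^sup>2 / s) powr (- (p / 2 + a + 1 + l))))"
      unfolding S_def w_def .
  qed
qed

text \<open>Both error terms of the perturbation bound are of the same order: in the product term
  the mass bound cancels the size of the unweighted oscillation. The square of
  \<open>1 / (g + 1)\<close> contributes \<open>(1 + w) powr (- 2)\<close>, one power of which pays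
  for the factor \<open>w\<close> in \<open>(norm x)\<^sup>2 = w * s\<close>.\<close>

lemma cutoff_perturbation:
  "\<exists>C\<ge>0. \<forall>\<epsilon> (x :: real ^ 'p) s d. 0 < \<epsilon> \<longrightarrow> \<epsilon> \<le> 1 \<longrightarrow> s > 0 \<longrightarrow>
    cut_sq \<epsilon> x s (\<lambda>z. post_mean x (snd z) - bayes (x, s))
     + ennreal (1 / 2 * (norm d)\<^sup>2) * cut_mass \<epsilon> x s
     \<le> cut_sq \<epsilon> x s (\<lambda>z. post_mean x (snd z) - bayes (x, s) - d)
       + ennreal (C * cut_energy \<epsilon> x s)"
proof -
  \<comment> \<open>Small enough for all moments to converge: \<open>1 / 4\<close> suffices for the
    first condition because \<open>p \<ge> 3\<close> and \<open>a \<ge> -2\<close>, and a quarter of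
    the gap in \<open>kappa_gt\<close> suffices for the second one with
    \<open>l = 2\<close>.\<close>
  define \<tau> where "\<tau> = min (1 / 4) ((\<kappa> - (p / 2 + a + 3)) / 4)"
  have \<tau>: "\<tau> > 0" "\<tau> \<le> 1 / 4" "4 * \<tau> \<le> \<kappa> - (p / 2 + a + 3)"
    using kappa_gt by (auto simp: \<tau>_def min_def)
  have c0: "p / 2 + a + 2 + 0 - \<tau> > 1" "\<kappa> + 1 > p / 2 + a + 2 + 0 + 2 * \<tau>"
   and c2: "p / 2 + a + 2 + 2 - \<tau> > 1" "\<kappa> + 1 > p / 2 + a + 2 + 2 + 2 * \<tau>"
    using p_ge a_ge \<tau> by auto
  obtain C0 where C0: "C0 \<ge> 0" "\<And>(x :: real ^ 'p) s. s > 0 \<Longrightarrow>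
    kern_osc 0 \<tau> x s
    \<le> ennreal (C0 * (s powr (- p / 2 - 2) * (1 + (norm x)\<^sup>2 / s) powr (- (p / 2 + a + 1 + 0))))"
    using nn_integral_kern_oscillation[OF \<tau>(1) c0] by blast
  obtain C2 where C2: "C2 \<ge> 0" "\<And>(x :: real ^ 'p) s. s > 0 \<Longrightarrow>
    kern_osc 2 \<tau> x s
    \<le> ennreal (C2 * (s powr (- p / 2 - 2) * (1 + (norm x)\<^sup>2 / s) powr (- (p / 2 + a + 1 + 2))))"
    using nn_integral_kern_oscillation[OF \<tau>(1) c2] by blast
  obtain c where c: "c > 0" "\<And>w. w \<ge> 0 \<Longrightarrow> ennreal (c * (1 + w) powr (- (p / 2 + a + 1))) \<le> (\<integral>\<^sup>+g. ennreal (mix w g) \<partial>pos_lborel)"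
    using nn_integral_mix_ge by blast
  define E2 where "E2 = gamma_const 0 * (1 / (p / 2 + a + 1 + (2 + 0)) + 1 / (\<kappa> + 0 - (p / 2 + a + 1 + (2 + 0))))"
  have g0: "gamma_const 0 > 0" using kappa_gt by (intro gamma_const_pos) auto
  have E2: "E2 \<ge> 0" unfolding E2_def using g0 p_ge a_ge kappa_gt by (intro mult_nonneg_nonneg add_nonneg_nonneg) auto
  define C where "C = 16 * (6 / \<tau>) ^ 6 * (C2 + 3 * E2 * C0 / (gamma_const 0 * c))"
  show ?thesis
  proof (intro exI conjI allI impI)
    show "C \<ge> 0" unfolding C_def using C0 C2 E2 g0 c \<tau>
      by (intro mult_nonneg_nonneg add_nonneg_nonneg divide_nonneg_nonneg zero_le_power) auto
    fix \<epsilon> s :: real and x d :: "real ^ 'p"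
    assume \<epsilon>: "0 < \<epsilon>" "\<epsilon> \<le> 1" and s: "s > 0"
    define w where "w = (norm x)\<^sup>2 / s"
    have w: "w \<ge> 0" using s by (simp add: w_def)
    define r where "r = \<bar>ln s\<bar> + ln (1 + w)"
    define A where "A = \<epsilon>\<^sup>2 * (1 + r) powr (- 2 - 2 * \<epsilon>) * (6 / \<tau>) ^ 6"
    have A: "A \<ge> 0" using \<tau> by (simp add: A_def)
    define U where "U = (\<lambda>z. ((fst z * s) powr \<tau> + (fst z * s) powr (- \<tau>)) * (((1 + w) / (snd z + 1)) powr \<tau> + ((1 + w) / (snd z + 1)) powr (- \<tau>)))"
    have U: "U z \<ge> 0" for z by (simp add: U_def)
    have [measurable]: "U \<in> borel_measurable pos_plane" unfolding U_def by measurable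
    define S where "S = s powr (- p / 2 - 2)"
    have S: "S > 0" using s by (simp add: S_def)
    define W0 where "W0 = (1 + w) powr (- (p / 2 + a + 1))"
    define W2 where "W2 = (1 + w) powr (- (p / 2 + a + 1 + 2))"
    have W0: "W0 > 0" "W2 > 0" using w by (auto simp: W0_def W2_def)
    have sq: "(1 / (snd z + 1))\<^sup>2 = (snd z + 1) powr (- 2)" if "snd z > 0" for z :: "real \<times> real"
      using that by (simp add: powr_minus_divide power_divide)
    have "cut_sq \<epsilon> x s (\<lambda>z. post_mean x (snd z) - bayes (x, s))
     + ennreal (1 / 2 * (norm d)\<^sup>2) * cut_mass \<epsilon> x s
     \<le> cut_sq \<epsilon> x s (\<lambda>z. post_mean x (snd z) - bayes (x, s) - d)
       + ennreal (16 * (norm x)\<^sup>2 * (A * (C2 * (S * W2)) + 3 * (E2 * S * W2) * (A * (C0 * (S * W0))) / (gamma_const 0 * S * (c * W0))))"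
    proof (rule kern_perturbation[OF s])
      show "(log_cutoff \<epsilon> z - max 0 ((1 + r) powr (- \<epsilon>) - 1 / 4))\<^sup>2 \<le> A * U z" if "fst z > 0" "snd z > 0" for z
        using log_cutoff_oscillation[OF \<epsilon> \<tau>(1) _ s w that] \<tau> unfolding A_def U_def r_def by simp
      show "(\<integral>\<^sup>+z. ennreal ((1 / (snd z + 1))\<^sup>2 * (A * U z) * kern x s (fst z) (snd z)) \<partial>pos_plane) \<le> ennreal (A * (C2 * (S * W2)))"
      proof -
        have "(\<integral>\<^sup>+z. ennreal ((1 / (snd z + 1))\<^sup>2 * (A * U z) * kern x s (fst z) (snd z)) \<partial>pos_plane)
          = (\<integral>\<^sup>+z. ennreal A * ennreal ((snd z + 1) powr (- 2) * U z * kern x s (fst z) (snd z)) \<partial>pos_plane)"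
          using A U by (intro nn_integral_cong) (auto simp: ennreal_mult[symmetric] space_pos2 sq[unfolded snd_conv] mult_ac powr_minus_divide power_divide)
        also have "\<dots> = ennreal A * (\<integral>\<^sup>+z. ennreal ((snd z + 1) powr (- 2) * U z * kern x s (fst z) (snd z)) \<partial>pos_plane)"
          by (rule nn_integral_cmult) measurable
        also have "\<dots> \<le> ennreal A * ennreal (C2 * (S * W2))"
          using C2(2)[OF s, of x] unfolding U_def S_def W2_def w_def by (intro mult_left_mono) auto
        also have "\<dots> = ennreal (A * (C2 * (S * W2)))" using A C2 S W0 by (simp add: ennreal_mult)
        finally show ?thesis .
      qed
      show "(\<integral>\<^sup>+z. ennreal (A * U z * kern x s (fst z) (snd z)) \<partial>pos_plane) \<le> ennreal (A * (C0 * (S * W0)))"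
      proof -
        have "(\<integral>\<^sup>+z. ennreal (A * U z * kern x s (fst z) (snd z)) \<partial>pos_plane)
          = (\<integral>\<^sup>+z. ennreal A * ennreal ((snd z + 1) powr (- 0) * U z * kern x s (fst z) (snd z)) \<partial>pos_plane)"
          using A U by (intro nn_integral_cong) (auto simp: ennreal_mult[symmetric] space_pos2 mult_ac)
        also have "\<dots> = ennreal A * (\<integral>\<^sup>+z. ennreal ((snd z + 1) powr (- 0) * U z * kern x s (fst z) (snd z)) \<partial>pos_plane)"
          by (rule nn_integral_cmult) measurable
        also have "\<dots> \<le> ennreal A * ennreal (C0 * (S * W0))"
          using C0(2)[OF s, of x] unfolding U_def S_def W0_def w_def by (intro mult_left_mono) auto
        also have "\<dots> = ennreal (A * (C0 * (S * W0)))" using A C0 S W0 by (simp add: ennreal_mult)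
        finally show ?thesis .
      qed
      show "(\<integral>\<^sup>+z. ennreal ((1 / (snd z + 1))\<^sup>2 * kern x s (fst z) (snd z)) \<partial>pos_plane) \<le> ennreal (E2 * S * W2)"
      proof -
        have "(\<integral>\<^sup>+z. ennreal ((1 / (snd z + 1))\<^sup>2 * kern x s (fst z) (snd z)) \<partial>pos_plane)
          = (\<integral>\<^sup>+z. ennreal ((snd z + 1) powr (- 2) * ((1 + w) / (snd z + 1)) powr 0 * (fst z * s) powr 0 * kern x s (fst z) (snd z)) \<partial>pos_plane)"
          using s w by (intro nn_integral_cong) (auto simp: space_pos2 powr_minus_divide power_divide)
        also have "\<dots> \<le> ennreal (E2 * S * W2)"
          unfolding E2_def S_def W2_def using kappa_gt p_ge a_ge by (intro nn_integral_kern_moment[OF s w_def]) auto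
        finally show ?thesis .
      qed
      show "ennreal (gamma_const 0 * S * (c * W0)) \<le> (\<integral>\<^sup>+z. ennreal (kern x s (fst z) (snd z)) \<partial>pos_plane)"
      proof -
        have "ennreal (gamma_const 0 * S * (c * W0)) = ennreal (gamma_const 0 * S) * ennreal (c * W0)"
          using g0 S c W0 by (intro ennreal_mult) auto
        also have "\<dots> \<le> ennreal (gamma_const 0 * S) * (\<integral>\<^sup>+g. ennreal (mix w g) \<partial>pos_lborel)"
          using c(2)[OF w] unfolding W0_def by (intro mult_left_mono) auto
        also have "(\<integral>\<^sup>+g. ennreal (mix w g) \<partial>pos_lborel) = (\<integral>\<^sup>+g. ennreal (1 * (1 + w / (g + 1)) powr (- 0) * mix w g) \<partial>pos_lborel)"
          using w by (intro nn_integral_cong) (auto simp: add_pos_nonneg less_imp_neq[symmetric])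
        also have "ennreal (gamma_const 0 * S) * \<dots> = (\<integral>\<^sup>+z. ennreal (1 * (fst z * s) powr 0 * kern x s (fst z) (snd z)) \<partial>pos_plane)"
          unfolding S_def w_def using kappa_gt by (intro nn_integral_kern_eq[OF s, symmetric]) auto
        also have "\<dots> = (\<integral>\<^sup>+z. ennreal (kern x s (fst z) (snd z)) \<partial>pos_plane)"
          using s by (intro nn_integral_cong) (auto simp: space_pos2)
        finally show ?thesis .
      qed
    qed (use \<epsilon> log_cutoff_nonneg log_cutoff_le_1 A C0(1) C2(1) E2 S W0 c(1) g0 in auto)
    also have "16 * (norm x)\<^sup>2 * (A * (C2 * (S * W2)) + 3 * (E2 * S * W2) * (A * (C0 * (S * W0))) / (gamma_const 0 * S * (c * W0)))
      \<le> C * (\<epsilon>\<^sup>2 * (1 + r) powr (- 2 - 2 * \<epsilon>) * (s powr (- p / 2 - 1) * (1 + w) powr (- p / 2)))"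
    proof -
      have "3 * (E2 * S * W2) * (A * (C0 * (S * W0))) / (gamma_const 0 * S * (c * W0)) = (A * (S * W2)) * (3 * E2 * C0 / (gamma_const 0 * c))"
        using S W0 g0 c by (simp add: field_simps)
      then have 1: "16 * (norm x)\<^sup>2 * (A * (C2 * (S * W2)) + 3 * (E2 * S * W2) * (A * (C0 * (S * W0))) / (gamma_const 0 * S * (c * W0)))
        = 16 * (A * (C2 + 3 * E2 * C0 / (gamma_const 0 * c))) * ((norm x)\<^sup>2 * (S * W2))"
        by (simp add: algebra_simps)
      \<comment> \<open>Conversion of the error to the energy weight: the factor \<open>s\<close>
        hidden in \<open>(norm x)\<^sup>2\<close> raises the power of \<open>s\<close> by one, and
        the factor \<open>w\<close> is set against the decay in \<open>W2\<close>.\<close>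
      have "(norm x)\<^sup>2 * S = w * s powr (- p / 2 - 1)"
      proof -
        have "s powr (- p / 2 - 1) = s * S" using s powr_mult_base[of s "- p / 2 - 2"] by (simp add: S_def minus_diff_commute)
        then show ?thesis using s by (simp add: w_def)
      qed
      moreover have "w * W2 \<le> (1 + w) powr (- p / 2)"
      proof -
        have "w * W2 \<le> (1 + w) * W2" using W0 by (intro mult_right_mono) auto
        also have "\<dots> = (1 + w) powr (- (p / 2 + a + 2))"
          using w powr_mult_base[of "1 + w" "- (p / 2 + a + 1 + 2)"] by (simp add: W2_def algebra_simps)
        \<comment> \<open>The lower bound on \<open>a\<close> is used here; at \<open>a = -2\<close>
          the two exponents coincide and no decay is given away.\<close>
        also have "\<dots> \<le> (1 + w) powr (- p / 2)" using w a_ge by (intro powr_mono) auto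
        finally show ?thesis .
      qed
      ultimately have nle: "s powr (- p / 2 - 1) * (w * W2) \<le> s powr (- p / 2 - 1) * (1 + w) powr (- p / 2)"
          and nS: "(norm x)\<^sup>2 * S = w * s powr (- p / 2 - 1)" by (auto intro: mult_left_mono)
      have "(norm x)\<^sup>2 * (S * W2) = s powr (- p / 2 - 1) * (w * W2)"
        unfolding mult.assoc[symmetric] nS by (simp only: mult_ac)
      with nle have 2: "(norm x)\<^sup>2 * (S * W2) \<le> s powr (- p / 2 - 1) * (1 + w) powr (- p / 2)" by (simp only:)
      have "16 * (A * (C2 + 3 * E2 * C0 / (gamma_const 0 * c))) * ((norm x)\<^sup>2 * (S * W2))
        \<le> 16 * (A * (C2 + 3 * E2 * C0 / (gamma_const 0 * c))) * (s powr (- p / 2 - 1) * (1 + w) powr (- p / 2))"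
        using 2 A C0(1) C2(1) E2 g0 c(1) by (intro mult_left_mono mult_nonneg_nonneg add_nonneg_nonneg divide_nonneg_nonneg) auto
      also have "\<dots> = C * (\<epsilon>\<^sup>2 * (1 + r) powr (- 2 - 2 * \<epsilon>) * (s powr (- p / 2 - 1) * (1 + w) powr (- p / 2)))"
        by (simp add: A_def C_def mult_ac)
      finally show ?thesis unfolding 1 .
    qed
    finally show "cut_sq \<epsilon> x s (\<lambda>z. post_mean x (snd z) - bayes (x, s))
     + ennreal (1 / 2 * (norm d)\<^sup>2) * cut_mass \<epsilon> x s
     \<le> cut_sq \<epsilon> x s (\<lambda>z. post_mean x (snd z) - bayes (x, s) - d)
       + ennreal (C * cut_energy \<epsilon> x s)"
      unfolding r_def w_def by (simp add: ennreal_leI add.assoc)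
  qed
qed

text \<open>Tonelli puts the integration over \<theta> innermost, where the posterior given \<eta>
  and \<open>g\<close> is normal. Bias and variance then separate, and the variance term does not
  depend on the estimator, so two estimators can be compared through their distances to the
  conditional posterior mean.\<close>

lemma integrated_risk:
  fixes \<delta> :: "(real ^ 'p) \<times> real \<Rightarrow> real ^ 'p"
  assumes est: "estimator \<delta>" and [measurable]: "W \<in> borel_measurable pos_plane" and W: "\<And>z. W z \<ge> 0"
  shows "(\<integral>\<^sup>+z. \<integral>\<^sup>+\<theta>. ennreal (W z / fst z * mixing_dens a b (snd z) * normal_dens 0 (fst z / snd z) \<theta>) * risk n \<delta> \<theta> (fst z) \<partial>lborel \<partial>pos_plane)
    = (\<integral>\<^sup>+u. \<integral>\<^sup>+z. ennreal (W z * (norm (post_mean (fst u) (snd z) - \<delta> u))\<^sup>2 * kern (fst u) (snd u) (fst z) (snd z)) \<partial>pos_plane \<partial>(lborel \<Otimes>\<^sub>M pos_lborel))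
    + (\<integral>\<^sup>+u. \<integral>\<^sup>+z. ennreal (W z * (p / (fst z * (snd z + 1) / snd z)) * kern (fst u) (snd u) (fst z) (snd z)) \<partial>pos_plane \<partial>(lborel \<Otimes>\<^sub>M pos_lborel))"
proof -
  let ?M = "lborel \<Otimes>\<^sub>M pos_lborel :: ((real ^ 'p) \<times> real) measure"
  have [measurable]: "\<delta> \<in> borel_measurable ?M" using est by (simp add: estimator_def)
  have n: "n > 0" using n_ge by simp
  interpret uz: pair_sigma_finite ?M pos_plane ..
  interpret uth: pair_sigma_finite ?M "lborel :: (real ^ 'p) measure" ..
  define F where "F = (\<lambda>z \<theta> u. ennreal (W z / fst z * mixing_dens a b (snd z) * normal_dens 0 (fst z / snd z) \<theta>)
      * ennreal (normal_dens \<theta> (fst z) (fst u) * chisq_dens n (fst z) (snd u) * (fst z * (norm (\<delta> u - \<theta>))\<^sup>2)))"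
  have inner: "(\<integral>\<^sup>+\<theta>. F z \<theta> u \<partial>lborel) = ennreal (W z * (norm (post_mean (fst u) (snd z) - \<delta> u))\<^sup>2 * kern (fst u) (snd u) (fst z) (snd z))
      + ennreal (W z * (p / (fst z * (snd z + 1) / snd z)) * kern (fst u) (snd u) (fst z) (snd z))"
    if z: "z \<in> space pos_plane" for z u
  proof -
    define \<eta> g where "\<eta> = fst z" and "g = snd z"
    have pos: "\<eta> > 0" "g > 0" using z by (auto simp: space_pos2 \<eta>_def g_def)
    define t where "t = \<eta> * (g + 1) / g"
    have t: "t > 0" using pos by (simp add: t_def)
    define k where "k = W z * kern (fst u) (snd u) \<eta> g"
    have k: "k \<ge> 0" using W by (simp add: k_def)
    have "F z \<theta> u = ennreal k * ennreal (normal_dens (post_mean (fst u) g) t \<theta> * (norm (\<theta> - \<delta> u))\<^sup>2)" for \<theta>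
    proof -
      have "W z / \<eta> * mixing_dens a b g * normal_dens 0 (\<eta> / g) \<theta> * (normal_dens \<theta> \<eta> (fst u) * chisq_dens n \<eta> (snd u) * (\<eta> * (norm (\<delta> u - \<theta>))\<^sup>2))
        = (normal_dens \<theta> \<eta> (fst u) * normal_dens 0 (\<eta> / g) \<theta>) * (W z * mixing_dens a b g * chisq_dens n \<eta> (snd u) * (norm (\<theta> - \<delta> u))\<^sup>2)"
        using pos by (simp add: norm_minus_commute)
      also have "\<dots> = k * (normal_dens (post_mean (fst u) g) t \<theta> * (norm (\<theta> - \<delta> u))\<^sup>2)"
        unfolding normal_dens_mult[OF pos] k_def kern_def t_def by (simp add: mult_ac)
      finally show ?thesis
        unfolding F_def \<eta>_def[symmetric] g_def[symmetric] using W pos k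
        by (simp add: ennreal_mult[symmetric])
    qed
    then have "(\<integral>\<^sup>+\<theta>. F z \<theta> u \<partial>lborel) = ennreal k * ennreal ((norm (post_mean (fst u) g - \<delta> u))\<^sup>2 + p / t)"
      by (simp add: nn_integral_cmult nn_integral_normal_dens_sq_dist[OF t] p_eq)
    also have "\<dots> = ennreal (k * (norm (post_mean (fst u) g - \<delta> u))\<^sup>2 + k * (p / t))"
      using k t p_ge by (simp add: ennreal_mult[symmetric] distrib_left)
    also have "\<dots> = ennreal (k * (norm (post_mean (fst u) g - \<delta> u))\<^sup>2) + ennreal (k * (p / t))"
      using k t p_ge by (intro ennreal_plus mult_nonneg_nonneg divide_nonneg_nonneg) auto
    finally show ?thesis unfolding k_def t_def \<eta>_def g_def by (simp add: mult_ac)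
  qed
  \<comment> \<open>Stated for arbitrary measurable arguments because \<open>F\<close> occurs below
    under iterated integrals in three different orders.\<close>
  have [measurable]: "(\<lambda>v. F (f v) (h v) (q v)) \<in> borel_measurable N"
    if f: "f \<in> N \<rightarrow>\<^sub>M pos_plane" and [measurable]: "h \<in> borel_measurable N" and q: "q \<in> N \<rightarrow>\<^sub>M ?M" for f h q and N :: "'z measure"
  proof -
    have [measurable]: "(\<lambda>v. W (f v)) \<in> borel_measurable N" "(\<lambda>v. fst (f v)) \<in> borel_measurable N" "(\<lambda>v. snd (f v)) \<in> borel_measurable N"
      by (rule measurable_compose[OF f], measurable)+
    have [measurable]: "(\<lambda>v. \<delta> (q v)) \<in> borel_measurable N" "(\<lambda>v. fst (q v)) \<in> borel_measurable N" "(\<lambda>v. snd (q v)) \<in> borel_measurable N"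
      by (rule measurable_compose[OF q], measurable)+
    show ?thesis unfolding F_def by measurable
  qed
  have "(\<integral>\<^sup>+z. \<integral>\<^sup>+\<theta>. ennreal (W z / fst z * mixing_dens a b (snd z) * normal_dens 0 (fst z / snd z) \<theta>) * risk n \<delta> \<theta> (fst z) \<partial>lborel \<partial>pos_plane)
    = (\<integral>\<^sup>+z. \<integral>\<^sup>+\<theta>. \<integral>\<^sup>+u. F z \<theta> u \<partial>?M \<partial>lborel \<partial>pos_plane)"
  proof (rule nn_integral_cong, rule nn_integral_cong)
    fix z \<theta> assume "z \<in> space pos_plane"
    then have "fst z > 0" by (auto simp: space_pos2)
    then show "ennreal (W z / fst z * mixing_dens a b (snd z) * normal_dens 0 (fst z / snd z) \<theta>) * risk n \<delta> \<theta> (fst z) = (\<integral>\<^sup>+u. F z \<theta> u \<partial>?M)"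
      unfolding F_def risk_eq[OF est \<open>fst z > 0\<close> n] by (subst nn_integral_cmult) auto
  qed
  also have "\<dots> = (\<integral>\<^sup>+z. \<integral>\<^sup>+u. \<integral>\<^sup>+\<theta>. F z \<theta> u \<partial>lborel \<partial>?M \<partial>pos_plane)"
  proof (rule nn_integral_cong)
    fix z assume [measurable]: "z \<in> space pos_plane"
    show "(\<integral>\<^sup>+\<theta>. \<integral>\<^sup>+u. F z \<theta> u \<partial>?M \<partial>lborel) = (\<integral>\<^sup>+u. \<integral>\<^sup>+\<theta>. F z \<theta> u \<partial>lborel \<partial>?M)"
      by (rule uth.Fubini') measurable
  qed
  also have "\<dots> = (\<integral>\<^sup>+u. \<integral>\<^sup>+z. \<integral>\<^sup>+\<theta>. F z \<theta> u \<partial>lborel \<partial>pos_plane \<partial>?M)"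
    by (rule uz.Fubini') measurable
  also have "\<dots> = (\<integral>\<^sup>+u. (\<integral>\<^sup>+z. ennreal (W z * (norm (post_mean (fst u) (snd z) - \<delta> u))\<^sup>2 * kern (fst u) (snd u) (fst z) (snd z))
      + ennreal (W z * (p / (fst z * (snd z + 1) / snd z)) * kern (fst u) (snd u) (fst z) (snd z)) \<partial>pos_plane) \<partial>?M)"
    by (intro nn_integral_cong inner)
  also have "\<dots> = (\<integral>\<^sup>+u. (\<integral>\<^sup>+z. ennreal (W z * (norm (post_mean (fst u) (snd z) - \<delta> u))\<^sup>2 * kern (fst u) (snd u) (fst z) (snd z)) \<partial>pos_plane)
      + (\<integral>\<^sup>+z. ennreal (W z * (p / (fst z * (snd z + 1) / snd z)) * kern (fst u) (snd u) (fst z) (snd z)) \<partial>pos_plane) \<partial>?M)"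
    by (intro nn_integral_cong nn_integral_add) measurable
  also have "\<dots> = (\<integral>\<^sup>+u. \<integral>\<^sup>+z. ennreal (W z * (norm (post_mean (fst u) (snd z) - \<delta> u))\<^sup>2 * kern (fst u) (snd u) (fst z) (snd z)) \<partial>pos_plane \<partial>?M)
      + (\<integral>\<^sup>+u. \<integral>\<^sup>+z. ennreal (W z * (p / (fst z * (snd z + 1) / snd z)) * kern (fst u) (snd u) (fst z) (snd z)) \<partial>pos_plane \<partial>?M)"
    by (rule nn_integral_add) measurable
  finally show ?thesis .
qed

end

lemma
  assumes "A \<in> sets borel" "A \<subseteq> {0<..}"
  shows sets_pos_lborelI: "A \<in> sets pos_lborel"
    and emeasure_pos_lborel: "emeasure pos_lborel A = emeasure lborel A"
  using assms unfolding pos_lborel_def by (auto simp: sets_restrict_space_iff emeasure_restrict_space)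

section \<open>Blyth's argument and the choice of parameters\<close>

context scale_mixture begin

text \<open>The support of the cutoff is bounded in logarithmic coordinates, hence \<eta> stays
  between \<open>exp (- R)\<close> and \<open>exp R\<close> and \<open>g\<close> below
  \<open>exp R\<close>. There \<open>1 / \<eta>\<close> is at most \<open>exp R\<close> and, because
  \<open>a \<ge> -2\<close>, the mixing density is at most 1.\<close>

lemma log_cutoff_prior_mass_finite:
  assumes \<epsilon>: "\<epsilon> > 0"
  shows "(\<integral>\<^sup>+z. ennreal ((log_cutoff \<epsilon> z)\<^sup>2 / fst z * mixing_dens a b (snd z)) \<partial>pos_plane) < \<infinity>"
proof -
  define R where "R = 4 powr (1 / \<epsilon>)"
  define A where "A = {exp (- R)..exp R}"
  define B where "B = {0<..exp R}"
  have A: "A \<in> sets borel" "A \<subseteq> {0<..}" by (auto simp: A_def intro: less_le_trans[OF exp_gt_zero])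
  have B: "B \<in> sets borel" "B \<subseteq> {0<..}" by (auto simp: B_def)
  note AB [measurable] = sets_pos_lborelI[OF A] sets_pos_lborelI[OF B]
  have "(\<integral>\<^sup>+z. ennreal ((log_cutoff \<epsilon> z)\<^sup>2 / fst z * mixing_dens a b (snd z)) \<partial>pos_plane)
    \<le> (\<integral>\<^sup>+z. ennreal (exp R) * indicator (A \<times> B) z \<partial>pos_plane)"
  proof (rule nn_integral_mono)
    fix z assume "z \<in> space pos_plane"
    then have z: "fst z > 0" "snd z > 0" by (auto simp: space_pos2)
    show "ennreal ((log_cutoff \<epsilon> z)\<^sup>2 / fst z * mixing_dens a b (snd z)) \<le> ennreal (exp R) * indicator (A \<times> B) z"
    proof (cases "log_cutoff \<epsilon> z = 0")
      case False
      then have "\<bar>ln (fst z)\<bar> + ln (snd z + 1) < R"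
        using log_cutoff_eq_0[OF \<epsilon>, of z] unfolding R_def by linarith
      moreover have "ln (snd z + 1) \<ge> 0" using z by simp
      ultimately have "- R \<le> ln (fst z)" "ln (fst z) \<le> R" "ln (snd z + 1) \<le> R" by linarith+
      then have f: "exp (- R) \<le> fst z" "fst z \<le> exp R" "snd z + 1 \<le> exp R"
        using z by (auto simp: ln_ge_iff ln_le_cancel_iff[symmetric, of _ "exp R"])
      then have "z \<in> A \<times> B" using z by (cases z) (auto simp: A_def B_def)
      moreover have "(log_cutoff \<epsilon> z)\<^sup>2 / fst z * mixing_dens a b (snd z) \<le> 1 / exp (- R) * 1"
      proof (intro mult_mono frac_le)
        show "(log_cutoff \<epsilon> z)\<^sup>2 \<le> 1" using log_cutoff_le_1[OF \<epsilon> z(2)] log_cutoff_nonneg[of \<epsilon> z] by (simp add: power_le_one)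
        have "(snd z + 1) powr (- a - 2) \<le> (snd z + 1) powr 0" using z a_ge by (intro powr_mono) auto
        then show "mixing_dens a b (snd z) \<le> 1" using mixing_dens_le[OF z(2) b_ge, of a] z by simp
      qed (use z f in auto)
      moreover have "1 / exp (- R) * 1 = exp R" by (simp add: exp_minus divide_inverse)
      ultimately show ?thesis by (simp add: ennreal_leI)
    qed auto
  qed
  also have "\<dots> = ennreal (exp R) * (emeasure lborel A * emeasure lborel B)"
    by (subst nn_integral_cmult_indicator)
       (auto simp: pos_lborel.emeasure_pair_measure_Times emeasure_pos_lborel[OF A] emeasure_pos_lborel[OF B])
  also have "\<dots> < \<infinity>" by (auto simp: A_def B_def ennreal_mult_less_top emeasure_lborel_Icc_eq)
  finally show ?thesis .
qed

text \<open>Blyth's method: any competitor has to coincide with the generalized Bayes rule because its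
  squared distance to it is bounded by the energy of the cutoff, which tends to \<open>0\<close>.\<close>

lemma dominating_estimator_unique:
  fixes \<delta> :: "(real ^ 'p) \<times> real \<Rightarrow> real ^ 'p"
  assumes fin: "\<And>\<theta> \<eta>. \<eta> > 0 \<Longrightarrow> risk n bayes \<theta> \<eta> \<le> ennreal p"
    and est: "estimator \<delta>" and dom: "\<And>\<theta> \<eta>. \<eta> > 0 \<Longrightarrow> risk n \<delta> \<theta> \<eta> \<le> risk n bayes \<theta> \<eta>"
  shows "AE u in lborel \<Otimes>\<^sub>M pos_lborel. \<delta> u = bayes u"
proof -
  let ?M = "lborel \<Otimes>\<^sub>M pos_lborel :: ((real ^ 'p) \<times> real) measure"
  have [measurable]: "\<delta> \<in> borel_measurable ?M" "bayes \<in> borel_measurable ?M"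
    using est estimator_bayes by (simp_all add: estimator_def)
  define d where "d = (\<lambda>u. \<delta> u - bayes u)"
  have [measurable]: "d \<in> borel_measurable ?M" unfolding d_def by measurable
  \<comment> \<open>A region of positive measure where
    \<open>\<bar>ln \<eta>\<bar> + ln (g + 1) \<le> 1\<close>, so the squared cutoff is at least
    1/16 for every \<epsilon> considered. This makes \<open>X\<close> independent of
    \<epsilon>.\<close>
  define box where "box = {1..3/2 :: real} \<times> {0<..1/2 :: real}"
  have b1: "{1..3/2 :: real} \<in> sets borel" "{1..3/2 :: real} \<subseteq> {0<..}" by auto
  have b2: "{0<..1/2 :: real} \<in> sets borel" "{0<..1/2 :: real} \<subseteq> {0<..}" by auto
  have box [measurable]: "box \<in> sets pos_plane"
    unfolding box_def by (intro pair_measureI sets_pos_lborelI b1 b2)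
  define X where "X = (\<integral>\<^sup>+u. ennreal (1 / 2 * (norm (d u))\<^sup>2) * (\<integral>\<^sup>+z. ennreal (1 / 16 * (indicator box z * kern (fst u) (snd u) (fst z) (snd z))) \<partial>pos_plane) \<partial>?M)"
  obtain C where C: "C \<ge> 0" "\<And>\<epsilon> (x :: real ^ 'p) s d. 0 < \<epsilon> \<Longrightarrow> \<epsilon> \<le> 1 \<Longrightarrow> s > 0 \<Longrightarrow>
    cut_sq \<epsilon> x s (\<lambda>z. post_mean x (snd z) - bayes (x, s))
     + ennreal (1 / 2 * (norm d)\<^sup>2) * cut_mass \<epsilon> x s
     \<le> cut_sq \<epsilon> x s (\<lambda>z. post_mean x (snd z) - bayes (x, s) - d)
       + ennreal (C * cut_energy \<epsilon> x s)"
    using cutoff_perturbation by blast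
  define V where "V = C * (p * unit_ball_vol p / 2)"
  have Xle: "X \<le> ennreal (V * \<epsilon>)" if \<epsilon>: "0 < \<epsilon>" "\<epsilon> \<le> 1" for \<epsilon>
  proof -
    define W where "W = (\<lambda>z. (log_cutoff \<epsilon> z)\<^sup>2)"
    have [measurable]: "W \<in> borel_measurable pos_plane" unfolding W_def by measurable
    have W0: "W z \<ge> 0" for z by (simp add: W_def)
    define T where "T = (\<lambda>f. \<integral>\<^sup>+u. \<integral>\<^sup>+z. ennreal (W z * (norm (post_mean (fst u) (snd z) - f u))\<^sup>2 * kern (fst u) (snd u) (fst z) (snd z)) \<partial>pos_plane \<partial>?M)"
    define N where "N = (\<integral>\<^sup>+u. \<integral>\<^sup>+z. ennreal (W z * (p / (fst z * (snd z + 1) / snd z)) * kern (fst u) (snd u) (fst z) (snd z)) \<partial>pos_plane \<partial>?M)"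
    define I where "I = (\<lambda>f :: (real ^ 'p) \<times> real \<Rightarrow> real ^ 'p. \<integral>\<^sup>+z. \<integral>\<^sup>+\<theta>. ennreal (W z / fst z * mixing_dens a b (snd z) * normal_dens 0 (fst z / snd z) \<theta>) * risk n f \<theta> (fst z) \<partial>lborel \<partial>pos_plane)"
    have I: "I f = T f + N" if "estimator f" for f :: "(real ^ 'p) \<times> real \<Rightarrow> real ^ 'p"
      unfolding I_def T_def N_def by (rule integrated_risk[OF that _ W0]) measurable
    have "I \<delta> \<le> I bayes"
      unfolding I_def
    proof (rule nn_integral_mono, rule nn_integral_mono)
      fix z \<theta> assume "z \<in> space pos_plane"
      then have "fst z > 0" by (auto simp: space_pos2)
      then show "ennreal (W z / fst z * mixing_dens a b (snd z) * normal_dens 0 (fst z / snd z) \<theta>) * risk n \<delta> \<theta> (fst z)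
        \<le> ennreal (W z / fst z * mixing_dens a b (snd z) * normal_dens 0 (fst z / snd z) \<theta>) * risk n bayes \<theta> (fst z)"
        by (intro mult_left_mono dom) auto
    qed
    \<comment> \<open>The uniform risk bound enters here: the truncated prior has finite mass, so
      the integrated risk is finite although the full prior is improper.\<close>
    moreover have "I bayes < \<infinity>"
    proof -
      have "I bayes \<le> (\<integral>\<^sup>+z. ennreal p * ennreal (W z / fst z * mixing_dens a b (snd z)) \<partial>pos_plane)"
        unfolding I_def
      proof (rule nn_integral_mono)
        fix z assume "z \<in> space pos_plane"
        then have z: "fst z > 0" "snd z > 0" by (auto simp: space_pos2)
        define c where "c = W z / fst z * mixing_dens a b (snd z)"
        have c: "c \<ge> 0" using W0 z by (simp add: c_def)
        have "(\<integral>\<^sup>+\<theta>. ennreal (c * normal_dens 0 (fst z / snd z) \<theta>) * risk n bayes \<theta> (fst z) \<partial>lborel)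
          \<le> (\<integral>\<^sup>+(\<theta> :: real ^ 'p). (ennreal p * ennreal c) * ennreal (normal_dens 0 (fst z / snd z) \<theta>) \<partial>lborel)"
        proof (rule nn_integral_mono)
          fix \<theta> :: "real ^ 'p"
          have "ennreal (c * normal_dens 0 (fst z / snd z) \<theta>) * risk n bayes \<theta> (fst z) \<le> ennreal (c * normal_dens 0 (fst z / snd z) \<theta>) * ennreal p"
            using fin[OF z(1)] by (intro mult_left_mono) auto
          also have "\<dots> = (ennreal p * ennreal c) * ennreal (normal_dens 0 (fst z / snd z) \<theta>)"
            using c by (simp add: ennreal_mult mult_ac)
          finally show "ennreal (c * normal_dens 0 (fst z / snd z) \<theta>) * risk n bayes \<theta> (fst z) \<le> \<dots>" .
        qed
        also have "\<dots> = ennreal p * ennreal c"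
          using z by (subst nn_integral_cmult) (auto simp: nn_integral_normal_dens)
        finally show "(\<integral>\<^sup>+\<theta>. ennreal (W z / fst z * mixing_dens a b (snd z) * normal_dens 0 (fst z / snd z) \<theta>) * risk n bayes \<theta> (fst z) \<partial>lborel)
          \<le> ennreal p * ennreal (W z / fst z * mixing_dens a b (snd z))" unfolding c_def .
      qed
      also have "\<dots> = ennreal p * (\<integral>\<^sup>+z. ennreal (W z / fst z * mixing_dens a b (snd z)) \<partial>pos_plane)"
        by (rule nn_integral_cmult) measurable
      also have "\<dots> < \<infinity>"
        using log_cutoff_prior_mass_finite[OF \<epsilon>(1)] unfolding W_def by (auto simp: ennreal_mult_less_top)
      finally show ?thesis .
    qed
    \<comment> \<open>Finiteness permits the cancellation of the common variance term
      \<open>N\<close> in extended reals.\<close>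
    ultimately have T: "T \<delta> \<le> T bayes" and Tfin: "T bayes < \<infinity>"
      unfolding I[OF est] I[OF estimator_bayes] by (auto simp: add.commute[of _ N] ennreal_add_left_cancel_le)
    define e where "e = (\<lambda>u :: (real ^ 'p) \<times> real. \<epsilon>\<^sup>2 * (1 + \<bar>ln (snd u)\<bar> + ln (1 + (norm (fst u))\<^sup>2 / snd u)) powr (- 2 - 2 * \<epsilon>)
            * (snd u powr (- p / 2 - 1) * (1 + (norm (fst u))\<^sup>2 / snd u) powr (- p / 2)))"
    have [measurable]: "e \<in> borel_measurable ?M" unfolding e_def by measurable
    define Y where "Y = (\<integral>\<^sup>+u. ennreal (1 / 2 * (norm (d u))\<^sup>2) * (\<integral>\<^sup>+z. ennreal (W z * kern (fst u) (snd u) (fst z) (snd z)) \<partial>pos_plane) \<partial>?M)"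
    have "T bayes + Y = (\<integral>\<^sup>+u. (\<integral>\<^sup>+z. ennreal (W z * (norm (post_mean (fst u) (snd z) - bayes u))\<^sup>2 * kern (fst u) (snd u) (fst z) (snd z)) \<partial>pos_plane)
        + ennreal (1 / 2 * (norm (d u))\<^sup>2) * (\<integral>\<^sup>+z. ennreal (W z * kern (fst u) (snd u) (fst z) (snd z)) \<partial>pos_plane) \<partial>?M)"
      unfolding T_def Y_def by (rule nn_integral_add[symmetric]) measurable
    also have "\<dots> \<le> (\<integral>\<^sup>+u. (\<integral>\<^sup>+z. ennreal (W z * (norm (post_mean (fst u) (snd z) - \<delta> u))\<^sup>2 * kern (fst u) (snd u) (fst z) (snd z)) \<partial>pos_plane)
        + ennreal C * ennreal (e u) \<partial>?M)"
    proof (rule nn_integral_mono)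
      fix u assume "u \<in> space ?M"
      then obtain x s where u: "u = (x, s)" and s: "s > 0" by (auto simp: space_pair_measure)
      have 1: "post_mean x g - bayes (x, s) - d (x, s) = post_mean x g - \<delta> (x, s)" for g by (simp add: d_def)
      have "e u \<ge> 0" by (simp add: e_def)
      then have 2: "ennreal (C * e u) = ennreal C * ennreal (e u)" using C(1) by (intro ennreal_mult) auto
      show "(\<integral>\<^sup>+z. ennreal (W z * (norm (post_mean (fst u) (snd z) - bayes u))\<^sup>2 * kern (fst u) (snd u) (fst z) (snd z)) \<partial>pos_plane)
        + ennreal (1 / 2 * (norm (d u))\<^sup>2) * (\<integral>\<^sup>+z. ennreal (W z * kern (fst u) (snd u) (fst z) (snd z)) \<partial>pos_plane)
        \<le> (\<integral>\<^sup>+z. ennreal (W z * (norm (post_mean (fst u) (snd z) - \<delta> u))\<^sup>2 * kern (fst u) (snd u) (fst z) (snd z)) \<partial>pos_plane)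
        + ennreal C * ennreal (e u)"
        using C(2)[OF \<epsilon> s, of x "d (x, s)"] unfolding 1 2[symmetric] unfolding W_def e_def u by simp
    qed
    also have "\<dots> = T \<delta> + (\<integral>\<^sup>+u. ennreal C * ennreal (e u) \<partial>?M)"
      unfolding T_def by (rule nn_integral_add) measurable
    also have "\<dots> \<le> T bayes + (\<integral>\<^sup>+u. ennreal C * ennreal (e u) \<partial>?M)"
      using T by (rule add_right_mono)
    \<comment> \<open>Since \<open>T bayes\<close> is finite it cancels, and the gain in
      \<open>d\<close> is left against the energy alone.\<close>
    finally have "Y \<le> (\<integral>\<^sup>+u. ennreal C * ennreal (e u) \<partial>?M)"
      using Tfin by (auto simp: ennreal_add_left_cancel_le)
    also have "\<dots> = ennreal C * (\<integral>\<^sup>+u. ennreal (e u) \<partial>?M)" by (rule nn_integral_cmult) measurable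
    also have "\<dots> \<le> ennreal C * ennreal (p * unit_ball_vol p / 2 * \<epsilon>)"
      using nn_integral_energy[where 'p='p, OF \<epsilon>(1)] p_ge p_eq unfolding e_def by (intro mult_left_mono) auto
    also have "\<dots> = ennreal (V * \<epsilon>)"
      using C(1) by (simp add: V_def ennreal_mult'[symmetric] mult_ac)
    finally have "Y \<le> ennreal (V * \<epsilon>)" .
    moreover have "X \<le> Y"
      unfolding X_def Y_def
    proof (intro nn_integral_mono mult_left_mono ennreal_leI)
      fix u :: "(real ^ 'p) \<times> real" and z assume "z \<in> space pos_plane"
      then have z: "fst z > 0" "snd z > 0" by (auto simp: space_pos2)
      have "1 / 16 * indicator box z \<le> W z"
      proof (cases "z \<in> box")
        case True
        then have "fst z \<ge> 1" "fst z \<le> 3 / 2" "snd z \<le> 1 / 2" by (auto simp: box_def)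
        moreover from this have "ln (fst z) \<ge> 0" "ln (fst z) \<le> fst z - 1" "ln (snd z + 1) \<le> snd z"
          using z ln_le_minus_one[of "fst z"] ln_add_one_self_le_self[of "snd z"] by (auto simp: add.commute)
        ultimately have "\<bar>ln (fst z)\<bar> + ln (snd z + 1) \<le> 1" by linarith
        then have "1 / 4 \<le> log_cutoff \<epsilon> z" using \<epsilon> z by (intro log_cutoff_ge) auto
        then have "(1 / 4)\<^sup>2 \<le> W z" unfolding W_def by (intro power_mono) auto
        then show ?thesis by (simp add: power2_eq_square indicator_def)
      qed (simp add: W0)
      from mult_right_mono[OF this, of "kern (fst u) (snd u) (fst z) (snd z)"]
      show "1 / 16 * (indicator box z * kern (fst u) (snd u) (fst z) (snd z)) \<le> W z * kern (fst u) (snd u) (fst z) (snd z)"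
        by simp
    qed auto
    ultimately show ?thesis by simp
  qed
  \<comment> \<open>As \<epsilon> tends to 0 the bound vanishes. The inner integral of
    \<open>X\<close> is positive at every data point, so \<open>d\<close> must vanish almost
    everywhere.\<close>
  have "X \<le> ennreal (V * 0)"
  proof (rule tendsto_lowerbound)
    show "((\<lambda>\<epsilon>. ennreal (V * \<epsilon>)) \<longlongrightarrow> ennreal (V * 0)) (at_right 0)"
      by (intro tendsto_ennrealI tendsto_intros)
    show "\<forall>\<^sub>F \<epsilon> in at_right 0. X \<le> ennreal (V * \<epsilon>)"
      using eventually_at_right_real[of 0 "1 :: real"] by (auto elim!: eventually_mono intro!: Xle)
  qed simp
  then have "X = 0" by simp
  then have ae: "AE u in ?M. ennreal (1 / 2 * (norm (d u))\<^sup>2) * (\<integral>\<^sup>+z. ennreal (1 / 16 * (indicator box z * kern (fst u) (snd u) (fst z) (snd z))) \<partial>pos_plane) = 0"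
    unfolding X_def by (subst (asm) nn_integral_0_iff_AE) measurable
  have kpos: "(\<integral>\<^sup>+z. ennreal (1 / 16 * (indicator box z * kern x s (fst z) (snd z))) \<partial>pos_plane) \<noteq> 0" if s: "s > 0" for x :: "real ^ 'p" and s
  proof
    assume "(\<integral>\<^sup>+z. ennreal (1 / 16 * (indicator box z * kern x s (fst z) (snd z))) \<partial>pos_plane) = 0"
    then have "AE z in pos_plane. ennreal (1 / 16 * (indicator box z * kern x s (fst z) (snd z))) = 0"
      by (subst (asm) nn_integral_0_iff_AE) measurable
    moreover have "AE z in pos_plane. z \<in> space pos_plane" by (rule AE_space)
    ultimately have "AE z in pos_plane. z \<notin> box"
    proof eventually_elim
      case (elim z)
      then have "kern x s (fst z) (snd z) > 0" using s by (intro kern_pos) (auto simp: space_pos2)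
      with elim show ?case by (auto simp: indicator_def ennreal_eq_0_iff split: if_splits)
    qed
    then have "emeasure pos_plane box = 0"
      using AE_iff_measurable[OF box, of "\<lambda>z. z \<notin> box"] sets.sets_into_space[OF box] by auto
    moreover have "emeasure pos_plane box = emeasure lborel {1..3/2 :: real} * emeasure lborel {0<..1/2 :: real}"
      unfolding box_def using sets_pos_lborelI[OF b1] sets_pos_lborelI[OF b2]
      by (simp add: pos_lborel.emeasure_pair_measure_Times emeasure_pos_lborel[OF b1] emeasure_pos_lborel[OF b2])
    ultimately show False by (simp add: ennreal_mult[symmetric])
  qed
  from ae AE_space show ?thesis
  proof eventually_elim
    case (elim u)
    then have "snd u > 0" by (auto simp: space_pair_measure)
    from kpos[OF this, of "fst u"] elim have "ennreal (1 / 2 * (norm (d u))\<^sup>2) = 0" by simp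
    then have "norm (d u) = 0" by (simp add: ennreal_eq_0_iff)
    then show ?case by (simp add: d_def)
  qed
qed

text \<open>An estimator that is nowhere worse agrees almost everywhere with the generalized Bayes
  rule and therefore has the same risk function, so a strict improvement at some parameter is
  impossible.\<close>

lemma admissible_bayes:
  assumes fin: "\<And>\<theta> \<eta>. \<eta> > 0 \<Longrightarrow> risk n bayes \<theta> \<eta> \<le> ennreal p"
  shows "admissible n bayes"
  unfolding admissible_def
proof (intro conjI estimator_bayes notI)
  have n: "n > 0" using n_ge by simp
  assume "\<exists>\<delta>'. estimator \<delta>' \<and> (\<forall>\<theta>. \<forall>\<eta>>0. risk n \<delta>' \<theta> \<eta> \<le> risk n bayes \<theta> \<eta>) \<and> (\<exists>\<theta>. \<exists>\<eta>>0. risk n \<delta>' \<theta> \<eta> < risk n bayes \<theta> \<eta>)"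
  then obtain \<delta> \<theta> \<eta> where est: "estimator \<delta>" and dom: "\<And>\<theta> \<eta>. \<eta> > 0 \<Longrightarrow> risk n \<delta> \<theta> \<eta> \<le> risk n bayes \<theta> \<eta>"
    and \<eta>: "\<eta> > 0" and strict: "risk n \<delta> \<theta> \<eta> < risk n bayes \<theta> \<eta>" by blast
  have "risk n \<delta> \<theta> \<eta> = risk n bayes \<theta> \<eta>"
    unfolding risk_eq[OF est \<eta> n] risk_eq[OF estimator_bayes \<eta> n]
    using dominating_estimator_unique[OF fin est dom] by (intro nn_integral_cong_AE) (auto elim!: eventually_mono)
  with strict show False by simp
qed

text \<open>After clearing denominators, the comparison of the limit of \<open>w * mixmean w\<close>
  with Baranchik's constant is linear in \<open>a + 2\<close> and is equivalent to
  \<open>a \<le> \<xi>\<close>.\<close>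

lemma risk_bayes_le:
  assumes a: "a \<le> \<xi> CARD('p) n" and \<eta>: "\<eta> > 0"
  shows "risk n bayes \<theta> \<eta> \<le> ennreal p"
proof -
  have bd: "(p / 2 + a + 1) / (real n / 2 - a - 1) \<le> 2 * (p - 2) / (real n + 2)"
  proof -
    define c where "c = a + 2"
    have D: "2 * p + real n - 2 > 0" using p_ge by simp
    have "c \<le> (p - 2) * (real n + 2) / (2 * (2 * p + real n - 2))" using a by (simp add: \<xi>_def c_def p_eq)
    then have "c * (2 * (2 * p + real n - 2)) \<le> (p - 2) * (real n + 2)" using D by (simp add: pos_le_divide_eq)
    then have "(p / 2 + a + 1) * (real n + 2) \<le> 2 * (p - 2) * (real n / 2 - a - 1)"
      unfolding c_def by (simp add: algebra_simps)
    moreover have "real n / 2 - a - 1 > 0" using a_less by simp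
    ultimately show ?thesis by (simp add: divide_le_eq pos_le_divide_eq mult.commute)
  qed
  have "risk n bayes \<theta> \<eta> \<le> ennreal (real CARD('p))"
  proof (rule baranchik_risk_le[where Q = mixmean])
    show "n > 0" using n_ge by simp
    show "2 \<le> CARD('p)" using p_ge p_eq by simp
    show "bayes (x, s) = (1 - mixmean ((norm x)\<^sup>2 / s)) *\<^sub>R x" if "s > 0" for x s using that by (rule gen_bayes_prior)
    show "w * mixmean w \<le> 2 * (real CARD('p) - 2) / (real n + 2)" if "w \<ge> 0" for w
      using shrinkage_le[OF that] bd p_eq by simp
  qed (use \<eta> estimator_bayes mixmean_nonneg mixmean_less_1 shrinkage_mono in \<open>auto intro: less_imp_le\<close>)
  then show ?thesis by (simp add: p_eq)
qed

end

text \<open>The bound by \<xi> is stronger than \<open>a_less\<close>: for \<open>n \<ge> 2\<close>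
  one has \<open>n + 2 \<le> 2 * n\<close>, so \<open>(p - 2) * (n + 2)\<close> is at most
  \<open>2 * n * (p - 2)\<close> and hence below \<open>n * (2 * p + n - 2)\<close>.\<close>

lemma scale_mixture_of_xi:
  assumes "CARD('p :: finite) \<ge> 3" "n \<ge> 2" "-2 \<le> a" "a \<le> \<xi> CARD('p) n" "b \<ge> 0"
  shows "scale_mixture TYPE('p) (real CARD('p)) n a b"
proof
  define p where "p = real CARD('p)"
  have p: "p \<ge> 3" using assms(1) by (simp add: p_def)
  have n: "real n \<ge> 2" using assms(2) by simp
  have D: "2 * (2 * p + real n - 2) > 0" using p n by simp
  have "(p - 2) * (real n + 2) \<le> (p - 2) * (2 * real n)" using p n by (intro mult_left_mono) auto
  also have "\<dots> < real n / 2 * (2 * (2 * p + real n - 2))"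
  proof -
    have "real n * real n > 0" using n by simp
    moreover have "real n * p \<ge> 0" using p by simp
    ultimately show ?thesis by (simp add: algebra_simps)
  qed
  finally have "(p - 2) * (real n + 2) / (2 * (2 * p + real n - 2)) < real n / 2"
    using D by (simp add: pos_divide_less_eq)
  moreover have "a + 2 \<le> (p - 2) * (real n + 2) / (2 * (2 * p + real n - 2))"
    using assms(4) unfolding \<xi>_def p_def by linarith
  ultimately show "a + 2 < real n / 2" by linarith
qed (use assms in auto)

theorem theorem1p2:
  fixes n :: nat and a b :: real and \<nu> :: "((real ^ 'p) \<times> real) measure"
  assumes "CARD('p) \<ge> 3" and "n \<ge> 2"
    and "-2 \<le> a" and "a \<le> \<xi> CARD('p) n" and "b \<ge> 0"
    and "\<nu> = prior_measure a b"
  shows "minimax n (gen_bayes n \<nu>) \<and> admissible n (gen_bayes n \<nu>)"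
proof -
  interpret scale_mixture "TYPE('p)" "real CARD('p)" n a b
    using assms by (intro scale_mixture_of_xi) auto
  have "n > 0" using assms by simp
  then show ?thesis
    unfolding assms(6) using assms(4)
    by (intro conjI minimax_of_risk_le admissible_bayes estimator_bayes risk_bayes_le) auto
qed

end
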